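(* Let $r,d\in\mathbb{N}$, $d\ge3$, let $0\le k_1<k_2<\dots<k_d=r$ be integers, $\mathbf{k}=(k_1,\dots,k_d)$, $\mathbf{k}^2=(k_2,\dots,k_d)$, and let $M_{\mathbf{k}}=\{M_{k_1},\dots,M_{k_d}\}$ be positive numbers, $M_{\mathbf{k}^2}=\{M_{k_2},\dots,M_{k_d}\}$. Then $M_{\mathbf{k}}\in A_d(L^{r,r}_{\infty,\infty}(\mathbb{R}_-))$ if and only if at least one of the following three conditions holds: (i) $M_{\mathbf{k}^2}\in A^1_{d-1}$ and $M_{k_1}\ge\|\phi^{(k_1)}(M_{\mathbf{k}^2})\|$; (ii) $M_{\mathbf{k}^2}\in A^2_{d-1}$, $k_1>0$ and $M_{k_1}=\|\phi^{(k_1)}(M_{\mathbf{k}^2})\|$; (iii) $M_{\mathbf{k}^2}\in A^2_{d-1}$, $k_1=0$ and $M_{k_1}\ge\|\phi^{(k_1)}(M_{\mathbf{k}^2})\|$. Moreover: - if (i) holds, then $M_{\mathbf{k}}\in A^1_d$ when $M_{k_1}>\|\phi^{(k_1)}(M_{\mathbf{k}^2})\|$, and $M_{\mathbf{k}}\in A^2_d$ when $M_{k_1}=\|\phi^{(k_1)}(M_{\mathbf{k}^2})\|$; - if (ii) holds, then $M_{\mathbf{k}}\in A^2_d$; - if (iii) holds, then $M_{\mathbf{k}}\in A^2_d$ when $M_{k_1}=\|\phi^{(k_1)}(M_{\mathbf{k}^2})\|$, and $M_{\mathbf{k}}\in A^3_d$ when $M_{k_1}>\|\phi^{(k_1)}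(M_{\mathbf{k}^2})\|$.
   Context: $\mathbb{R}_-=(-\infty,0]$ and $\|\cdot\|$ is the (essential) supremum norm of $L_\infty(\mathbb{R}_-)$. For $r\in\mathbb{N}$, $L^{r}_{\infty,\infty}(\mathbb{R}_-)$ is the space of functions $x:\mathbb{R}_-\to\mathbb{R}$, $x\in L_\infty(\mathbb{R}_-)$, with locally absolutely continuous derivative of order $r-1$ ($x^{(0)}=x$, one-sided derivatives at $0$) and $x^{(r)}\in L_\infty(\mathbb{R}_-)$. $L^{r,r}_{\infty,\infty}(\mathbb{R}_-)$ is the class of $x\in L^r_{\infty,\infty}(\mathbb{R}_-)$ that are nonnegative together with all derivatives up to and including order $r$ (with $x^{(r)}\ge0$ almost everywhere). For $s\in\mathbb{N}$, $a_1>a_2>\dots>a_s>0$ and $l>0$, define on $\mathbb{R}_-$ the spline $$\phi(a_1,\dots,a_s,l;t):=\frac{l}{r!}\sum_{j=1}^s(-1)^{j+1}(t+a_j)_+^r ,$$ and $\Phi_{r,n}:=\{\phi(a_1,\dots,a_s,l;\cdot): s\in\mathbb{N},\ s\le n,\ a_1>\dots>a_s>0,\ l>0\}$ (so $\Phi_{r,0}=\emptyset$). For a vector of $m$ integers $0\le q_1<\dots<q_m\le r$, $\mathbf{q}=(q_1,\dots,q_m)$, a system of positive numbers $M_{\mathbf{q}}=\{M_{q_1},\dots,M_{q_m}\}$ is admissible, written $M_{\mathbf{q}}\in A_m=A_m(L^{r,r}_{\infty,\infty}(\mathbb{R}_-))$, if there is $x\in L^{r,r}_{\infty,\infty}(\mathbb{R}_-)$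 with $\|x^{(q_i)}\|=M_{q_i}$, $i=1,\dots,m$. An admissible $M_{\mathbf{q}}$ is: - of Type 1, $M_{\mathbf{q}}\in A^1_m$, if there is $\phi\in\Phi_{r,m-1}\setminus\Phi_{r,m-2}$ with $\|\phi^{(q_i)}\|=M_{q_i}$, $i=1,\dots,m$; - of Type 2, $M_{\mathbf{q}}\in A^2_m$, if there is $\phi\in\Phi_{r,m-2}$ with $\|\phi^{(q_i)}\|=M_{q_i}$, $i=1,\dots,m$; - of Type 3, $M_{\mathbf{q}}\in A^3_m$, if $q_1=0$, there are a constant $C>0$ and $\phi\in\Phi_{r,m-1}$ with $\|(\phi+C)^{(q_i)}\|=M_{q_i}$, $i=1,\dots,m$, and $M_{\mathbf{q}}$ is not of Type 1. (Here $A_d,A_d^j$ refer to $\mathbf{q}=\mathbf{k}$ and $A_{d-1}^j$ to $\mathbf{q}=\mathbf{k}^2$.) $\phi(M_{\mathbf{q}};t)$ (or $\phi(M_{\mathbf q})$) denotes the spline $\phi\in\Phi_{r,m-1}$ such that $\|\phi^{(q_i)}\|=\phi^{(q_i)}(0)=M_{q_i}$, $i=1,\dots,m$, and $\phi^{(k_1)}(M_{\mathbf{k}^2})$ is its derivative of order $k_1$ when $\mathbf{q}=\mathbf{k}^2$.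
   Formalization: In the definition of φ(M_q), the condition φ^{(q_i)}(0)=M_{q_i} is required only for q_i<r (the norm condition is kept for all q_i), since for an even number of knots φ^{(r)} vanishes near 0 while its norm is l>0, so the literal definition would leave φ(M_q) undefined. *)

theory Defs
  imports "HOL-Analysis.Analysis" "HOL-Probability.Essential_Supremum"
begin

text \<open>
  Functions on the half-line are total functions of type real to real of which only the values
  on \<open>{..0}\<close> matter: derivatives are taken within \<open>{..0}\<close> (hence one-sided at \<open>0\<close>) and norms use
  Lebesgue measure restricted to \<open>{..0}\<close>.
\<close>

text \<open>At points where the derivative does not exist, \<^const>\<open>vector_derivative\<close> is an arbitrary
  number; below this affects the top derivative only, and only on a null set.\<close>

definition nth_deriv :: "nat \<Rightarrow> (real \<Rightarrow> real) \<Rightarrow> real \<Rightarrow> real" where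
  "nth_deriv n = (\<lambda>x t. vector_derivative x (at t within {..0})) ^^ n"

definition linf_norm :: "(real \<Rightarrow> real) \<Rightarrow> ereal" where
  "linf_norm x = esssup (lebesgue_on {..0}) (\<lambda>t. ereal \<bar>x t\<bar>)"

definition Linf :: "(real \<Rightarrow> real) set" where
  "Linf = {x. x \<in> borel_measurable (lebesgue_on {..0}) \<and> linf_norm x < \<infinity>}"

definition abs_cont_on :: "real \<Rightarrow> real \<Rightarrow> (real \<Rightarrow> real) \<Rightarrow> bool" where
  "abs_cont_on a b f \<longleftrightarrow>
     (\<forall>\<epsilon>>0. \<exists>\<delta>>0. \<forall>(n::nat) u v.
        (\<forall>i<n. a \<le> u i \<and> u i \<le> v i \<and> v i \<le> b) \<and>
        disjoint_family_on (\<lambda>i. {u i<..<v i}) {..<n} \<and>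
        (\<Sum>i<n. v i - u i) < \<delta>
        \<longrightarrow> (\<Sum>i<n. \<bar>f (v i) - f (u i)\<bar>) < \<epsilon>)"

definition locally_abs_cont :: "(real \<Rightarrow> real) \<Rightarrow> bool" where
  "locally_abs_cont f \<longleftrightarrow> (\<forall>a b. a \<le> b \<and> b \<le> 0 \<longrightarrow> abs_cont_on a b f)"

text \<open>The almost-everywhere differentiability clause expresses that the derivative of order \<open>r\<close>
  exists as an element of \<open>Linf\<close>. By Lebesgue's theorem it is implied by the local absolute
  continuity of the derivative of order \<open>r - 1\<close>, so it does not restrict the space.\<close>

definition Lr_space :: "nat \<Rightarrow> (real \<Rightarrow> real) set" where
  "Lr_space r = {x. x \<in> Linf \<and>
     (\<forall>i<r - 1. \<forall>t\<le>0. nth_deriv i x differentiable (at t within {..0})) \<and>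
     locally_abs_cont (nth_deriv (r - 1) x) \<and>
     (AE t in lebesgue_on {..0}. nth_deriv (r - 1) x differentiable (at t within {..0})) \<and>
     nth_deriv r x \<in> Linf}"

definition Lrr_class :: "nat \<Rightarrow> (real \<Rightarrow> real) set" where
  "Lrr_class r = {x \<in> Lr_space r.
     (\<forall>i<r. \<forall>t\<le>0. nth_deriv i x t \<ge> 0) \<and>
     (AE t in lebesgue_on {..0}. nth_deriv r x t \<ge> 0)}"

definition spline :: "nat \<Rightarrow> nat \<Rightarrow> (nat \<Rightarrow> real) \<Rightarrow> real \<Rightarrow> real \<Rightarrow> real" where
  "spline r s a l t = l / fact r * (\<Sum>j=1..s. (-1) ^ (j + 1) * (max 0 (t + a j)) ^ r)"

text \<open>For \<open>r > 0\<close> all knots \<open>- a j\<close> are negative, so two such splines that agree on \<open>{..0}\<close> agree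
  everywhere; set differences and uniqueness may therefore be read for functions on \<open>{..0}\<close>.\<close>

definition Phi :: "nat \<Rightarrow> nat \<Rightarrow> (real \<Rightarrow> real) set" where
  "Phi r n = {spline r s a l | s a l.
     1 \<le> s \<and> s \<le> n \<and> strict_antimono_on {1..s} a \<and> (\<forall>j\<in>{1..s}. a j > 0) \<and> l > 0}"

text \<open>A vector \<open>(q\<^sub>1, \<dots>, q\<^sub>m)\<close> of orders is a list \<open>q\<close> of length \<open>m\<close>, and \<open>M i\<close> is the number
  prescribed for the derivative of order \<open>i\<close>; only the values of \<open>M\<close> on \<open>set q\<close> matter.\<close>

definition has_norms :: "nat list \<Rightarrow> (nat \<Rightarrow> real) \<Rightarrow> (real \<Rightarrow> real) \<Rightarrow> bool" where
  "has_norms q M x \<longleftrightarrow> (\<forall>i\<in>set q. linf_norm (nth_deriv i x) = ereal (M i))"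

definition admissible :: "nat \<Rightarrow> nat list \<Rightarrow> (nat \<Rightarrow> real) \<Rightarrow> bool" where
  "admissible r q M \<longleftrightarrow> (\<forall>i\<in>set q. M i > 0) \<and> (\<exists>x\<in>Lrr_class r. has_norms q M x)"

text \<open>The orders below use truncated subtraction, which is harmless: \<open>Phi r 0\<close> is empty.\<close>

definition admissible1 :: "nat \<Rightarrow> nat list \<Rightarrow> (nat \<Rightarrow> real) \<Rightarrow> bool" where
  "admissible1 r q M \<longleftrightarrow> admissible r q M \<and>
     (\<exists>\<phi>\<in>Phi r (length q - 1) - Phi r (length q - 2). has_norms q M \<phi>)"

definition admissible2 :: "nat \<Rightarrow> nat list \<Rightarrow> (nat \<Rightarrow> real) \<Rightarrow> bool" where
  "admissible2 r q M \<longleftrightarrow> admissible r q M \<and>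
     (\<exists>\<phi>\<in>Phi r (length q - 2). has_norms q M \<phi>)"

definition admissible3 :: "nat \<Rightarrow> nat list \<Rightarrow> (nat \<Rightarrow> real) \<Rightarrow> bool" where
  "admissible3 r q M \<longleftrightarrow> admissible r q M \<and> q \<noteq> [] \<and> hd q = 0 \<and>
     (\<exists>C>0. \<exists>\<phi>\<in>Phi r (length q - 1). has_norms q M (\<lambda>t. \<phi> t + C)) \<and>
     \<not> admissible1 r q M"

text \<open>The value at \<open>0\<close> is prescribed for orders below \<open>r\<close> only: the derivative of order \<open>r\<close> is
  defined merely almost everywhere, and near \<open>0\<close> it vanishes when the number of knots is even,
  while its norm is \<open>l\<close>.\<close>

definition extremal_spline :: "nat \<Rightarrow> nat list \<Rightarrow> (nat \<Rightarrow> real) \<Rightarrow> real \<Rightarrow> real" where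
  "extremal_spline r q M = (THE \<phi>. \<phi> \<in> Phi r (length q - 1) \<and> has_norms q M \<phi> \<and>
     (\<forall>i\<in>set q. i < r \<longrightarrow> nth_deriv i \<phi> 0 = M i))"

end

theory Submission
  imports Defs "HOL-Homology.Invariance_of_Domain" "HOL-Computational_Algebra.Polynomial"
begin

text \<open>
  The theorem is a moment problem in disguise. For a function \<open>x\<close> of the class, put
  \<open>f(t) = x\<^sup>(\<^sup>r\<^sup>)(-t) / M\<^sub>r\<close> for \<open>t > 0\<close>; its values lie in the unit interval almost everywhere. All lower
  derivatives are nonnegative and increasing, so their norms are their values at \<open>0\<close>, and by Taylor's
  formula \<open>(r-q)! x\<^sup>(\<^sup>q\<^sup>)(0) / M\<^sub>r\<close> is the moment \<open>\<integral> e t\<^sup>e\<^sup>-\<^sup>1 f(t) dt\<close> of exponent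
  \<open>e = r - q\<close>, up to the limit of \<open>x\<close> at \<open>-\<infinity>\<close> if \<open>q = 0\<close>
  (\<open>Lrr_class_moments\<close>). For a spline, \<open>f\<close> is a step function with values \<open>0\<close> and
  \<open>1\<close> that jumps at the knots, and its moments are the alternating sums \<open>a\<^sub>1\<^sup>e - a\<^sub>2\<^sup>e + \<dots>\<close>
  of powers of the knots. Admissibility of norms thus asks which moments occur, and the three
  types ask how many knots realise them.

  Three facts about such moments carry the proof. First, among all \<open>f\<close> with the same \<open>n\<close>
  moments a step function with at most \<open>n\<close> knots has the smallest moment of any larger exponent, and it
  is the only minimiser (\<open>step_minimizes_next_moment\<close>): by Descartes' rule there is a polynomial with the
  given exponents that changes sign exactly at the knots. Second, if it has fewer than \<open>n\<close> knots, then
  it is the only \<open>f\<close> with these moments (\<open>step_determined_by_moments\<close>). Third, if it has exactly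
  \<open>n\<close> knots, then every larger value of the next moment is attained by a step function with
  \<open>n + 1\<close> knots and the same \<open>n\<close> moments (\<open>extra_knot_with_prescribed_moment\<close>). The
  last fact is proved by a continuity argument: the set of attained values is open by invariance of domain,
  closed by a compactness argument in which escaping knots cancel in pairs, and not empty. By
  induction on \<open>n\<close>, every admissible system of \<open>n\<close> moments comes from a step function with at
  most \<open>n\<close> knots (\<open>exists_knots_with_moments\<close>).

  Now let \<open>n = d - 2\<close>. The system for \<open>\<^bold>k\<^sup>2\<close> prescribes \<open>n\<close> moments, and the order
  \<open>k\<^sub>1\<close> has the largest exponent. An admissible system for \<open>\<^bold>k\<close> restricts to one for
  \<open>\<^bold>k\<^sup>2\<close>, which comes from a spline with \<open>n\<close> knots (Type 1) or fewer (Type 2), and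
  minimality bounds \<open>M\<^sub>k\<^sub>1\<close> from below. In Type 2 rigidity forces equality, except that for
  \<open>k\<^sub>1 = 0\<close> an additive constant is free, which is Type 3. In Type 1 every larger value is attained by
  a spline with one more knot.
\<close>

section \<open>Positive zeros of polynomials with few terms\<close>

definition terms :: "real poly \<Rightarrow> nat set" where
  "terms p = {i. Polynomial.coeff p i \<noteq> 0}"

lemma finite_terms [simp]: "finite (terms p)"
  unfolding terms_def by (rule finite_subset[of _ "{..degree p}"]) (auto simp: le_degree)

lemma terms_empty_iff: "terms p = {} \<longleftrightarrow> p = 0"
  by (auto simp: terms_def poly_eq_iff)

text \<open>Rolle's theorem for a finite set of positive zeros. The zeros of the derivative lie strictly between
  those of \<open>p\<close>, so a further common zero of \<open>p\<close> and its derivative is not among them; this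
  is what makes double zeros count twice below.\<close>

lemma rolle_finite_set:
  fixes p :: "real poly"
  assumes "finite A" "A \<noteq> {}" "\<forall>a\<in>A. a > 0 \<and> poly p a = 0"
  shows "\<exists>B. finite B \<and> Suc (card B) = card A \<and> B \<inter> A = {} \<and>
           (\<forall>b\<in>B. 0 < b \<and> b < Max A \<and> poly (pderiv p) b = 0)"
  using assms
proof (induction A rule: finite_linorder_max_induct)
  case empty
  then show ?case by simp
next
  case (insert z A)
  show ?case
  proof (cases "A = {}")
    case True
    then show ?thesis by (intro exI[of _ "{}"]) auto
  next
    case False
    then obtain B where B: "finite B" "Suc (card B) = card A" "B \<inter> A = {}"
      "\<forall>b\<in>B. 0 < b \<and> b < Max A \<and> poly (pderiv p) b = 0"
      using insert by auto
    have M: "Max A \<in> A" "Max A < z" "Max A > 0"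
      using insert False by auto
    with insert.prems have "poly p (Max A) = 0" "poly p z = 0" by auto
    with poly_MVT[OF M(2), of p] M(2) obtain c where c: "Max A < c" "c < z" "poly (pderiv p) c = 0"
      by auto
    have cA: "c \<notin> A" using c(1) insert.hyps(1) by (meson Max_ge leD)
    have cB: "c \<notin> B" using B(4) c(1) by force
    have zB: "z \<notin> B" using B(4) M(2) by force
    have "Max (insert z A) = z"
      using insert.hyps by (intro Max_eqI) (auto intro: less_imp_le)
    moreover have "card (insert z A) = Suc (card A)"
      using insert.hyps by (metis card_insert_disjoint less_irrefl)
    ultimately show ?thesis
      using B cA cB zB c M by (intro exI[of _ "insert c B"]) force
  qed
qed

text \<open>The induction step behind Descartes' bound. Dividing by the lowest power of the variable creates a
  constant term without moving positive zeros; differentiation then kills that term, and Rolle loses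
  only one zero. Double zeros survive as zeros.\<close>

lemma derivative_drops_a_term:
  assumes "p \<noteq> 0" "finite A" "A \<noteq> {}" "\<forall>a\<in>A. a > 0 \<and> poly p a = 0"
  obtains q B where "q \<noteq> 0" "Suc (card (terms q)) = card (terms p)"
    "finite B" "Suc (card B) = card A" "B \<inter> A = {}" "\<forall>b\<in>B. b > 0 \<and> poly q b = 0"
    "\<forall>a\<in>A. poly (pderiv p) a = 0 \<longrightarrow> poly q a = 0"
proof -
  define m where "m = Min (terms p)"
  have ne: "terms p \<noteq> {}" using assms(1) terms_empty_iff by blast
  have m: "m \<in> terms p" "\<And>i. i < m \<Longrightarrow> Polynomial.coeff p i = 0"
    unfolding m_def using Min_in[OF finite_terms ne] Min_le[OF finite_terms]
    by (auto simp: terms_def) (metis (mono_tags, lifting) finite_terms leD mem_Collect_eq terms_def)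
  \<comment> \<open>This is \<open>p\<close> divided by \<open>x ^ m\<close>.\<close>
  define s where "s = poly_shift m p"
  have p: "p = Polynomial.monom 1 m * s"
    by (rule poly_eqI) (use m(2) in \<open>auto simp: s_def coeff_monom_mult coeff_poly_shift\<close>)
  have sA: "\<forall>a\<in>A. a > 0 \<and> poly s a = 0"
    using assms(4) p by (auto simp: poly_monom)
  have s0: "Polynomial.coeff s 0 \<noteq> 0" using m(1) by (simp add: s_def coeff_poly_shift terms_def)
  have cards: "card (terms s) = card (terms p)"
  proof (rule bij_betw_same_card)
    show "bij_betw (\<lambda>i. i + m) (terms s) (terms p)"
      unfolding bij_betw_def
    proof
      show "(\<lambda>i. i + m) ` terms s = terms p"
      proof (rule Set.set_eqI)
        fix i show "i \<in> (\<lambda>i. i + m) ` terms s \<longleftrightarrow> i \<in> terms p"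
          using m(2)[of i] by (cases "i < m")
            (auto simp: terms_def s_def coeff_poly_shift image_iff add.commute intro!: exI[of _ "i - m"])
      qed
    qed auto
  qed
  have "bij_betw Suc (terms (pderiv s)) (terms s - {0})"
    unfolding bij_betw_def
  proof
    show "Suc ` terms (pderiv s) = terms s - {0}"
    proof (rule Set.set_eqI)
      fix i show "i \<in> Suc ` terms (pderiv s) \<longleftrightarrow> i \<in> terms s - {0}"
        by (cases i) (auto simp: terms_def coeff_pderiv image_iff)
    qed
  qed auto
  then have "card (terms (pderiv s)) = card (terms s - {0})" by (rule bij_betw_same_card)
  moreover have "0 \<in> terms s" using s0 by (simp add: terms_def)
  ultimately have cd: "Suc (card (terms (pderiv s))) = card (terms p)"
    using cards by (metis card_Suc_Diff1 finite_terms)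
  obtain B where B: "finite B" "Suc (card B) = card A" "B \<inter> A = {}"
      "\<forall>b\<in>B. 0 < b \<and> b < Max A \<and> poly (pderiv s) b = 0"
    using rolle_finite_set[OF assms(2,3) sA] by blast
  have "pderiv s \<noteq> 0"
  proof
    assume "pderiv s = 0"
    then obtain c where c: "s = [:c:]" using pderiv_iszero by blast
    with s0 sA assms(3) show False by auto
  qed
  moreover have "poly (pderiv s) a = 0" if "a \<in> A" "poly (pderiv p) a = 0" for a
    using that sA unfolding p by (auto simp: pderiv_mult poly_monom)
  ultimately show ?thesis using that B cd by blast
qed

lemma card_positive_zeros_less:
  assumes "p \<noteq> 0" "finite A" "\<forall>a\<in>A. a > 0 \<and> poly p a = 0"
  shows "card A < card (terms p)"
  using assms
proof (induction "card (terms p)" arbitrary: p A rule: less_induct)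
  case less
  show ?case
  proof (cases "A = {}")
    case True
    then show ?thesis using less.prems(1) by (simp add: card_gt_0_iff terms_empty_iff)
  next
    case False
    obtain q B where "q \<noteq> 0" "Suc (card (terms q)) = card (terms p)"
      "finite B" "Suc (card B) = card A" "\<forall>b\<in>B. b > 0 \<and> poly q b = 0"
      using derivative_drops_a_term[OF less.prems(1,2) False less.prems(3)] by metis
    with less.hyps[of q B] show ?thesis by linarith
  qed
qed

text \<open>One more application of Rolle: a double zero of \<open>p\<close> gives the derived polynomial one zero in
  addition to the zeros supplied by Rolle's theorem.\<close>

lemma card_positive_zeros_double_less:
  assumes "p \<noteq> 0" "finite A" "\<forall>a\<in>A. a > 0 \<and> poly p a = 0"
    and "z \<in> A" "poly (pderiv p) z = 0"
  shows "Suc (card A) < card (terms p)"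
proof -
  have "A \<noteq> {}" using assms(4) by auto
  obtain q B where q: "q \<noteq> 0" "Suc (card (terms q)) = card (terms p)"
      "finite B" "Suc (card B) = card A" "B \<inter> A = {}" "\<forall>b\<in>B. b > 0 \<and> poly q b = 0"
      "\<forall>a\<in>A. poly (pderiv p) a = 0 \<longrightarrow> poly q a = 0"
    using derivative_drops_a_term[OF assms(1,2) \<open>A \<noteq> {}\<close> assms(3)] by metis
  have "card (insert z B) < card (terms q)"
    using q assms by (intro card_positive_zeros_less) auto
  moreover have "card (insert z B) = Suc (card B)"
    using q(3,5) assms(4) by (intro card_insert_disjoint) auto
  ultimately show ?thesis using q(2,4) by linarith
qed

text \<open>Fewer linear conditions than coefficients leave a nontrivial solution.\<close>

lemma exists_poly_with_terms_vanishing: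
  assumes "finite A" "finite E" "card A < card E"
  shows "\<exists>p::real poly. p \<noteq> 0 \<and> terms p \<subseteq> E \<and> (\<forall>a\<in>A. poly p a = 0)"
  using assms
proof (induction A arbitrary: E rule: finite_induct)
  case empty
  then obtain e where "e \<in> E" by fastforce
  then show ?case by (intro exI[of _ "Polynomial.monom 1 e"]) (auto simp: terms_def)
next
  case (insert a A)
  have step: "\<exists>p::real poly. p \<noteq> 0 \<and> terms p \<subseteq> E - {e} \<and> (\<forall>a\<in>A. poly p a = 0)" if "e \<in> E" for e
    using insert that by (intro insert.IH) auto
  have "E \<noteq> {}" using insert.prems by auto
  then obtain e where e: "e \<in> E" by blast
  obtain p1 where p1: "p1 \<noteq> 0" "terms p1 \<subseteq> E - {e}" "\<forall>a\<in>A. poly p1 a = 0"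
    using step[OF e] by blast
  then obtain e' where e': "e' \<in> terms p1" "e' \<in> E" using terms_empty_iff[of p1] by blast
  then obtain p2 where p2: "p2 \<noteq> 0" "terms p2 \<subseteq> E - {e'}" "\<forall>a\<in>A. poly p2 a = 0"
    using step by blast
  show ?case
  proof (cases "poly p1 a = 0")
    case True
    then show ?thesis using p1 by auto
  next
    case False
    define c where "c = poly p2 a / poly p1 a"
    \<comment> \<open>The exponent \<open>e'\<close> occurs in \<open>p1\<close> but not in \<open>p2\<close>, so the two cannot cancel.\<close>
    have "p2 - Polynomial.smult c p1 \<noteq> 0"
    proof
      assume eq: "p2 - Polynomial.smult c p1 = 0"
      have "Polynomial.coeff p2 e' = 0" using p2 by (auto simp: terms_def)
      with eq have "c * Polynomial.coeff p1 e' = 0"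
        by (metis coeff_smult eq_iff_diff_eq_0)
      then have "c = 0" using e' by (auto simp: terms_def)
      with eq p2 show False by simp
    qed
    moreover have "terms (p2 - Polynomial.smult c p1) \<subseteq> E"
      using p1(2) p2(2) by (force simp: terms_def)
    ultimately show ?thesis
      using False p1 p2 by (intro exI[of _ "p2 - Polynomial.smult c p1"]) (auto simp: c_def)
  qed
qed

lemma prod_linear_dvd:
  fixes p :: "real poly"
  assumes "distinct xs" "\<forall>x\<in>set xs. poly p x = 0"
  shows "(\<Prod>x\<leftarrow>xs. [:-x, 1:]) dvd p"
  using assms
proof (induction xs arbitrary: p)
  case (Cons x xs)
  then obtain q where q: "p = [:-x, 1:] * q"
    using poly_eq_0_iff_dvd[of p x] by auto
  have "poly q y = 0" if "y \<in> set xs" for y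
    using Cons.prems that q by (auto simp: algebra_simps)
  then have "(\<Prod>x\<leftarrow>xs. [:-x, 1:]) dvd q" using Cons by auto
  then show ?case unfolding q by (simp add: mult_dvd_mono del: mult_pCons_left)
qed auto

text \<open>The powers with exponents in \<open>E\<close> form a Chebyshev system on the positive half-line: one exponent
  more than prescribed zeros yields a polynomial with exactly these positive zeros, all of them simple.
  Its sign therefore is that of the product of the linear factors, which is what the cofactor
  \<open>q\<close> expresses. The sign is normalised at infinity, that is, by the coefficient of the
  largest exponent.\<close>

lemma exists_sign_matching_poly:
  fixes xs :: "real list"
  assumes xs: "distinct xs" "\<forall>x\<in>set xs. x > 0"
    and E: "finite E" "card E = Suc (length xs)"
  obtains p q :: "real poly" where "terms p \<subseteq> E" "Polynomial.coeff p (Max E) > 0"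
    "p = q * (\<Prod>x\<leftarrow>xs. [:-x, 1:])" "\<forall>t>0. poly q t > 0"
proof -
  have cs: "card (set xs) = length xs" using xs(1) by (simp add: distinct_card)
  obtain p0 where p0: "p0 \<noteq> 0" "terms p0 \<subseteq> E" "\<forall>a\<in>set xs. poly p0 a = 0"
    using exists_poly_with_terms_vanishing[of "set xs" E] E cs by auto
  define p where "p = Polynomial.smult (sgn (lead_coeff p0)) p0"
  have p: "p \<noteq> 0" "terms p \<subseteq> E" "\<forall>a\<in>set xs. a > 0 \<and> poly p a = 0"
    using p0 xs(2) by (auto simp: p_def terms_def sgn_0_0)
  have lc: "lead_coeff p > 0"
  proof -
    have "lead_coeff p = \<bar>lead_coeff p0\<bar>"
      by (simp add: p_def lead_coeff_smult abs_sgn mult.commute)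
    moreover have "lead_coeff p0 \<noteq> 0" using p0(1) by simp
    ultimately show ?thesis by linarith
  qed
  have "card (set xs) < card (terms p)" using p by (intro card_positive_zeros_less) auto
  then have tE: "terms p = E" using p(2) E cs by (metis Suc_leI card_seteq)
  have "Polynomial.coeff p (Max E) \<noteq> 0" using Max_in[OF E(1)] E(2) tE
    by (metis (mono_tags, lifting) card.empty mem_Collect_eq nat.distinct(1) terms_def)
  then have "Max E \<le> degree p" by (rule le_degree)
  moreover have "degree p \<in> E" using tE lc by (auto simp: terms_def)
  ultimately have "Max E = degree p" using E(1) by (simp add: Max_ge order_antisym)
  then have Mx: "Polynomial.coeff p (Max E) > 0" using lc by simp
  obtain q where q: "p = q * (\<Prod>x\<leftarrow>xs. [:-x, 1:])"
    using prod_linear_dvd[OF xs(1), of p] p(3) by (metis dvdE mult.commute)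
  have lcprod: "lead_coeff (\<Prod>x\<leftarrow>xs. [:-x, 1:]) = (1::real)" for xs :: "real list"
    by (induction xs) (auto simp: lead_coeff_mult simp del: mult_pCons_left)
  have lcq: "lead_coeff q > 0" using lc unfolding q lead_coeff_mult lcprod by simp
  have nz: "poly q z \<noteq> 0" if z: "z > 0" for z
  proof
    assume q0: "poly q z = 0"
    show False
    proof (cases "z \<in> set xs")
      case True
      have "poly (\<Prod>x\<leftarrow>xs. [:-x, 1:]) z = 0"
        using True by (induction xs) auto
      then have "poly (pderiv p) z = 0" using q0 unfolding q by (simp add: pderiv_mult)
      then have "Suc (card (set xs)) < card (terms p)"
        using p True by (intro card_positive_zeros_double_less[of p "set xs" z]) auto
      then show False using tE E(2) cs by simp
    next
      case False
      have "card (insert z (set xs)) < card (terms p)"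
        using p z q0 by (intro card_positive_zeros_less) (auto simp: q)
      then show False using tE E(2) cs False by simp
    qed
  qed
  have "poly q t > 0" if t: "t > 0" for t
  proof (rule ccontr)
    assume "\<not> poly q t > 0"
    then have neg: "poly q t < 0" using nz[OF t] by linarith
    obtain n where n: "\<forall>x\<ge>n. lead_coeff q \<le> poly q x"
      using poly_pinfty_gt_lc[OF lcq] by auto
    define u where "u = max n (t + 1)"
    have "t < u" "poly q u > 0" using n lcq by (auto simp: u_def intro: less_le_trans)
    with neg poly_IVT_pos[of t u q] obtain x where "t < x" "poly q x = 0" by auto
    with nz[of x] t show False by simp
  qed
  with that p(2) Mx q show ?thesis by blast
qed

section \<open>Moments of step functions\<close>

text \<open>Knots are kept in a list in decreasing order \<open>a\<^sub>1 > a\<^sub>2 > \<dots>\<close>. Everything attached to them is an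
  alternating sum \<open>f a\<^sub>1 - f a\<^sub>2 + f a\<^sub>3 - \<dots>\<close> with a different \<open>f\<close>.\<close>

definition alt_sum :: "('a \<Rightarrow> real) \<Rightarrow> 'a list \<Rightarrow> real" where
  "alt_sum f xs = foldr (\<lambda>x s. f x - s) xs 0"

lemma alt_sum_simps [simp]: "alt_sum f [] = 0" "alt_sum f (x # xs) = f x - alt_sum f xs"
  by (simp_all add: alt_sum_def)

text \<open>For a decreasing list this is the indicator of \<open>{a\<^sub>2..<a\<^sub>1} \<union> {a\<^sub>4..<a\<^sub>3} \<union> \<dots>\<close>, the last interval
  extending down to \<open>-\<infinity>\<close> if the number of knots is odd. It is the normalised derivative of
  order \<open>r\<close> of the spline, with time reversed.\<close>

definition step :: "real list \<Rightarrow> real \<Rightarrow> real" where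
  "step xs t = alt_sum (\<lambda>x. of_bool (t < x)) xs"

lemma step_simps [simp]: "step [] t = 0" "step (x # xs) t = of_bool (t < x) - step xs t"
  by (simp_all add: step_def)

definition power_sum :: "nat \<Rightarrow> real list \<Rightarrow> real" where
  "power_sum e xs = alt_sum (\<lambda>x. x ^ e) xs"

lemma power_sum_simps [simp]: "power_sum e [] = 0" "power_sum e (x # xs) = x ^ e - power_sum e xs"
  by (simp_all add: power_sum_def)

definition knots :: "real list \<Rightarrow> bool" where
  "knots xs \<longleftrightarrow> sorted_wrt (>) xs \<and> (\<forall>x\<in>set xs. x > 0)"

lemma knots_simps [simp]: "knots []" "knots (x # xs) \<longleftrightarrow> x > 0 \<and> (\<forall>y\<in>set xs. y < x) \<and> knots xs"
  by (auto simp: knots_def)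

lemma knots_distinct: "knots xs \<Longrightarrow> distinct xs"
  by (induction xs) auto

lemma knots_pos: "knots xs \<Longrightarrow> \<forall>x\<in>set xs. x > 0"
  by (simp add: knots_def)

lemma alt_sum_bounds:
  assumes "sorted_wrt (\<ge>) xs" "\<And>x. x \<in> set xs \<Longrightarrow> 0 \<le> f x"
    "\<And>x y. x \<in> set xs \<Longrightarrow> y \<in> set xs \<Longrightarrow> x \<le> y \<Longrightarrow> f x \<le> f y"
  shows "0 \<le> alt_sum f xs" "xs \<noteq> [] \<Longrightarrow> alt_sum f xs \<le> f (hd xs)"
proof -
  have "0 \<le> alt_sum f xs \<and> (xs \<noteq> [] \<longrightarrow> alt_sum f xs \<le> f (hd xs))"
    using assms
  proof (induction xs)
    case (Cons x xs)
    then have IH: "0 \<le> alt_sum f xs \<and> (xs \<noteq> [] \<longrightarrow> alt_sum f xs \<le> f (hd xs))" by auto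
    show ?case
    proof (cases "xs = []")
      case True
      then show ?thesis using Cons by auto
    next
      case False
      then have "f (hd xs) \<le> f x" using Cons.prems(1) by (intro Cons.prems(3)) auto
      then show ?thesis using IH False by auto
    qed
  qed auto
  then show "0 \<le> alt_sum f xs" "xs \<noteq> [] \<Longrightarrow> alt_sum f xs \<le> f (hd xs)" by auto
qed

lemma knots_sorted: "knots xs \<Longrightarrow> sorted_wrt (\<ge>) xs"
  unfolding knots_def by (auto elim: sorted_wrt_mono_rel[rotated])

lemma step_eq_0: "\<forall>x\<in>set xs. x \<le> t \<Longrightarrow> step xs t = 0"
  by (induction xs) auto

text \<open>Both the step function and the sign of the product change exactly at the knots.\<close>

lemma step_sign_of_prod:
  assumes "knots xs" "t \<notin> set xs"
  shows "(step xs t = 0 \<and> (\<Prod>x\<leftarrow>xs. t - x) > 0) \<or> (step xs t = 1 \<and> (\<Prod>x\<leftarrow>xs. t - x) < 0)"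
  using assms
proof (induction xs)
  case (Cons x xs)
  show ?case
  proof (cases "t < x")
    case True
    then have "t - x < 0" by simp
    then show ?thesis using Cons True by (auto simp: mult_neg_neg mult_neg_pos)
  next
    case False
    then have "t > x" using Cons by auto
    then have "step xs t = 0" using Cons.prems by (intro step_eq_0) auto
    then show ?thesis using Cons \<open>t > x\<close> by auto
  qed
qed auto

text \<open>The integral over the positive half-line is improper, since the top derivative of a function of the
  class is only known to be bounded; convergence is a consequence of the boundedness of the function. The factor
  \<open>e\<close> makes the moment of the indicator of an interval from \<open>0\<close> to \<open>a\<close> equal to
  \<open>a\<^sup>e\<close>.\<close>

definition has_moment :: "(real \<Rightarrow> real) \<Rightarrow> nat \<Rightarrow> real \<Rightarrow> bool" where
  "has_moment f e \<mu> \<longleftrightarrow>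
     (\<forall>T\<ge>0. (\<lambda>t. real e * t ^ (e - 1) * f t) integrable_on {0..T}) \<and>
     ((\<lambda>T. integral {0..T} (\<lambda>t. real e * t ^ (e - 1) * f t)) \<longlongrightarrow> \<mu>) at_top"

lemma has_moment_unique: "has_moment f e \<mu> \<Longrightarrow> has_moment f e \<nu> \<Longrightarrow> \<mu> = \<nu>"
  unfolding has_moment_def by (blast intro: tendsto_unique[OF trivial_limit_at_top_linorder])

lemma has_moment_cong_ae:
  assumes "has_moment f e \<mu>" "negligible {t. 0 < t \<and> f t \<noteq> g t}"
  shows "has_moment g e \<mu>"
proof -
  let ?N = "insert 0 {t. 0 < t \<and> f t \<noteq> g t}"
  have N: "negligible ?N" using assms(2) by (simp add: negligible_insert)
  have eq: "integral {0..T} (\<lambda>t. real e * t ^ (e - 1) * g t)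
       = integral {0..T} (\<lambda>t. real e * t ^ (e - 1) * f t)" for T
    by (rule integral_spike[OF N]) auto
  have "(\<lambda>t. real e * t ^ (e - 1) * g t) integrable_on {0..T}" if "T \<ge> 0" for T
  proof -
    have "(\<lambda>t. real e * t ^ (e - 1) * f t) integrable_on {0..T}"
      using assms(1) that by (simp add: has_moment_def)
    then show ?thesis by (rule integrable_spike[OF _ N]) auto
  qed
  then show ?thesis using assms(1) unfolding has_moment_def eq by blast
qed

lemma has_integral_step:
  assumes "\<forall>x\<in>set xs. x \<ge> 0" "e \<ge> 1" "T \<ge> 0"
  shows "((\<lambda>t. real e * t ^ (e - 1) * step xs t) has_integral
           alt_sum (\<lambda>x. (min x T) ^ e) xs) {0..T}"
  using assms
proof (induction xs)
  case (Cons x xs)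
  let ?c = "min x T"
  have c: "0 \<le> ?c" using Cons by auto
  have "((\<lambda>t. real e * t ^ (e - 1)) has_integral (?c ^ e - 0 ^ e)) {0..?c}"
    by (rule fundamental_theorem_of_calculus[OF c])
      (auto intro!: derivative_eq_intros simp: has_real_derivative_iff_has_vector_derivative[symmetric])
  then have "((\<lambda>t. if t \<in> {0..?c} then real e * t ^ (e - 1) else 0) has_integral ?c ^ e) {0..T}"
    using assms(2) by (subst has_integral_restrict) (auto simp: power_0_left)
  then have "((\<lambda>t. real e * t ^ (e - 1) * of_bool (t < x)) has_integral ?c ^ e) {0..T}"
    by (rule has_integral_spike[of "{x}", rotated 2]) auto
  from has_integral_diff[OF this Cons.IH] Cons.prems show ?case
    by (simp add: right_diff_distrib)
qed (simp add: has_integral_0)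

lemma has_moment_step:
  assumes "\<forall>x\<in>set xs. x \<ge> 0" "e \<ge> 1"
  shows "has_moment (step xs) e (power_sum e xs)"
proof -
  note hi = has_integral_step[OF assms]
  define B where "B = Max (insert 0 (set xs))"
  have B: "x \<le> B" if "x \<in> set xs" for x unfolding B_def using that by auto
  have B0: "0 \<le> B" unfolding B_def by auto
  have cong: "alt_sum f ys = alt_sum g ys" if "\<And>x. x \<in> set ys \<Longrightarrow> f x = g x" for f g and ys :: "real list"
    using that by (induction ys) auto
  have "integral {0..T} (\<lambda>t. real e * t ^ (e - 1) * step xs t) = power_sum e xs" if "T \<ge> B" for T
    using integral_unique[OF hi, of T] that B0
    by (auto simp: power_sum_def intro!: cong) (metis B min_absorb1 order_trans)
  then have "eventually (\<lambda>T. integral {0..T} (\<lambda>t. real e * t ^ (e - 1) * step xs t) = power_sum e xs) at_top"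
    unfolding eventually_at_top_linorder by blast
  then show ?thesis unfolding has_moment_def
    using hi by (auto intro: tendsto_eventually)
qed

lemma negligible_nonzero_if_integral_0:
  fixes f :: "real \<Rightarrow> real"
  assumes f: "f integrable_on {a..b}" "integral {a..b} f = 0"
    and N: "negligible N" "\<And>t. t \<in> {a..b} \<Longrightarrow> t \<notin> N \<Longrightarrow> f t \<ge> 0"
  shows "negligible {t\<in>{a..b}. f t \<noteq> 0}"
proof -
  define g where "g t = (if t \<in> N then 0 else f t)" for t
  have g: "g integrable_on {a..b}" by (rule integrable_spike[OF f(1) N(1)]) (auto simp: g_def)
  have "integral {a..b} g = integral {a..b} f" by (rule integral_spike[OF N(1)]) (auto simp: g_def)
  then have g0: "integral {a..b} g = 0" using f by simp
  have af: "g absolutely_integrable_on {a..b}"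
    using N(2) by (intro absolutely_integrable_onI g integrable_eq[OF g]) (auto simp: g_def)
  have "set_lebesgue_integral lebesgue {a..b} g = 0"
    using set_lebesgue_integral_eq_integral(2)[OF af] g0 by simp
  then have "AE x in lebesgue. indicator {a..b} x *\<^sub>R g x = 0"
    unfolding set_lebesgue_integral_def using af N(2)
    by (subst (asm) integral_nonneg_eq_0_iff_AE) (auto simp: indicator_def g_def set_integrable_def)
  then have "AE x in lebesgue. x \<notin> {t\<in>{a..b}. g t \<noteq> 0}"
    by eventually_elim (auto simp: indicator_def)
  then obtain Z where "Z \<in> null_sets lebesgue" "{t\<in>{a..b}. g t \<noteq> 0} \<subseteq> Z"
    by (auto simp: eventually_ae_filter)
  then have "negligible {t\<in>{a..b}. g t \<noteq> 0}"
    using negligible_iff_null_sets negligible_subset by blast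
  then have "negligible ({t\<in>{a..b}. g t \<noteq> 0} \<union> N)" using N(1) by (rule negligible_Un)
  then show ?thesis by (rule negligible_subset) (auto simp: g_def)
qed

lemma poly_as_sum_over:
  fixes p :: "real poly"
  assumes "finite E" "terms p \<subseteq> E"
  shows "poly p t = (\<Sum>i\<in>E. Polynomial.coeff p i * t ^ i)"
proof -
  have "poly p t = (\<Sum>i\<le>degree p. Polynomial.coeff p i * t ^ i)" by (simp add: poly_altdef)
  also have "\<dots> = (\<Sum>i\<in>terms p. Polynomial.coeff p i * t ^ i)"
    by (rule sum.mono_neutral_right) (auto simp: terms_def le_degree)
  also have "\<dots> = (\<Sum>i\<in>E. Polynomial.coeff p i * t ^ i)"
    by (rule sum.mono_neutral_left) (use assms in \<open>auto simp: terms_def\<close>)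
  finally show ?thesis .
qed

text \<open>The extremal property that drives everything (Markov, Krein). Take a combination \<open>p\<close> of the weights
  of the given moments and of the next one that changes sign exactly at the knots and is positive at
  infinity. As the step function is \<open>0\<close> where \<open>p > 0\<close> and \<open>1\<close> where
  \<open>p < 0\<close>, it minimises \<open>\<integral> p f\<close> among all \<open>f\<close> with values in the unit interval,
  even pointwise; and with the lower moments fixed this integral is an increasing function of the next
  moment. In the case of equality the nonnegative integrand vanishes.\<close>

lemma step_minimizes_next_moment:
  assumes xs: "knots xs"
    and f: "negligible {t. 0 < t \<and> \<not> (0 \<le> f t \<and> f t \<le> 1)}"
    and E: "finite E" "length xs \<le> card E" "\<forall>e\<in>E. 1 \<le> e \<and> e < e0" "e0 \<ge> 1"
    and mE: "\<forall>e\<in>E. has_moment f e (power_sum e xs)"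
    and m0: "has_moment f e0 \<mu>"
  shows "power_sum e0 xs \<le> \<mu>"
    and "\<mu> \<le> power_sum e0 xs \<Longrightarrow> negligible {t. 0 < t \<and> f t \<noteq> step xs t}"
proof -
  \<comment> \<open>As many of the given exponents as there are knots suffice, together with the exponent \<open>e0\<close>.\<close>
  obtain E1 where E1: "E1 \<subseteq> E" "card E1 = length xs" using E(2) by (metis obtain_subset_with_card_n)
  have fE1: "finite E1" using E1 E finite_subset by blast
  define F where "F = insert e0 E1"
  have F: "finite F" "\<forall>e\<in>F. 1 \<le> e" "e0 \<in> F" using fE1 E E1 by (auto simp: F_def)
  have e0: "e0 \<notin> E1" using E1 E by auto
  have cF: "card F = Suc (length xs)" using fE1 e0 E1 by (simp add: F_def)
  \<comment> \<open>The weight of the moment of order \<open>e\<close> is a multiple of \<open>t ^ (e - 1)\<close>.\<close>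
  define D where "D = (\<lambda>e. e - 1) ` F"
  have injD: "inj_on (\<lambda>e. e - 1) F"
    using F(2) by (auto simp: inj_on_def) (metis One_nat_def Suc_le_D diff_Suc_1)
  have D: "finite D" "card D = Suc (length xs)" using F cF injD by (auto simp: D_def card_image)
  have MD: "Max D = e0 - 1"
  proof (rule Max_eqI)
    fix y assume "y \<in> D"
    then show "y \<le> e0 - 1" using E E1 by (fastforce simp: D_def F_def)
  qed (use D F in \<open>auto simp: D_def\<close>)
  obtain p q where p: "terms p \<subseteq> D" "Polynomial.coeff p (e0 - 1) > 0"
    "p = q * (\<Prod>x\<leftarrow>xs. [:-x, 1:])" "\<forall>t>0. poly q t > 0"
    using exists_sign_matching_poly[OF knots_distinct[OF xs] knots_pos[OF xs] D] MD by metis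
  have pprod: "poly (\<Prod>x\<leftarrow>ys. [:-x, 1:]) t = (\<Prod>x\<leftarrow>ys. t - x)" for ys and t :: real
    by (induction ys) (auto simp: algebra_simps)
  have pt: "poly p t = poly q t * (\<Prod>x\<leftarrow>xs. t - x)" for t
    unfolding p(3) by (simp add: pprod)
  have psum: "poly p t = (\<Sum>e\<in>F. Polynomial.coeff p (e - 1) / e * (real e * t ^ (e - 1)))" for t
  proof -
    have "poly p t = (\<Sum>i\<in>D. Polynomial.coeff p i * t ^ i)" by (rule poly_as_sum_over[OF D(1) p(1)])
    also have "\<dots> = (\<Sum>e\<in>F. Polynomial.coeff p (e - 1) * t ^ (e - 1))"
      unfolding D_def by (rule sum.reindex_cong[OF injD refl]) simp
    also have "\<dots> = (\<Sum>e\<in>F. Polynomial.coeff p (e - 1) / e * (real e * t ^ (e - 1)))"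
      by (rule sum.cong) (use F(2) in force)+
    finally show ?thesis .
  qed
  define \<nu> where "\<nu> e = (if e = e0 then \<mu> else power_sum e xs)" for e
  have mf: "has_moment f e (\<nu> e)" if "e \<in> F" for e
    using that mE m0 E1 by (auto simp: F_def \<nu>_def)
  have ms: "has_moment (step xs) e (power_sum e xs)" if "e \<in> F" for e
    using that F(2) knots_pos[OF xs] by (intro has_moment_step) auto
  have intf: "(\<lambda>t. real e * t ^ (e - 1) * f t) integrable_on {0..T}"
    and ints: "(\<lambda>t. real e * t ^ (e - 1) * step xs t) integrable_on {0..T}" if "e \<in> F" "T \<ge> 0" for e T
    using mf[OF that(1)] ms[OF that(1)] that(2) unfolding has_moment_def by blast+
  define w where "w t = poly p t * (f t - step xs t)" for t
  have w: "w t = (\<Sum>e\<in>F. Polynomial.coeff p (e - 1) / e *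
              (real e * t ^ (e - 1) * f t - real e * t ^ (e - 1) * step xs t))" for t
    unfolding w_def psum sum_distrib_right by (rule sum.cong) (auto simp: algebra_simps)
  define I where "I T = integral {0..T} w" for T
  have wint: "w integrable_on {0..T}" if "T \<ge> 0" for T
    unfolding w by (intro integrable_sum integrable_on_mult_right integrable_diff intf ints F that)
  have I: "I T = (\<Sum>e\<in>F. Polynomial.coeff p (e - 1) / e *
      (integral {0..T} (\<lambda>t. real e * t ^ (e - 1) * f t)
       - integral {0..T} (\<lambda>t. real e * t ^ (e - 1) * step xs t)))" if "T \<ge> 0" for T
  proof -
    have "I T = (\<Sum>e\<in>F. integral {0..T} (\<lambda>t. Polynomial.coeff p (e - 1) / e *
              (real e * t ^ (e - 1) * f t - real e * t ^ (e - 1) * step xs t)))"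
      unfolding I_def w
      by (intro integral_sum integrable_on_mult_right integrable_diff intf ints F that)
    also have "\<dots> = (\<Sum>e\<in>F. Polynomial.coeff p (e - 1) / e *
      (integral {0..T} (\<lambda>t. real e * t ^ (e - 1) * f t)
       - integral {0..T} (\<lambda>t. real e * t ^ (e - 1) * step xs t)))"
    proof (rule sum.cong[OF refl])
      fix e assume "e \<in> F"
      note int = intf[OF this that] ints[OF this that]
      show "integral {0..T} (\<lambda>t. Polynomial.coeff p (e - 1) / e *
              (real e * t ^ (e - 1) * f t - real e * t ^ (e - 1) * step xs t))
        = Polynomial.coeff p (e - 1) / e * (integral {0..T} (\<lambda>t. real e * t ^ (e - 1) * f t)
       - integral {0..T} (\<lambda>t. real e * t ^ (e - 1) * step xs t))"
        by (subst integral_mult_right) (rule arg_cong[OF integral_diff[OF int]])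
    qed
    finally show ?thesis .
  qed
  have "((\<lambda>T. \<Sum>e\<in>F. Polynomial.coeff p (e - 1) / e *
      (integral {0..T} (\<lambda>t. real e * t ^ (e - 1) * f t)
       - integral {0..T} (\<lambda>t. real e * t ^ (e - 1) * step xs t)))
      \<longlongrightarrow> (\<Sum>e\<in>F. Polynomial.coeff p (e - 1) / e * (\<nu> e - power_sum e xs))) at_top"
    using mf ms by (intro tendsto_intros) (auto simp: has_moment_def)
  also have "(\<Sum>e\<in>F. Polynomial.coeff p (e - 1) / e * (\<nu> e - power_sum e xs))
      = Polynomial.coeff p (e0 - 1) / e0 * (\<mu> - power_sum e0 xs)"
    using fE1 e0 unfolding F_def by (subst sum.insert) (auto simp: \<nu>_def intro!: sum.neutral)
  finally have lim: "(I \<longlongrightarrow> Polynomial.coeff p (e0 - 1) / e0 * (\<mu> - power_sum e0 xs)) at_top"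
  proof (rule Lim_transform_eventually)
    show "\<forall>\<^sub>F T in at_top. (\<Sum>e\<in>F. Polynomial.coeff p (e - 1) / e *
      (integral {0..T} (\<lambda>t. real e * t ^ (e - 1) * f t)
       - integral {0..T} (\<lambda>t. real e * t ^ (e - 1) * step xs t))) = I T"
      using eventually_ge_at_top[of 0] by eventually_elim (rule I[symmetric])
  qed
  define N where "N = insert 0 {t. 0 < t \<and> \<not> (0 \<le> f t \<and> f t \<le> 1)} \<union> set xs"
  have N: "negligible N" using f by (simp add: N_def negligible_finite)
  have pos: "w t \<ge> 0" if "0 \<le> t" "t \<notin> N" for t
  proof -
    have t: "0 < t" "0 \<le> f t" "f t \<le> 1" "t \<notin> set xs"
      using that by (auto simp: N_def)
    with p(4) have "poly q t > 0" by auto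
    have "0 \<le> (\<Prod>x\<leftarrow>xs. t - x) * (f t - step xs t)"
      using step_sign_of_prod[OF xs t(4)]
    proof
      assume "step xs t = 0 \<and> (\<Prod>x\<leftarrow>xs. t - x) > 0"
      then show ?thesis using t by (intro mult_nonneg_nonneg) auto
    next
      assume "step xs t = 1 \<and> (\<Prod>x\<leftarrow>xs. t - x) < 0"
      then show ?thesis using t by (intro mult_nonpos_nonpos) auto
    qed
    then show ?thesis using \<open>poly q t > 0\<close> unfolding w_def pt by (simp add: mult.assoc)
  qed
  have Ipos: "0 \<le> integral {a..b} w" if "0 \<le> a" for a b
  proof -
    have "integral {a..b} w = integral {a..b} (\<lambda>t. if t \<in> N then 0 else w t)"
      by (rule integral_spike[OF N]) auto
    also have "\<dots> \<ge> 0"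
    proof (cases "(\<lambda>t. if t \<in> N then 0 else w t) integrable_on {a..b}")
      case True
      then show ?thesis
      proof (rule integral_nonneg)
        fix t assume "t \<in> {a..b}"
        then have "0 \<le> t" using that by simp
        then show "0 \<le> (if t \<in> N then 0 else w t)" using pos[of t] by simp
      qed
    qed (simp add: not_integrable_integral)
    finally show ?thesis .
  qed
  have Imono: "I S \<le> I T" if "0 \<le> S" "S \<le> T" for S T
  proof -
    have "integral {0..S} w + integral {S..T} w = integral {0..T} w"
      using that by (intro Henstock_Kurzweil_Integration.integral_combine wint) auto
    then show ?thesis using Ipos[OF that(1), of T] unfolding I_def by linarith
  qed
  have Ile: "I S \<le> Polynomial.coeff p (e0 - 1) / e0 * (\<mu> - power_sum e0 xs)" if "0 \<le> S" for S
  proof (rule tendsto_lowerbound[OF lim])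
    show "\<forall>\<^sub>F x in at_top. I S \<le> I x"
      using eventually_ge_at_top[of S] by eventually_elim (rule Imono[OF that])
  qed simp
  have "0 \<le> Polynomial.coeff p (e0 - 1) / e0 * (\<mu> - power_sum e0 xs)"
    using Ile[of 0] by (simp add: I_def)
  moreover have "Polynomial.coeff p (e0 - 1) / e0 > 0" using p(2) E(4) by simp
  ultimately show "power_sum e0 xs \<le> \<mu>" by (simp only: zero_le_mult_iff) linarith
  assume "\<mu> \<le> power_sum e0 xs"
  then have "Polynomial.coeff p (e0 - 1) / e0 * (\<mu> - power_sum e0 xs) \<le> 0"
    using p(2) by (intro mult_nonneg_nonpos) auto
  then have I0: "integral {0..T} w = 0" if "0 \<le> T" for T
    using Ile[OF that] Ipos[of 0 T] unfolding I_def by linarith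
  have "negligible {t\<in>{0..real n}. w t \<noteq> 0}" for n
    by (rule negligible_nonzero_if_integral_0[OF wint I0 N]) (auto intro: pos)
  then have "negligible (\<Union>n. {t\<in>{0..real n}. w t \<noteq> 0})"
    by (intro negligible_countable_Union) auto
  then have "negligible ((\<Union>n. {t\<in>{0..real n}. w t \<noteq> 0}) \<union> N)" using N by (rule negligible_Un)
  then show "negligible {t. 0 < t \<and> f t \<noteq> step xs t}"
  proof (rule negligible_subset)
    show "{t. 0 < t \<and> f t \<noteq> step xs t} \<subseteq> (\<Union>n. {t\<in>{0..real n}. w t \<noteq> 0}) \<union> N"
    proof
      fix t assume t: "t \<in> {t. 0 < t \<and> f t \<noteq> step xs t}"
      obtain n where n: "t \<le> real n" using real_arch_simple by blast
      show "t \<in> (\<Union>n. {t\<in>{0..real n}. w t \<noteq> 0}) \<union> N"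
      proof (cases "t \<in> set xs")
        case False
        then have "(\<Prod>x\<leftarrow>xs. t - x) \<noteq> 0" using step_sign_of_prod[OF xs, of t] by linarith
        moreover have "poly q t > 0" using p(4) t by simp
        ultimately have "w t \<noteq> 0" using t unfolding w_def pt by simp
        then show ?thesis using t n by auto
      qed (simp add: N_def)
    qed
  qed
qed

text \<open>A step function with fewer knots than prescribed moments lies on the boundary of the moment space: its
  largest prescribed moment is already the minimum for the other ones, so the case of equality applies.\<close>

lemma step_determined_by_moments:
  assumes xs: "knots xs"
    and f: "negligible {t. 0 < t \<and> \<not> (0 \<le> f t \<and> f t \<le> 1)}"
    and E: "finite E" "length xs < card E" "\<forall>e\<in>E. 1 \<le> e"
    and mE: "\<forall>e\<in>E. has_moment f e (power_sum e xs)"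
  shows "negligible {t. 0 < t \<and> f t \<noteq> step xs t}"
proof -
  have ne: "E \<noteq> {}" using E by auto
  have M: "Max E \<in> E" using E ne by auto
  have "length xs \<le> card (E - {Max E})" using E M by simp
  moreover have "\<forall>e\<in>E - {Max E}. 1 \<le> e \<and> e < Max E" using E by (auto simp: order_less_le)
  ultimately show ?thesis
    using E mE M by (intro step_minimizes_next_moment(2)[OF xs f, of "E - {Max E}" "Max E" "power_sum (Max E) xs"]) auto
qed

lemma step_unit_interval:
  assumes "sorted_wrt (\<ge>) xs"
  shows "0 \<le> step xs t \<and> step xs t \<le> 1"
proof -
  have "0 \<le> step xs t" unfolding step_def by (rule alt_sum_bounds(1)[OF assms]) auto
  moreover have "step xs t \<le> 1"
  proof (cases "xs = []")
    case False
    have "step xs t \<le> of_bool (t < hd xs)" unfolding step_def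
      by (rule alt_sum_bounds(2)[OF assms _ _ False]) auto
    then show ?thesis by (rule order_trans) simp
  qed auto
  ultimately show ?thesis by simp
qed

text \<open>Peel off the largest knots: if they differ, one step function is \<open>1\<close> just below the larger one
  and the other still vanishes there.\<close>

lemma knots_eq_if_step_eq_ae:
  assumes "knots xs" "knots ys" "negligible {t. 0 < t \<and> step xs t \<noteq> step ys t}"
  shows "xs = ys"
proof -
  have hd_le: False
    if k: "knots (x # xs)" "knots ys" "negligible {t. 0 < t \<and> step (x # xs) t \<noteq> step ys t}"
      and y: "\<forall>y\<in>set ys. y < x" for x xs ys
  proof -
    define m where "m = Max (insert 0 (set xs \<union> set ys))"
    have m: "0 \<le> m" "\<forall>z\<in>set xs \<union> set ys. z \<le> m" unfolding m_def by auto
    have "m < x" using k y unfolding m_def by auto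
    have "{m<..<x} \<subseteq> {t. 0 < t \<and> step (x # xs) t \<noteq> step ys t}"
    proof
      fix t assume t: "t \<in> {m<..<x}"
      then have "step xs t = 0" "step ys t = 0" using m by (force intro: step_eq_0)+
      then show "t \<in> {t. 0 < t \<and> step (x # xs) t \<noteq> step ys t}" using t m by auto
    qed
    then have "negligible {m<..<x}" using k(3) negligible_subset by blast
    then show False using \<open>m < x\<close> negligible_interval(2)[of m x] by simp
  qed
  have sym: "{t. 0 < t \<and> step xs t \<noteq> step ys t} = {t. 0 < t \<and> step ys t \<noteq> step xs t}" for xs ys
    by auto
  show ?thesis
    using assms
  proof (induction xs arbitrary: ys)
    case Nil
    show ?case
    proof (cases ys)
      case (Cons y ys')
      then show ?thesis using hd_le[of y ys' "[]"] Nil sym[of "[]" ys] by auto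
    qed simp
  next
    case (Cons x xs)
    show ?case
    proof (cases ys)
      case Nil
      then show ?thesis using hd_le[of x xs "[]"] Cons by auto
    next
      case ys: (Cons y ys')
      have "\<not> y < x"
      proof
        assume "y < x"
        then have "\<forall>z\<in>set ys. z < x" using ys Cons.prems(2) by (auto intro: less_trans)
        then show False using hd_le[of x xs ys] Cons.prems by auto
      qed
      moreover have "\<not> x < y"
      proof
        assume "x < y"
        then have "\<forall>z\<in>set (x # xs). z < y" using Cons.prems(1) by (auto intro: less_trans)
        then show False using hd_le[of y ys' "x # xs"] Cons.prems sym[of "x # xs" ys] ys by auto
      qed
      ultimately have "x = y" by simp
      with Cons ys show ?thesis by auto
    qed
  qed
qed

text \<open>Limits of knot lists may have coinciding or vanishing knots. An equal pair cancels in the alternating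
  sum and a knot at \<open>0\<close> contributes nothing, so both can be dropped.\<close>

lemma weak_knots_reduce:
  assumes "sorted_wrt (\<ge>) ys" "\<forall>y\<in>set ys. 0 \<le> y"
  obtains xs where "knots xs" "length xs \<le> length ys" "length xs = length ys \<Longrightarrow> xs = ys"
    "\<And>e. e \<ge> 1 \<Longrightarrow> power_sum e xs = power_sum e ys"
proof -
  have "\<exists>xs. knots xs \<and> length xs \<le> length ys \<and> (length xs = length ys \<longrightarrow> xs = ys) \<and> set xs \<subseteq> set ys
    \<and> (\<forall>t\<ge>0. step xs t = step ys t) \<and> (\<forall>e\<ge>1. power_sum e xs = power_sum e ys)"
    using assms
  proof (induction ys)
    case Nil
    then show ?case by (intro exI[of _ "[]"]) auto
  next
    case (Cons y ys)
    then obtain xs where xs: "knots xs" "length xs \<le> length ys" "length xs = length ys \<longrightarrow> xs = ys"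
      "set xs \<subseteq> set ys" "\<forall>t\<ge>0. step xs t = step ys t" "\<forall>e\<ge>1. power_sum e xs = power_sum e ys"
      by auto
    consider "y = 0" | zs where "xs = y # zs" | "y > 0" "\<forall>x\<in>set xs. x < y"
    proof (cases xs)
      case Nil
      then show ?thesis using Cons.prems that by force
    next
      case (Cons x' zs)
      then have "x' \<le> y" using Cons.prems xs(4) by auto
      then show ?thesis using that Cons xs(1) Cons.prems
        by (cases "x' = y") force+
    qed
    then show ?case
    proof cases
      case 1
      then have "set xs \<subseteq> {0}" using Cons.prems xs(4) by force
      then have "xs = []" using knots_pos[OF xs(1)] by (cases xs) auto
      then show ?thesis using 1 xs by (intro exI[of _ "[]"]) auto
    next
      case 2
      have z: "step zs t = 0" if "y \<le> t" for t
        using xs(1) that unfolding 2 by (intro step_eq_0) force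
      have "step zs t = step (y # ys) t" if "0 \<le> t" for t
      proof -
        have "step ys t = of_bool (t < y) - step zs t" using xs(5) that 2 by simp
        then show ?thesis using z[of t] by (cases "t < y") auto
      qed
      moreover have "power_sum e zs = power_sum e (y # ys)" if "1 \<le> e" for e
        using xs(6) that 2 by (metis add_diff_cancel_left' diff_diff_eq2 power_sum_simps(2))
      moreover have "knots zs" "length zs < length ys" "set zs \<subseteq> set (y # ys)"
        using xs(1,2,4) 2 by auto
      ultimately show ?thesis by (intro exI[of _ zs]) auto
    next
      case 3
      then show ?thesis using xs by (intro exI[of _ "y # xs"]) auto
    qed
  qed
  then show ?thesis using that by blast
qed

section \<open>Realising moments by knots\<close>

lemma alt_sum_append: "alt_sum f (xs @ ys) = alt_sum f xs + (-1) ^ length xs * alt_sum f ys"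
  by (induction xs) auto

lemma power_sum_snoc: "power_sum e (xs @ [x]) = power_sum e xs + (-1) ^ length xs * x ^ e"
  by (simp add: power_sum_def alt_sum_append)

lemma alt_sum_upt: "alt_sum f (map b [0..<n]) = (\<Sum>j<n. (-1) ^ j * f (b j))"
  by (induction n) (simp_all add: alt_sum_append)

lemma step_ae_unit_interval:
  "sorted_wrt (\<ge>) xs \<Longrightarrow> negligible {t. 0 < t \<and> \<not> (0 \<le> step xs t \<and> step xs t \<le> 1)}"
  using step_unit_interval[of xs] by simp

lemma power_sum_minimal:
  assumes "knots xs" "knots ys" "finite E" "length xs \<le> card E" "\<forall>e\<in>E. 1 \<le> e \<and> e < e0" "1 \<le> e0"
    "\<forall>e\<in>E. power_sum e ys = power_sum e xs"
  shows "power_sum e0 xs \<le> power_sum e0 ys" "power_sum e0 ys \<le> power_sum e0 xs \<Longrightarrow> ys = xs"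
proof -
  have f: "negligible {t. 0 < t \<and> \<not> (0 \<le> step ys t \<and> step ys t \<le> 1)}"
    using step_ae_unit_interval[OF knots_sorted[OF assms(2)]] .
  have "\<forall>x\<in>set ys. 0 \<le> x" using knots_pos[OF assms(2)] by auto
  note mom = has_moment_step[OF this]
  have mE: "\<forall>e\<in>E. has_moment (step ys) e (power_sum e xs)"
    using mom assms(5,7) by (metis)
  show "power_sum e0 xs \<le> power_sum e0 ys"
    by (rule step_minimizes_next_moment(1)[OF assms(1) f assms(3-6) mE mom[OF assms(6)]])
  show "ys = xs" if "power_sum e0 ys \<le> power_sum e0 xs"
    by (rule knots_eq_if_step_eq_ae[OF assms(2,1)])
       (rule step_minimizes_next_moment(2)[OF assms(1) f assms(3-6) mE mom[OF assms(6)] that])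
qed

lemma knots_unique:
  assumes "knots xs" "knots ys" "finite E" "length xs \<le> card E" "length ys \<le> card E" "\<forall>e\<in>E. 1 \<le> e"
    "\<forall>e\<in>E. power_sum e ys = power_sum e xs"
  shows "ys = xs"
proof -
  define e0 where "e0 = Suc (Max (insert 0 E))"
  have "e < e0" if "e \<in> E" for e unfolding e0_def using assms(3) that by (simp add: less_Suc_eq_le)
  then have e: "\<forall>e\<in>E. 1 \<le> e \<and> e < e0" using assms(6) by auto
  have e0: "1 \<le> e0" by (simp add: e0_def)
  show ?thesis
    using power_sum_minimal(1)[OF assms(2,1,3,5) e e0] assms(7)
    by (intro power_sum_minimal(2)[OF assms(1-4) e e0]) auto
qed

text \<open>Vectors of \<open>n\<close> knots are functions on the natural numbers that vanish from \<open>n\<close> on, so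
  that the dimension is a number and may vary inside a proof.\<close>

abbreviation Euclid :: "nat \<Rightarrow> (nat \<Rightarrow> real) set" where
  "Euclid n \<equiv> {b. \<forall>i\<ge>n. b i = 0}"

lemma Euclidean_space_top_of_set: "Euclidean_space n = top_of_set (Euclid n)"
  by (simp add: Euclidean_space_def euclidean_product_topology)

lemma open_knots_upt: "open {b :: nat \<Rightarrow> real. knots (map b [0..<n])}"
proof -
  have "{b :: nat \<Rightarrow> real. knots (map b [0..<n])}
     = (\<Inter>j\<in>{..<n}. (\<Inter>i\<in>{..<j}. {b. b j < b i})) \<inter> (\<Inter>j\<in>{..<n}. {b. 0 < b j})"
    unfolding knots_def sorted_wrt_iff_nth_less by auto (use less_trans in blast)?
  also have "open \<dots>"
    by (intro open_Int open_INT ballI open_Collect_less continuous_intros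
        continuous_on_product_coordinates finite_lessThan)
  finally show ?thesis .
qed

text \<open>A vector of \<open>n\<close> knots is determined by \<open>n\<close> of its power sums; being continuous and
  injective between spaces of equal dimension, the map to the power sums is open.\<close>

lemma power_sums_open_map:
  assumes es: "distinct es" "\<forall>e\<in>set es. 1 \<le> e"
    and W: "open W" "\<And>b. b \<in> W \<Longrightarrow> knots (map b [0..<length es])"
  obtains V where "open V"
    "(\<lambda>b i. if i < length es then power_sum (es ! i) (map b [0..<length es]) else 0) `
       (W \<inter> Euclid (length es)) = V \<inter> Euclid (length es)"
proof -
  let ?N = "length es"
  define F where "F = (\<lambda>b i. if i < ?N then power_sum (es ! i) (map b [0..<?N]) else 0)"
  let ?U = "W \<inter> Euclid ?N"
  have U: "openin (Euclidean_space ?N) ?U"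
    unfolding Euclidean_space_top_of_set using W(1) by (auto simp: openin_open)
  have sub: "subtopology (Euclidean_space ?N) ?U = top_of_set ?U"
  proof -
    have "Euclid ?N \<inter> ?U = ?U" by blast
    then show ?thesis unfolding Euclidean_space_top_of_set subtopology_subtopology by (rule arg_cong)
  qed
  have "continuous_map (top_of_set ?U) euclideanreal (\<lambda>b. power_sum (es ! i) (map b [0..<?N]))" for i
    unfolding power_sum_def alt_sum_upt continuous_map_iff_continuous
    by (intro continuous_intros continuous_on_subset[OF continuous_on_product_coordinates]) auto
  then have cm: "continuous_map (subtopology (Euclidean_space ?N) ?U) (Euclidean_space ?N) F"
    unfolding F_def continuous_map_componentwise_Euclidean_space sub by blast
  have "inj_on F ?U"
  proof (rule inj_onI)
    fix b b' assume b: "b \<in> ?U" "b' \<in> ?U" and eq: "F b = F b'"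
    have ps: "power_sum e (map b' [0..<?N]) = power_sum e (map b [0..<?N])" if e: "e \<in> set es" for e
    proof -
      obtain i where "i < ?N" "e = es ! i" using e by (metis in_set_conv_nth)
      then show ?thesis using fun_cong[OF eq, of i] by (simp add: F_def)
    qed
    have "map b' [0..<?N] = map b [0..<?N]"
    proof (rule knots_unique[of _ _ "set es"])
      show "knots (map b [0..<?N])" "knots (map b' [0..<?N])" using b by (auto intro: W(2))
      show "\<forall>e\<in>set es. power_sum e (map b' [0..<?N]) = power_sum e (map b [0..<?N])"
        using ps by blast
    qed (use es in \<open>auto simp: distinct_card\<close>)
    then have eq': "b' i = b i" if "i < ?N" for i using that unfolding list_eq_iff_nth_eq by simp
    show "b = b'"
    proof
      fix i show "b i = b' i" using eq'[of i] b by (cases "i < ?N") auto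
    qed
  qed
  from invariance_of_domain_Euclidean_space[OF U cm this]
  obtain V where "open V" "F ` ?U = Euclid ?N \<inter> V"
    unfolding Euclidean_space_top_of_set openin_open by blast
  then show ?thesis using that[of V] by (auto simp: F_def)
qed

lemma bounded_coordinates_convergent_subseq:
  fixes b :: "nat \<Rightarrow> nat \<Rightarrow> real"
  assumes "\<And>k j. j < n \<Longrightarrow> 0 \<le> b k j \<and> b k j \<le> B"
  shows "\<exists>\<rho> c. strict_mono \<rho> \<and> (\<forall>j<n. (\<lambda>k. b (\<rho> k) j) \<longlonglongrightarrow> c j)"
  using assms
proof (induction n)
  case 0
  then show ?case by (intro exI[of _ "\<lambda>k. k"]) (simp add: strict_mono_def)
next
  case (Suc n)
  then obtain \<rho> c where \<rho>: "strict_mono \<rho>" "\<forall>j<n. (\<lambda>k. b (\<rho> k) j) \<longlonglongrightarrow> c j" by force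
  have "\<forall>k. b (\<rho> k) n \<in> {0..B}" using Suc.prems by auto
  with compact_Icc[of 0 B] obtain l \<sigma> where \<sigma>: "strict_mono \<sigma>" "((\<lambda>k. b (\<rho> k) n) \<circ> \<sigma>) \<longlonglongrightarrow> l"
    unfolding compact_def by metis
  have "(\<lambda>k. b ((\<rho> \<circ> \<sigma>) k) j) \<longlonglongrightarrow> (c(n := l)) j" if "j < Suc n" for j
  proof (cases "j = n")
    case True
    then show ?thesis using \<sigma>(2) by (simp add: o_def)
  next
    case False
    with that \<rho>(2) have "(\<lambda>k. b (\<rho> k) j) \<longlonglongrightarrow> c j" by simp
    from LIMSEQ_subseq_LIMSEQ[OF this \<sigma>(1)] False show ?thesis by (simp add: o_def)
  qed
  then show ?case using strict_mono_o[OF \<rho>(1) \<sigma>(1)] by blast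
qed

lemma power_diff_lower_le:
  fixes x y :: real
  assumes "0 \<le> y" "y \<le> x" "e \<le> e0"
  shows "y ^ (e0 - e) * (x ^ e - y ^ e) \<le> x ^ e0 - y ^ e0"
proof -
  have "y ^ (e0 - e) * x ^ e \<le> x ^ (e0 - e) * x ^ e"
    using assms by (intro mult_right_mono power_mono) auto
  moreover have "x ^ (e0 - e) * x ^ e = x ^ e0" "y ^ (e0 - e) * y ^ e = y ^ e0"
    using assms(3) by (simp_all flip: power_add)
  ultimately show ?thesis by (simp add: right_diff_distrib)
qed

lemma power_sum_nonneg:
  assumes "sorted_wrt (\<ge>) xs" "\<forall>x\<in>set xs. 0 \<le> x"
  shows "0 \<le> power_sum e xs"
  unfolding power_sum_def using assms by (intro alt_sum_bounds(1)) (auto intro: power_mono)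

text \<open>Compactness of families of knots with a bounded power sum of the top order \<open>e0\<close>. If the largest
  knots stay bounded, a subsequence converges. Otherwise the largest knot \<open>x\<close> escapes along a
  subsequence, and the bound on \<open>x\<^sup>e\<^sup>0 - y\<^sup>e\<^sup>0\<close> forces the second knot \<open>y\<close> to escape with
  it. Such a pair may keep a positive share of the moment of order \<open>e0\<close>, but its share of every
  lower moment tends to \<open>0\<close>. So the pair can be removed, and the limit has at least two knots fewer.\<close>

lemma bounded_power_sums_compact:
  assumes "\<And>k. length (L k) = N" "\<And>k. sorted_wrt (\<ge>) (L k)" "\<And>k. \<forall>x\<in>set (L k). 0 \<le> x"
    and E: "\<forall>e\<in>E. 1 \<le> e \<and> e < e0" "1 \<le> e0"
    and "\<And>e. e \<in> E \<Longrightarrow> (\<lambda>k. power_sum e (L k)) \<longlonglongrightarrow> T e"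
    and "\<And>k. power_sum e0 (L k) \<le> K"
  shows "\<exists>c. sorted_wrt (\<ge>) c \<and> (\<forall>x\<in>set c. 0 \<le> x) \<and> (\<forall>e\<in>E. power_sum e c = T e) \<and>
    (length c = N \<and> (\<exists>\<rho>. filterlim \<rho> sequentially sequentially \<and>
          (\<lambda>k. power_sum e0 (L (\<rho> k))) \<longlonglongrightarrow> power_sum e0 c) \<or> length c + 2 \<le> N)"
  using assms(1-3,6-7)
proof (induction N arbitrary: L rule: less_induct)
  case (less N L)
  show ?case
  proof (cases "\<exists>k0. \<forall>j\<ge>k0. \<forall>x\<in>set (L j). x \<le> real k0")
    case True
    then obtain k0 where k0: "\<forall>j\<ge>k0. \<forall>x\<in>set (L j). x \<le> real k0" by blast
    have "0 \<le> L (k + k0) ! j \<and> L (k + k0) ! j \<le> real k0" if "j < N" for k j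
      using k0 less.prems(1,3)[of "k + k0"] that by (metis le_add2 nth_mem)
    then obtain \<rho> c where \<rho>: "strict_mono \<rho>" "\<forall>j<N. (\<lambda>k. L (\<rho> k + k0) ! j) \<longlonglongrightarrow> c j"
      using bounded_coordinates_convergent_subseq[of N "\<lambda>k j. L (k + k0) ! j" "real k0"] by blast
    define \<sigma> where "\<sigma> k = \<rho> k + k0" for k
    have \<sigma>: "filterlim \<sigma> sequentially sequentially"
      unfolding \<sigma>_def by (rule filterlim_at_top_mono[OF filterlim_subseq[OF \<rho>(1)]]) auto
    have lim: "(\<lambda>k. L (\<sigma> k) ! j) \<longlonglongrightarrow> c j" if "j < N" for j using \<rho>(2) that by (simp add: \<sigma>_def)
    have ps: "power_sum e (L k) = (\<Sum>j<N. (-1) ^ j * (L k ! j) ^ e)" for e k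
    proof -
      have "power_sum e (L k) = power_sum e (map (\<lambda>j. L k ! j) [0..<N])"
        using less.prems(1)[of k] map_nth[of "L k"] by simp
      then show ?thesis by (simp only: power_sum_def alt_sum_upt)
    qed
    have psl: "(\<lambda>k. power_sum e (L (\<sigma> k))) \<longlonglongrightarrow> power_sum e (map c [0..<N])" for e
      unfolding ps unfolding power_sum_def alt_sum_upt by (intro tendsto_intros lim) auto
    have "power_sum e (map c [0..<N]) = T e" if "e \<in> E" for e
      using LIMSEQ_unique[OF psl filterlim_compose[OF less.prems(4)[OF that] \<sigma>]] .
    moreover have "c j \<le> c i" if "i < j" "j < N" for i j
    proof (rule LIMSEQ_le[OF lim lim])
      have "L (\<sigma> n) ! j \<le> L (\<sigma> n) ! i" for n
        using less.prems(1,2)[of "\<sigma> n"] that by (simp add: sorted_wrt_iff_nth_less)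
      then show "\<exists>N. \<forall>n\<ge>N. L (\<sigma> n) ! j \<le> L (\<sigma> n) ! i" by blast
    qed (use that in auto)
    then have "sorted_wrt (\<ge>) (map c [0..<N])" by (simp add: sorted_wrt_iff_nth_less)
    moreover have "0 \<le> c j" if "j < N" for j
      using less.prems(1,3) that by (intro LIMSEQ_le_const[OF lim[OF that]]) (metis nth_mem)
    ultimately show ?thesis using psl \<sigma> by (intro exI[of _ "map c [0..<N]"]) auto
  next
    case False
    have "\<exists>j\<ge>k. \<exists>x\<in>set (L j). real k < x" for k using False by (meson not_le)
    then obtain \<rho> where \<rho>: "\<And>k. \<rho> k \<ge> k" "\<And>k. \<exists>x\<in>set (L (\<rho> k)). real k < x" by metis
    have \<rho>lim: "filterlim \<rho> sequentially sequentially"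
      using \<rho>(1) by (intro filterlim_at_top_mono[OF filterlim_ident]) auto
    have K0: "0 \<le> K" using power_sum_nonneg[OF less.prems(2,3)] less.prems(5) order_trans by blast
    have ex: "\<exists>x y zs. L (\<rho> k) = x # y # zs \<and> real k < x" if k: "k > K" for k :: nat
    proof -
      obtain x xs where x: "L (\<rho> k) = x # xs" using \<rho>(2)[of k] by (cases "L (\<rho> k)") auto
      then have kx: "real k < x" using \<rho>(2)[of k] less.prems(2)[of "\<rho> k"] by force
      moreover have "xs \<noteq> []"
      proof
        assume "xs = []"
        then have "x ^ e0 \<le> K" using less.prems(5)[of "\<rho> k"] x by simp
        moreover have "1 < x" using kx k K0 by (cases k) auto
        then have "x \<le> x ^ e0" using E(2) by (intro self_le_power) auto
        ultimately show False using kx k by simp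
      qed
      ultimately show ?thesis using x by (cases xs) auto
    qed
    obtain k1 :: nat where k1: "K + 1 < k1" using reals_Archimedean2 by blast
    define M where "M k = L (\<rho> (k + k1))" for k
    have "\<forall>k. \<exists>x y zs. M k = x # y # zs \<and> real (k + k1) < x"
      unfolding M_def using k1 by (intro allI ex) simp
    then obtain x y Z where M: "\<And>k. M k = x k # y k # Z k" "\<And>k. real (k + k1) < x k" by metis
    have Ms: "sorted_wrt (\<ge>) (M k)" "\<forall>z\<in>set (M k). 0 \<le> z" "length (M k) = N" for k
      using less.prems(1-3) by (auto simp: M_def)
    have Zs: "sorted_wrt (\<ge>) (Z k)" "\<forall>z\<in>set (Z k). 0 \<le> z" "length (Z k) = N - 2" "2 \<le> N" "0 \<le> y k" "y k \<le> x k" for k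
      using Ms[of k] M(1)[of k] by auto
    have PM: "power_sum e (M k) = (x k ^ e - y k ^ e) + power_sum e (Z k)" for e k
      by (simp add: M(1))
    have dpos: "0 \<le> x k ^ e - y k ^ e" for k e using power_mono[OF Zs(6,5)] by simp
    have PMK: "power_sum e0 (M k) \<le> K" for k using less.prems(5) by (simp add: M_def)
    have dK: "x k ^ e0 - y k ^ e0 \<le> K" for k
      using PMK[of k] PM[of e0 k] power_sum_nonneg[OF Zs(1,2), of e0 k] by linarith
    have PZK: "power_sum e0 (Z k) \<le> K" for k
      using PMK[of k] PM[of e0 k] dpos[of k e0] by linarith
    have x1: "1 \<le> x k" for k using M(2)[of k] k1 K0 by simp
    \<comment> \<open>Since \<open>x k \<ge> 1\<close>, the gap \<open>x k - y k\<close> is at most the bounded difference of the powers.\<close>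
    have yk: "real k + 1 \<le> y k" for k
    proof -
      have "x k - y k \<le> x k ^ (e0 - 1) * (x k - y k)"
        using mult_right_mono[OF one_le_power[OF x1[of k], of "e0 - 1"], of "x k - y k"] Zs(6)[of k]
        by simp
      also have "\<dots> = x k ^ e0 - x k ^ (e0 - 1) * y k"
        using power_minus_mult[of e0 "x k"] E(2) by (simp add: right_diff_distrib)
      also have "\<dots> \<le> x k ^ e0 - y k ^ (e0 - 1) * y k"
        by (intro diff_left_mono mult_right_mono power_mono Zs(5,6))
      also have "\<dots> = x k ^ e0 - y k ^ e0" using power_minus_mult[of e0 "y k"] E(2) by simp
      finally show ?thesis using dK[of k] M(2)[of k] k1 by simp
    qed
    have d0: "(\<lambda>k. x k ^ e - y k ^ e) \<longlonglongrightarrow> 0" if e: "e \<in> E" for e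
    proof (rule tendsto_sandwich[of "\<lambda>_. 0" _ _ "\<lambda>k. K / (real k + 1)"])
      show "\<forall>\<^sub>F k in sequentially. x k ^ e - y k ^ e \<le> K / (real k + 1)"
      proof (rule always_eventually, rule allI)
        fix k
        have "e < e0" using E e by auto
        have "1 \<le> y k" using yk[of k] by simp
        then have "real k + 1 \<le> y k ^ (e0 - e)"
          by (rule order_trans[OF yk self_le_power]) (simp add: \<open>e < e0\<close>)
        then have "(real k + 1) * (x k ^ e - y k ^ e) \<le> y k ^ (e0 - e) * (x k ^ e - y k ^ e)"
          by (rule mult_right_mono[OF _ dpos])
        also have "\<dots> \<le> x k ^ e0 - y k ^ e0"
          using \<open>e < e0\<close> Zs(5,6) by (intro power_diff_lower_le) auto
        also have "\<dots> \<le> K" by (rule dK)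
        finally show "x k ^ e - y k ^ e \<le> K / (real k + 1)"
          by (simp add: pos_le_divide_eq mult.commute)
      qed
      show "(\<lambda>k. K / (real k + 1)) \<longlonglongrightarrow> 0"
        using LIMSEQ_Suc[OF lim_const_over_n[of K]] by (simp add: add.commute)
    qed (simp_all only: dpos always_eventually tendsto_const simp_thms)
    have "filterlim (\<lambda>k. \<rho> (k + k1)) sequentially sequentially"
    proof (rule filterlim_at_top_mono[OF filterlim_ident])
      have "k \<le> \<rho> (k + k1)" for k using \<rho>(1)[of "k + k1"] by simp
      then show "\<forall>\<^sub>F k in sequentially. k \<le> \<rho> (k + k1)" by simp
    qed
    then have PMT: "(\<lambda>k. power_sum e (M k)) \<longlonglongrightarrow> T e" if "e \<in> E" for e
      unfolding M_def by (rule filterlim_compose[OF less.prems(4)[OF that]])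
    have PZT: "(\<lambda>k. power_sum e (Z k)) \<longlonglongrightarrow> T e" if "e \<in> E" for e
      using tendsto_diff[OF PMT[OF that] d0[OF that]] by (simp add: PM)
    have "N - 2 < N" using Zs(4) by simp
    from less.IH[OF this Zs(3) Zs(1) Zs(2) PZT PZK] obtain c where
      "sorted_wrt (\<ge>) c" "\<forall>x\<in>set c. 0 \<le> x" "\<forall>e\<in>E. power_sum e c = T e" "length c \<le> N - 2"
      by fastforce
    then show ?thesis using Zs(4) by (intro exI[of _ c]) auto
  qed
qed

text \<open>A tiny knot \<open>\<epsilon>\<close> perturbs the power sums by as little as desired, and by openness the given knots
  can be moved slightly to compensate. The bound \<open>\<delta>\<close> keeps them above the new knot.\<close>

lemma small_extra_knot:
  assumes xs: "knots xs" and E: "finite E" "\<forall>e\<in>E. 1 \<le> e" "length xs = card E"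
  shows "\<exists>ys. knots ys \<and> length ys = Suc (length xs) \<and> (\<forall>e\<in>E. power_sum e ys = power_sum e xs)"
proof -
  define es where "es = sorted_list_of_set E"
  have es: "distinct es" "set es = E" "length es = card E" using E by (auto simp: es_def)
  define n where "n = length es"
  have n: "length xs = n" using E es by (simp add: n_def)
  define \<delta> where "\<delta> = (if xs = [] then 1 else Min (set xs)) / 2"
  have \<delta>: "0 < \<delta>" "\<And>x. x \<in> set xs \<Longrightarrow> \<delta> < x"
  proof -
    show "0 < \<delta>" using knots_pos[OF xs] by (auto simp: \<delta>_def)
    fix x assume x: "x \<in> set xs"
    then have "Min (set xs) \<le> x" "xs \<noteq> []" "0 < x" using knots_pos[OF xs] by auto
    then show "\<delta> < x" by (simp add: \<delta>_def)
  qed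
  define W where "W = {b :: nat \<Rightarrow> real. knots (map b [0..<n])} \<inter> (\<Inter>j\<in>{..<n}. {b. \<delta> < b j})"
  have "open W" unfolding W_def
    by (intro open_Int open_INT ballI open_Collect_less continuous_intros open_knots_upt
        continuous_on_product_coordinates finite_lessThan)
  then obtain V where V: "open V"
    "(\<lambda>b i. if i < n then power_sum (es ! i) (map b [0..<n]) else 0) ` (W \<inter> Euclid n) = V \<inter> Euclid n"
    using power_sums_open_map[of es W] es E unfolding n_def[symmetric] W_def by auto
  define pt where "pt \<epsilon> i = (if i < n then power_sum (es ! i) xs - (-1) ^ n * \<epsilon> ^ (es ! i) else 0)" for \<epsilon> i
  define a where "a i = (if i < n then xs ! i else 0)" for i
  have "map a [0..<n] = map (\<lambda>i. xs ! i) [0..<n]" by (rule map_cong) (auto simp: a_def)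
  also have "\<dots> = xs" using map_nth[of xs] n by simp
  finally have a: "map a [0..<n] = xs" .
  have "a \<in> W \<inter> Euclid n" using \<delta>(2) xs n by (auto simp: W_def a) (auto simp: a_def)
  moreover have "pt 0 = (\<lambda>i. if i < n then power_sum (es ! i) (map a [0..<n]) else 0)"
  proof
    fix i
    have "es ! i \<noteq> 0" if "i < n"
    proof -
      have "es ! i \<in> E" using that es(2) by (auto simp: n_def)
      then show ?thesis using E(2) by force
    qed
    then show "pt 0 i = (if i < n then power_sum (es ! i) (map a [0..<n]) else 0)"
      by (cases "i < n") (simp_all add: pt_def a power_0_left)
  qed
  ultimately have p0: "pt 0 \<in> V" using V(2) by (metis (no_types, lifting) IntD1 image_eqI)
  have "continuous_on UNIV pt"
    unfolding pt_def
  proof (rule continuous_on_coordinatewise_then_product)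
    fix i show "continuous_on UNIV (\<lambda>\<epsilon>. if i < n then power_sum (es ! i) xs - (- 1) ^ n * \<epsilon> ^ (es ! i) else 0)"
      by (cases "i < n") (auto intro!: continuous_intros)
  qed
  then have "open (pt -` V)" using V(1) by (simp add: continuous_on_open_vimage)
  moreover have "0 \<in> pt -` V" using p0 by simp
  ultimately obtain \<eta> where \<eta>: "\<eta> > 0" "ball 0 \<eta> \<subseteq> pt -` V" by (meson open_contains_ball)
  define \<epsilon> where "\<epsilon> = min \<eta> \<delta> / 2"
  have \<epsilon>: "0 < \<epsilon>" "\<epsilon> < \<eta>" "\<epsilon> < \<delta>" using \<eta>(1) \<delta>(1) by (auto simp: \<epsilon>_def)
  have "\<epsilon> \<in> ball 0 \<eta>" using \<epsilon> by simp
  then have "pt \<epsilon> \<in> V" using \<eta>(2) by auto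
  then have "pt \<epsilon> \<in> V \<inter> Euclid n" by (auto simp: pt_def)
  then obtain b where b: "b \<in> W" "pt \<epsilon> = (\<lambda>i. if i < n then power_sum (es ! i) (map b [0..<n]) else 0)"
    using V(2) by (metis (no_types, lifting) IntD1 image_iff)
  let ?ys = "map b [0..<n] @ [\<epsilon>]"
  have "knots ?ys" using b(1) \<epsilon> unfolding W_def knots_def by (auto simp: sorted_wrt_append intro: less_trans)
  moreover have "power_sum e ?ys = power_sum e xs" if e: "e \<in> E" for e
  proof -
    obtain i where "i < n" "e = es ! i" using e es by (metis in_set_conv_nth n_def)
    then show ?thesis using fun_cong[OF b(2), of i] by (simp add: pt_def power_sum_snoc)
  qed
  ultimately show ?thesis using n by (intro exI[of _ ?ys]) auto
qed

text \<open>With one more knot and the lower moments fixed, the next moment takes every value above its minimum.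
  The set \<open>R\<close> of the values that occur is nonempty by the previous lemma and lies above the minimum
  by the extremal property. It is open because the power sum map is open. It is closed in the half-line
  above the minimum: a limit of such knots either has the full number of knots, or it reduces to at most
  as many knots as \<open>xs\<close>, and then it is \<open>xs\<close> by uniqueness. This cannot happen: if no knots
  escaped, the limit value would be the minimum, and if a pair escaped, there are fewer knots left than
  \<open>xs\<close> has. As the half-line is connected, \<open>R\<close> is all of it.\<close>

lemma extra_knot_with_prescribed_moment:
  assumes xs: "knots xs" and E: "finite E" "\<forall>e\<in>E. 1 \<le> e \<and> e < e0" "1 \<le> e0" "length xs = card E"
    and m: "power_sum e0 xs < m"
  shows "\<exists>ys. knots ys \<and> length ys = Suc (length xs) \<and> (\<forall>e\<in>E. power_sum e ys = power_sum e xs) \<and>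
           power_sum e0 ys = m"
proof -
  define R where "R = {m. \<exists>ys. knots ys \<and> length ys = Suc (length xs) \<and>
     (\<forall>e\<in>E. power_sum e ys = power_sum e xs) \<and> power_sum e0 ys = m}"
  define S where "S = {power_sum e0 xs<..}"
  have RS: "R \<subseteq> S"
  proof
    fix m assume "m \<in> R"
    then obtain ys where ys: "knots ys" "length ys = Suc (length xs)"
      "\<forall>e\<in>E. power_sum e ys = power_sum e xs" "power_sum e0 ys = m" unfolding R_def by blast
    have "ys \<noteq> xs" using ys(2) by auto
    with power_sum_minimal(2)[OF xs ys(1) E(1) _ E(2,3) ys(3)] E(4) ys(4)
    show "m \<in> S" by (force simp: S_def)
  qed
  have "R \<noteq> {}" using small_extra_knot[OF xs E(1) _ E(4)] E(2) unfolding R_def by blast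
  have "open R"
  proof -
    define es where "es = sorted_list_of_set E @ [e0]"
    define n where "n = card E"
    have es: "distinct es" "\<forall>e\<in>set es. 1 \<le> e" "length es = Suc n" "es ! n = e0"
      "\<And>i. i < n \<Longrightarrow> es ! i \<in> E" "\<And>e. e \<in> E \<Longrightarrow> \<exists>i<n. e = es ! i"
    proof -
      show "distinct es" "\<forall>e\<in>set es. 1 \<le> e" "length es = Suc n" using E by (auto simp: es_def n_def)
      show "es ! n = e0" by (simp add: es_def n_def nth_append)
      show "es ! i \<in> E" if "i < n" for i
        using that E(1) nth_mem[of i "sorted_list_of_set E"] by (simp add: es_def n_def nth_append)
      show "\<exists>i<n. e = es ! i" if e: "e \<in> E" for e
      proof -
        have "e \<in> set (sorted_list_of_set E)" using e E(1) by simp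
        then obtain i where "i < n" "e = sorted_list_of_set E ! i"
          by (auto simp: in_set_conv_nth n_def)
        then show ?thesis by (intro exI[of _ i]) (simp add: es_def n_def nth_append)
      qed
    qed
    let ?F = "\<lambda>b i. if i < Suc n then power_sum (es ! i) (map b [0..<Suc n]) else 0"
    let ?W = "{b :: nat \<Rightarrow> real. knots (map b [0..<Suc n])}"
    obtain V where V: "open V" "?F ` (?W \<inter> Euclid (Suc n)) = V \<inter> Euclid (Suc n)"
      using power_sums_open_map[OF es(1,2), of ?W] open_knots_upt[of "Suc n"] unfolding es(3) by blast
    define pt where "pt m i = (if i < n then power_sum (es ! i) xs else if i = n then m else 0)" for m i
    have "m \<in> R \<longleftrightarrow> pt m \<in> V" for m
    proof
      assume "m \<in> R"
      then obtain ys where ys: "knots ys" "length ys = Suc n"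
        "\<forall>e\<in>E. power_sum e ys = power_sum e xs" "power_sum e0 ys = m" unfolding R_def E(4) n_def by blast
      define a where "a i = (if i < Suc n then ys ! i else 0)" for i
      have "map a [0..<Suc n] = map (\<lambda>i. ys ! i) [0..<Suc n]" by (rule map_cong) (auto simp: a_def)
      also have "\<dots> = ys" using map_nth[of ys] ys(2) by simp
      finally have a: "map a [0..<Suc n] = ys" .
      have "?F a = pt m"
        unfolding a using ys(3,4) es(4,5) by (auto simp: pt_def fun_eq_iff less_Suc_eq)
      moreover have "a \<in> ?W \<inter> Euclid (Suc n)" using ys(1) a by (auto simp: a_def)
      ultimately show "pt m \<in> V" using V(2) by (metis (no_types, lifting) IntD1 image_eqI)
    next
      assume "pt m \<in> V"
      then have "pt m \<in> V \<inter> Euclid (Suc n)" by (auto simp: pt_def)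
      then obtain b where b: "b \<in> ?W" "pt m = ?F b"
        using V(2) by (metis (no_types, lifting) IntD1 image_iff)
      have "power_sum e (map b [0..<Suc n]) = power_sum e xs" if e: "e \<in> E" for e
      proof -
        obtain i where "i < n" "e = es ! i" using es(6)[OF e] by blast
        then show ?thesis using fun_cong[OF b(2), of i] by (simp add: pt_def)
      qed
      moreover have "power_sum e0 (map b [0..<Suc n]) = m"
        using fun_cong[OF b(2), of n] es(4) by (simp add: pt_def)
      ultimately show "m \<in> R"
        using b(1) E(4) unfolding R_def n_def by (intro CollectI exI[of _ "map b [0..<Suc (card E)]"]) auto
    qed
    then have "R = pt -` V" by auto
    moreover have "continuous_on UNIV pt"
      unfolding pt_def
    proof (rule continuous_on_coordinatewise_then_product)
      fix i show "continuous_on UNIV (\<lambda>m. if i < n then power_sum (es ! i) xs else if i = n then m else 0)"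
        by (cases "i < n"; cases "i = n") (auto intro!: continuous_intros)
    qed
    ultimately show ?thesis using V(1) by (simp add: continuous_on_open_vimage)
  qed
  have cl: "l \<in> R" if t: "\<And>k. t k \<in> R" "t \<longlonglongrightarrow> l" "l \<in> S" for t l
  proof -
    obtain L where L: "\<And>k. knots (L k)" "\<And>k. length (L k) = Suc (length xs)"
      "\<And>k. \<forall>e\<in>E. power_sum e (L k) = power_sum e xs" "\<And>k. power_sum e0 (L k) = t k"
      using t(1) unfolding R_def mem_Collect_eq by metis
    obtain K where K: "\<And>k. t k \<le> K"
      using convergent_imp_Bseq[OF convergentI[OF t(2)]] unfolding Bseq_def by (auto dest: abs_le_D1)
    have "\<exists>c. sorted_wrt (\<ge>) c \<and> (\<forall>x\<in>set c. 0 \<le> x) \<and> (\<forall>e\<in>E. power_sum e c = power_sum e xs) \<and>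
      (length c = Suc (length xs) \<and> (\<exists>\<rho>. filterlim \<rho> sequentially sequentially \<and>
          (\<lambda>k. power_sum e0 (L (\<rho> k))) \<longlonglongrightarrow> power_sum e0 c) \<or> length c + 2 \<le> Suc (length xs))"
      using L K by (intro bounded_power_sums_compact[where K = K] E knots_sorted) (auto dest: knots_pos intro: less_imp_le)
    then obtain c where c: "sorted_wrt (\<ge>) c" "\<forall>x\<in>set c. 0 \<le> x" "\<forall>e\<in>E. power_sum e c = power_sum e xs"
      "length c = Suc (length xs) \<and> (\<exists>\<rho>. filterlim \<rho> sequentially sequentially \<and>
          (\<lambda>k. power_sum e0 (L (\<rho> k))) \<longlonglongrightarrow> power_sum e0 c) \<or> length c + 2 \<le> Suc (length xs)" by blast
    obtain ys where ys: "knots ys" "length ys \<le> length c" "length ys = length c \<Longrightarrow> ys = c"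
      "\<And>e. e \<ge> 1 \<Longrightarrow> power_sum e ys = power_sum e c"
      using weak_knots_reduce[OF c(1,2)] by metis
    have yxs: "\<forall>e\<in>E. power_sum e ys = power_sum e xs" using ys(4) c(3) E(2) by auto
    \<comment> \<open>Degenerate limits collapse to the spline one started from.\<close>
    have small: "ys = xs" if "length ys \<le> length xs"
      using that E yxs by (intro knots_unique[OF xs ys(1) E(1)]) auto
    from c(4) show ?thesis
    proof (elim disjE conjE exE)
      fix \<rho> assume len: "length c = Suc (length xs)" and \<rho>: "filterlim \<rho> sequentially sequentially"
        and "(\<lambda>k. power_sum e0 (L (\<rho> k))) \<longlonglongrightarrow> power_sum e0 c"
      then have "(\<lambda>k. t (\<rho> k)) \<longlonglongrightarrow> power_sum e0 c" by (simp add: L(4))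
      with filterlim_compose[OF t(2) \<rho>] have l: "power_sum e0 c = l" by (rule LIMSEQ_unique[symmetric])
      show "l \<in> R"
      proof (cases "length ys = length c")
        case True
        then show ?thesis using ys(1,3) len l c(3) unfolding R_def by auto
      next
        case False
        then have "ys = xs" using ys(2) len by (intro small) auto
        then have "l = power_sum e0 xs" using ys(4)[OF E(3)] l by simp
        then show ?thesis using t(3) by (simp add: S_def)
      qed
    next
      assume "length c + 2 \<le> Suc (length xs)"
      then have "length ys < length xs" using ys(2) by simp
      with small show ?thesis by simp
    qed
  qed
  have "openin (top_of_set S) R" using \<open>open R\<close> RS by (simp add: open_openin_trans open_subset)
  moreover have "closedin (top_of_set S) R"
    using cl RS by (auto simp: closedin_limpt islimpt_sequential)
  moreover have "connected S" by (simp add: S_def)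
  ultimately have "R = S" using \<open>R \<noteq> {}\<close> by (auto simp: connected_clopen)
  then show ?thesis using m by (auto simp: R_def S_def)
qed

text \<open>Treat the exponents in increasing order. Given knots for the lower ones, the next moment of \<open>f\<close> is
  at least that of the step function. If it is equal, nothing is to be done. If it is larger, the step
  function cannot be a boundary point, so it has the full number of knots, and one more knot
  adjusts the next moment.\<close>

lemma exists_knots_with_moments:
  assumes f: "negligible {t. 0 < t \<and> \<not> (0 \<le> f t \<and> f t \<le> 1)}"
    and "finite E" "\<forall>e\<in>E. 1 \<le> e \<and> has_moment f e (\<mu> e)"
  shows "\<exists>xs. knots xs \<and> length xs \<le> card E \<and> (\<forall>e\<in>E. power_sum e xs = \<mu> e)"
  using assms(2,3)
proof (induction E rule: finite_linorder_max_induct)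
  case empty
  then show ?case by (intro exI[of _ "[]"]) auto
next
  case (insert e0 E)
  then obtain xs where xs: "knots xs" "length xs \<le> card E" "\<forall>e\<in>E. power_sum e xs = \<mu> e" by auto
  have e: "\<forall>e\<in>E. 1 \<le> e \<and> e < e0" "1 \<le> e0" using insert by auto
  have mE: "\<forall>e\<in>E. has_moment f e (power_sum e xs)" and m0: "has_moment f e0 (\<mu> e0)"
    using insert.prems xs(3) by auto
  have le: "power_sum e0 xs \<le> \<mu> e0"
    by (rule step_minimizes_next_moment(1)[OF xs(1) f insert.hyps(1) xs(2) e mE m0])
  have card: "card (insert e0 E) = Suc (card E)" using insert.hyps by (metis card_insert_disjoint less_irrefl)
  show ?case
  proof (cases "power_sum e0 xs = \<mu> e0")
    case True
    then show ?thesis using xs card by (intro exI[of _ xs]) auto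
  next
    case False
    have "length xs = card E"
    proof (rule ccontr)
      assume "length xs \<noteq> card E"
      then have lt: "length xs < card E" using xs(2) by simp
      have "negligible {t. 0 < t \<and> f t \<noteq> step xs t}"
        using e by (intro step_determined_by_moments[OF xs(1) f insert.hyps(1) lt _ mE]) auto
      then have "has_moment (step xs) e0 (\<mu> e0)" by (rule has_moment_cong_ae[OF m0])
      moreover have "has_moment (step xs) e0 (power_sum e0 xs)"
        using knots_pos[OF xs(1)] e(2) by (intro has_moment_step) auto
      ultimately show False using False has_moment_unique by blast
    qed
    then obtain ys where "knots ys" "length ys = Suc (length xs)"
      "\<forall>e\<in>E. power_sum e ys = power_sum e xs" "power_sum e0 ys = \<mu> e0"
      using extra_knot_with_prescribed_moment[OF xs(1) insert.hyps(1) e, of "\<mu> e0"] le False by auto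
    then show ?thesis using xs card by (intro exI[of _ ys]) auto
  qed
qed

section \<open>The fundamental theorem of calculus for absolutely continuous functions\<close>

lemma tagged_division_real_cell:
  fixes a b :: real
  assumes "p tagged_division_of {a..b}" "(x, K) \<in> p"
  shows "K = {Inf K..Sup K}" "Inf K \<le> x" "x \<le> Sup K" "a \<le> Inf K" "Sup K \<le> b"
    "measure lborel K = Sup K - Inf K"
proof -
  obtain u v where K: "K = {u..v}" using tagged_division_ofD(4)[OF assms] by (metis interval_cbox)
  have x: "x \<in> K" "K \<subseteq> {a..b}" using tagged_division_ofD(2,3)[OF assms] by auto
  then have uv: "u \<le> v" using K by auto
  then have "Inf K = u" "Sup K = v" using K by auto
  then show "K = {Inf K..Sup K}" "Inf K \<le> x" "x \<le> Sup K" "a \<le> Inf K" "Sup K \<le> b"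
    "measure lborel K = Sup K - Inf K" using x K uv by auto
qed

text \<open>Absolute continuity in terms of tagged divisions: the cells with nonoverlapping interiors inside a set
  of small measure have a small total length.\<close>

lemma abs_cont_small_on_tagged_cells:
  assumes f: "abs_cont_on a b f" and "e > 0"
  obtains \<delta> where "\<delta> > 0" "\<And>p P U. p tagged_division_of {a..b} \<Longrightarrow> P \<subseteq> p \<Longrightarrow> U \<in> sets lebesgue \<Longrightarrow>
      emeasure lebesgue U < ennreal \<delta> \<Longrightarrow> (\<And>x K. (x, K) \<in> P \<Longrightarrow> K \<subseteq> U) \<Longrightarrow>
      (\<Sum>(x, K)\<in>P. \<bar>f (Sup K) - f (Inf K)\<bar>) < e"
proof -
  obtain \<delta> where \<delta>: "\<delta> > 0" "\<forall>(n::nat) u v.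
        (\<forall>i<n. a \<le> u i \<and> u i \<le> v i \<and> v i \<le> b) \<and>
        disjoint_family_on (\<lambda>i. {u i<..<v i}) {..<n} \<and>
        (\<Sum>i<n. v i - u i) < \<delta> \<longrightarrow> (\<Sum>i<n. \<bar>f (v i) - f (u i)\<bar>) < e"
    using f[unfolded abs_cont_on_def, THEN spec, THEN mp, OF assms(2)]
    by (elim exE conjE) (rule that)
  show ?thesis
  proof (rule that[OF \<delta>(1)])
    fix p P U
    assume p: "p tagged_division_of {a..b}" and P: "P \<subseteq> p" and U: "U \<in> sets lebesgue"
      "emeasure lebesgue U < ennreal \<delta>" and PU: "\<And>x K. (x, K) \<in> P \<Longrightarrow> K \<subseteq> U"
    have finP: "finite P" using p P finite_subset by blast
    obtain h where h: "bij_betw h {..<card P} P"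
      using ex_bij_betw_nat_finite[OF finP] by (auto simp: lessThan_atLeast0)
    define u where "u i = Inf (snd (h i))" for i
    define v where "v i = Sup (snd (h i))" for i
    have hP: "h i \<in> P" if "i < card P" for i using h that by (auto simp: bij_betw_def)
    have cell: "snd (h i) = {u i..v i}" "a \<le> u i" "u i \<le> v i" "v i \<le> b" "{u i..v i} \<subseteq> U"
      if "i < card P" for i
    proof -
      have m: "(fst (h i), snd (h i)) \<in> P" using hP[OF that] by simp
      then have mp: "(fst (h i), snd (h i)) \<in> p" using P by blast
      show c: "snd (h i) = {u i..v i}" "a \<le> u i" "u i \<le> v i" "v i \<le> b"
        using tagged_division_real_cell[OF p mp] unfolding u_def v_def by auto
      show "{u i..v i} \<subseteq> U" using PU[OF m] c(1) by simp
    qed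
    have disj: "disjoint_family_on (\<lambda>i. {u i<..<v i}) {..<card P}"
      unfolding disjoint_family_on_def
    proof (intro ballI impI)
      fix i j assume ij: "i \<in> {..<card P}" "j \<in> {..<card P}" "i \<noteq> j"
      then have "h i \<noteq> h j" using h by (auto simp: bij_betw_def inj_on_def)
      then have "interior (snd (h i)) \<inter> interior (snd (h j)) = {}"
        using tagged_division_ofD(5)[OF p, of "fst (h i)" "snd (h i)" "fst (h j)" "snd (h j)"]
          hP[of i] hP[of j] P ij by (auto simp: prod_eq_iff)
      then show "{u i<..<v i} \<inter> {u j<..<v j} = {}" using cell(1) ij by simp
    qed
    have "ennreal (\<Sum>i<card P. v i - u i) = (\<Sum>i<card P. emeasure lebesgue {u i<..<v i})"
      using cell(3) by (subst sum_ennreal[symmetric]) auto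
    also have "\<dots> = emeasure lebesgue (\<Union>i<card P. {u i<..<v i})"
      using disj by (intro sum_emeasure) auto
    also have "\<dots> \<le> emeasure lebesgue U"
      using cell(5) U(1) by (intro emeasure_mono) force+
    finally have "ennreal (\<Sum>i<card P. v i - u i) < ennreal \<delta>"
      using U(2) by (rule le_less_trans)
    moreover have "0 \<le> (\<Sum>i<card P. v i - u i)" using cell(3) by (intro sum_nonneg) auto
    ultimately have "(\<Sum>i<card P. v i - u i) < \<delta>" using ennreal_less_iff by blast
    then have "(\<Sum>i<card P. \<bar>f (v i) - f (u i)\<bar>) < e"
      using cell(2-4) disj by (intro \<delta>(2)[THEN spec, THEN spec, THEN spec, THEN mp] conjI) auto
    also have "(\<Sum>i<card P. \<bar>f (v i) - f (u i)\<bar>) = (\<Sum>(x, K)\<in>P. \<bar>f (Sup K) - f (Inf K)\<bar>)"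
      using sum.reindex_bij_betw[OF h, of "\<lambda>q. \<bar>f (Sup (snd q)) - f (Inf (snd q))\<bar>"]
      unfolding u_def v_def case_prod_unfold .
    finally show "(\<Sum>(x, K)\<in>P. \<bar>f (Sup K) - f (Inf K)\<bar>) < e" .
  qed
qed

text \<open>The fundamental theorem of calculus for absolutely continuous functions. Choose the gauge by the
  derivative outside the null set \<open>N\<close>; at points of \<open>N\<close> keep the cells inside an open set
  of small measure around \<open>N\<close>, where absolute continuity controls the increments.\<close>

lemma ftc_abs_cont_on:
  assumes f: "abs_cont_on a b f" and ab: "a \<le> b" and N: "negligible N"
    and d: "\<And>t. t \<in> {a..b} - N \<Longrightarrow> (f has_vector_derivative f' t) (at t within {a..b})"
  shows "(f' has_integral f b - f a) {a..b}"
proof -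
  define g where "g t = (if t \<in> N then 0 else f' t)" for t
  have "(g has_integral f b - f a) {a..b}"
    unfolding has_integral_real
  proof (intro allI impI)
    fix e :: real assume "e > 0"
    define \<epsilon> where "\<epsilon> = e / (2 * (b - a + 1))"
    have \<epsilon>: "\<epsilon> > 0" "\<epsilon> * (b - a) < e / 2"
      using \<open>e > 0\<close> ab by (auto simp: \<epsilon>_def field_simps)
    have "\<exists>d>0. \<forall>y\<in>{a..b}. \<bar>y - t\<bar> < d \<longrightarrow> \<bar>f y - f t - (y - t) * f' t\<bar> \<le> \<epsilon> * \<bar>y - t\<bar>"
      if "t \<in> {a..b} - N" for t
      using d[OF that] \<epsilon>(1) unfolding has_vector_derivative_def has_derivative_within_alt by auto
    then obtain \<eta> where \<eta>: "\<And>t. t \<in> {a..b} - N \<Longrightarrow> \<eta> t > 0"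
      "\<And>t y. t \<in> {a..b} - N \<Longrightarrow> y \<in> {a..b} \<Longrightarrow> \<bar>y - t\<bar> < \<eta> t \<Longrightarrow>
         \<bar>f y - f t - (y - t) * f' t\<bar> \<le> \<epsilon> * \<bar>y - t\<bar>"
      by metis
    obtain \<delta> where \<delta>: "\<delta> > 0" "\<And>p P U. p tagged_division_of {a..b} \<Longrightarrow> P \<subseteq> p \<Longrightarrow> U \<in> sets lebesgue \<Longrightarrow>
      emeasure lebesgue U < ennreal \<delta> \<Longrightarrow> (\<And>x K. (x, K) \<in> P \<Longrightarrow> K \<subseteq> U) \<Longrightarrow>
      (\<Sum>(x, K)\<in>P. \<bar>f (Sup K) - f (Inf K)\<bar>) < e / 2"
      using abs_cont_small_on_tagged_cells[OF f half_gt_zero[OF \<open>e > 0\<close>]] by blast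
    have N0: "N \<in> null_sets lebesgue" using N by (simp add: negligible_iff_null_sets)
    then obtain U where U: "open U" "N \<subseteq> U" "(U - N) \<in> lmeasurable" "emeasure lebesgue (U - N) < ennreal \<delta>"
      using sets_lebesgue_outer_open[of N \<delta>] \<delta>(1) by auto
    have Um: "U \<in> sets lebesgue" using U(1) by (simp add: borel_open sets_completionI_sets)
    have "emeasure lebesgue (U - N) = emeasure lebesgue U"
      using N0 Um by (rule emeasure_Diff_null_set)
    then have Ud: "emeasure lebesgue U < ennreal \<delta>" using U(4) by simp
    define \<gamma> where "\<gamma> t = (if t \<in> N then U else if t \<in> {a..b} then ball t (\<eta> t) else ball t 1)" for t
    have "gauge \<gamma>" unfolding gauge_def \<gamma>_def using \<eta>(1) U by auto
    moreover have "norm ((\<Sum>(x, K)\<in>p. measure lborel K *\<^sub>R g x) - (f b - f a)) < e"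
      if p: "p tagged_division_of {a..b}" and fine: "\<gamma> fine p" for p
    proof -
      note cell = tagged_division_real_cell[OF p]
      have finp: "finite p" using p by blast
      define P where "P = {(x, K) \<in> p. x \<in> N}"
      have P: "P \<subseteq> p" by (auto simp: P_def)
      have PU: "K \<subseteq> U" if "(x, K) \<in> P" for x K
        using that fine unfolding fine_def P_def \<gamma>_def by fastforce
      have sP: "(\<Sum>(x, K)\<in>P. \<bar>f (Sup K) - f (Inf K)\<bar>) < e / 2"
        by (rule \<delta>(2)[OF p P Um Ud PU])
      have pw: "\<bar>measure lborel K * g x - (f (Sup K) - f (Inf K))\<bar> \<le>
          \<epsilon> * measure lborel K + (if x \<in> N then \<bar>f (Sup K) - f (Inf K)\<bar> else 0)" if xK: "(x, K) \<in> p" for x K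
      proof (cases "x \<in> N")
        case True
        moreover have "0 \<le> \<epsilon> * measure lborel K" using \<epsilon>(1) by simp
        ultimately show ?thesis by (simp add: g_def abs_minus_commute)
      next
        case False
        have x: "x \<in> {a..b} - N" using False cell[OF xK] by auto
        have KB: "K \<subseteq> ball x (\<eta> x)" using fine xK x unfolding fine_def \<gamma>_def by fastforce
        have ends: "Inf K \<in> K" "Sup K \<in> K" using cell(1-3)[OF xK] by (metis atLeastAtMost_iff order.refl order_trans)+
        then have near: "\<bar>Inf K - x\<bar> < \<eta> x" "\<bar>Sup K - x\<bar> < \<eta> x" using KB by (auto simp: dist_real_def)
        have "Inf K \<in> {a..b}" "Sup K \<in> {a..b}" using cell(2-5)[OF xK] by auto
        then have "\<bar>f (Inf K) - f x - (Inf K - x) * f' x\<bar> \<le> \<epsilon> * \<bar>Inf K - x\<bar>"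
            "\<bar>f (Sup K) - f x - (Sup K - x) * f' x\<bar> \<le> \<epsilon> * \<bar>Sup K - x\<bar>"
          using near \<eta>(2)[OF x] by blast+
        moreover have "\<bar>Inf K - x\<bar> = x - Inf K" "\<bar>Sup K - x\<bar> = Sup K - x" using cell[OF xK] by auto
        ultimately have "\<bar>f (Inf K) - f x - (Inf K - x) * f' x\<bar> \<le> \<epsilon> * (x - Inf K)"
            "\<bar>f (Sup K) - f x - (Sup K - x) * f' x\<bar> \<le> \<epsilon> * (Sup K - x)" by simp_all
        moreover have "measure lborel K * g x - (f (Sup K) - f (Inf K))
            = (f (Inf K) - f x - (Inf K - x) * f' x) - (f (Sup K) - f x - (Sup K - x) * f' x)"
          using False unfolding cell(6)[OF xK] by (simp add: g_def algebra_simps)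
        moreover have "\<epsilon> * measure lborel K = \<epsilon> * (x - Inf K) + \<epsilon> * (Sup K - x)"
          unfolding cell(6)[OF xK] by (simp add: algebra_simps)
        ultimately show ?thesis using False by (simp only: if_False add_0_right)
      qed
      have tel: "(\<Sum>(x, K)\<in>p. f (Sup K) - f (Inf K)) = f b - f a"
        by (rule additive_tagged_division_1[OF ab p])
      have cont: "(\<Sum>(x, K)\<in>p. measure lborel K) = b - a"
        using additive_content_tagged_division[of p a b] p ab by simp
      have "norm ((\<Sum>(x, K)\<in>p. measure lborel K *\<^sub>R g x) - (f b - f a))
          = \<bar>\<Sum>(x, K)\<in>p. measure lborel K * g x - (f (Sup K) - f (Inf K))\<bar>"
        unfolding tel[symmetric] sum_subtractf[symmetric] by (simp add: case_prod_unfold)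
      also have "\<dots> \<le> (\<Sum>(x, K)\<in>p. \<bar>measure lborel K * g x - (f (Sup K) - f (Inf K))\<bar>)"
        by (rule order_trans[OF sum_abs]) (simp add: case_prod_unfold)
      also have "\<dots> \<le> (\<Sum>(x, K)\<in>p. \<epsilon> * measure lborel K + (if x \<in> N then \<bar>f (Sup K) - f (Inf K)\<bar> else 0))"
      proof (rule sum_mono)
        fix q assume "q \<in> p"
        then show "(case q of (x, K) \<Rightarrow> \<bar>measure lborel K * g x - (f (Sup K) - f (Inf K))\<bar>)
          \<le> (case q of (x, K) \<Rightarrow> \<epsilon> * measure lborel K + (if x \<in> N then \<bar>f (Sup K) - f (Inf K)\<bar> else 0))"
          using pw[of "fst q" "snd q"] unfolding case_prod_unfold by simp
      qed
      also have "\<dots> = \<epsilon> * (\<Sum>(x, K)\<in>p. measure lborel K) + (\<Sum>(x, K)\<in>p. if x \<in> N then \<bar>f (Sup K) - f (Inf K)\<bar> else 0)"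
        by (simp add: case_prod_unfold sum.distrib sum_distrib_left)
      also have "(\<Sum>(x, K)\<in>p. if x \<in> N then \<bar>f (Sup K) - f (Inf K)\<bar> else 0)
          = (\<Sum>(x, K)\<in>P. \<bar>f (Sup K) - f (Inf K)\<bar>)"
        by (rule sum.mono_neutral_cong_right[OF finp P]) (auto simp: P_def split: if_splits)
      finally show ?thesis using sP \<epsilon>(2) cont by simp
    qed
    ultimately show "\<exists>\<gamma>. gauge \<gamma> \<and> (\<forall>p. p tagged_division_of {a..b} \<and> \<gamma> fine p \<longrightarrow>
        norm ((\<Sum>(x, K)\<in>p. measure lborel K *\<^sub>R g x) - (f b - f a)) < e)"
      by (intro exI[of _ \<gamma>] conjI allI impI) simp_all
  qed
  then show ?thesis by (rule has_integral_spike[OF N, rotated]) (auto simp: g_def)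
qed

lemma abs_cont_on_if_lipschitz:
  assumes "\<And>u v. a \<le> u \<Longrightarrow> u \<le> v \<Longrightarrow> v \<le> b \<Longrightarrow> \<bar>f v - f u\<bar> \<le> C * (v - u)"
  shows "abs_cont_on a b f"
  unfolding abs_cont_on_def
proof (intro allI impI)
  fix e :: real assume "e > 0"
  show "\<exists>\<delta>>0. \<forall>(n::nat) u v. (\<forall>i<n. a \<le> u i \<and> u i \<le> v i \<and> v i \<le> b) \<and>
      disjoint_family_on (\<lambda>i. {u i<..<v i}) {..<n} \<and> (\<Sum>i<n. v i - u i) < \<delta> \<longrightarrow>
      (\<Sum>i<n. \<bar>f (v i) - f (u i)\<bar>) < e"
  proof (intro exI[of _ "e / (\<bar>C\<bar> + 1)"] conjI allI impI)
    show "e / (\<bar>C\<bar> + 1) > 0" using \<open>e > 0\<close> by simp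
    fix n :: nat and u v :: "nat \<Rightarrow> real"
    assume A: "(\<forall>i<n. a \<le> u i \<and> u i \<le> v i \<and> v i \<le> b) \<and>
      disjoint_family_on (\<lambda>i. {u i<..<v i}) {..<n} \<and> (\<Sum>i<n. v i - u i) < e / (\<bar>C\<bar> + 1)"
    have "(\<Sum>i<n. \<bar>f (v i) - f (u i)\<bar>) \<le> (\<Sum>i<n. (\<bar>C\<bar> + 1) * (v i - u i))"
    proof (rule sum_mono)
      fix i assume "i \<in> {..<n}"
      then have i: "a \<le> u i" "u i \<le> v i" "v i \<le> b" using A by auto
      have "\<bar>f (v i) - f (u i)\<bar> \<le> C * (v i - u i)" by (rule assms[OF i])
      also have "\<dots> \<le> (\<bar>C\<bar> + 1) * (v i - u i)" using i by (intro mult_right_mono) auto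
      finally show "\<bar>f (v i) - f (u i)\<bar> \<le> (\<bar>C\<bar> + 1) * (v i - u i)" .
    qed
    also have "\<dots> = (\<bar>C\<bar> + 1) * (\<Sum>i<n. v i - u i)" by (simp add: sum_distrib_left)
    also have "\<dots> < e" using A by (simp add: pos_less_divide_eq mult.commute)
    finally show "(\<Sum>i<n. \<bar>f (v i) - f (u i)\<bar>) < e" .
  qed
qed

section \<open>Functions with nonnegative derivatives on a half-line\<close>

text \<open>A function on the nonpositive half-line together with its nonnegative derivatives \<open>u 0, \<dots>, u r\<close>,
  the last of which exists and is bounded by \<open>L\<close> outside the null set \<open>N\<close>.\<close>

locale derivative_chain =
  fixes r :: nat and L :: real and u :: "nat \<Rightarrow> real \<Rightarrow> real" and N :: "real set"
  assumes r: "1 \<le> r" and L: "0 < L"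
    and nonneg: "\<And>q t. q < r \<Longrightarrow> t \<le> 0 \<Longrightarrow> 0 \<le> u q t"
    and deriv_lower: "\<And>q t. Suc q < r \<Longrightarrow> t \<le> 0 \<Longrightarrow>
      (u q has_vector_derivative u (Suc q) t) (at t within {..0})"
    and abs_cont: "locally_abs_cont (u (r - 1))"
    and N: "negligible N"
    and deriv_top: "\<And>t. t \<le> 0 \<Longrightarrow> t \<notin> N \<Longrightarrow>
      (u (r - 1) has_vector_derivative u r t) (at t within {..0})"
    and top_bounds: "\<And>t. t \<le> 0 \<Longrightarrow> t \<notin> N \<Longrightarrow> 0 \<le> u r t \<and> u r t \<le> L"
begin

lemma deriv_ae:
  assumes "q < r" "t \<le> 0" "t \<notin> N"
  shows "(u q has_vector_derivative u (Suc q) t) (at t within {..0})"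
proof (cases "Suc q = r")
  case True
  then show ?thesis using deriv_top assms by force
qed (use assms deriv_lower in auto)

lemma ftc:
  assumes "q < r" "a \<le> b" "b \<le> 0"
  shows "(u (Suc q) has_integral u q b - u q a) {a..b}"
proof (cases "Suc q = r")
  case True
  then have q: "q = r - 1" by simp
  show ?thesis
  proof (rule ftc_abs_cont_on[OF _ assms(2) N])
    show "abs_cont_on a b (u q)" using abs_cont assms unfolding locally_abs_cont_def q by blast
    fix t assume "t \<in> {a..b} - N"
    then show "(u q has_vector_derivative u (Suc q) t) (at t within {a..b})"
      using assms by (intro has_vector_derivative_within_subset[OF deriv_ae]) auto
  qed
next
  case False
  then show ?thesis using assms
    by (intro fundamental_theorem_of_calculus has_vector_derivative_within_subset[OF deriv_lower]) auto
qed

lemma nonneg_ae: "q \<le> r \<Longrightarrow> t \<le> 0 \<Longrightarrow> t \<notin> N \<Longrightarrow> 0 \<le> u q t"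
  using nonneg top_bounds by (cases "q = r") auto

lemma mono:
  assumes "q < r" "a \<le> b" "b \<le> 0"
  shows "u q a \<le> u q b"
proof -
  have "((\<lambda>t. if t \<in> N then 0 else u (Suc q) t) has_integral u q b - u q a) {a..b}"
    by (rule has_integral_spike[OF N _ ftc[OF assms]]) auto
  then have "0 \<le> u q b - u q a"
    by (rule has_integral_nonneg) (use nonneg_ae[of "Suc q"] assms in auto)
  then show ?thesis by simp
qed

lemma lipschitz:
  assumes "q < r"
  obtains C where "\<And>a b. a \<le> b \<Longrightarrow> b \<le> 0 \<Longrightarrow> \<bar>u q b - u q a\<bar> \<le> C * (b - a)"
proof -
  define C where "C = (if Suc q = r then L else u (Suc q) 0)"
  have C: "0 \<le> C" using L nonneg[of "Suc q" 0] assms by (auto simp: C_def)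
  have bnd: "u (Suc q) t \<le> C" if "t \<le> 0" "t \<notin> N" for t
    using top_bounds[OF that] mono[of "Suc q" t 0] that assms by (auto simp: C_def)
  have "\<bar>u q b - u q a\<bar> \<le> C * (b - a)" if ab: "a \<le> b" "b \<le> 0" for a b
  proof -
    have "((\<lambda>t. if t \<in> N then 0 else u (Suc q) t) has_integral u q b - u q a) (cbox a b)"
      unfolding interval_cbox[symmetric] by (rule has_integral_spike[OF N _ ftc[OF assms ab]]) auto
    from has_integral_bound[OF C this] have "norm (u q b - u q a) \<le> C * measure lborel (cbox a b)"
      using bnd nonneg_ae[of "Suc q"] C ab assms by auto
    then show ?thesis using ab by simp
  qed
  then show ?thesis by (rule that)
qed

text \<open>The derivative of \<open>(-s)\<^sup>j\<^sup>+\<^sup>1 / (j+1)! u q s\<close>, integrated. The product is Lipschitz continuous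
  since \<open>u q\<close> is, hence absolutely continuous, so that also the top derivative is covered.\<close>

lemma by_parts:
  assumes q: "q < r" and T: "0 \<le> T"
  shows "((\<lambda>s. (-s) ^ Suc j / fact (Suc j) * u (Suc q) s - (-s) ^ j / fact j * u q s)
     has_integral - (T ^ Suc j / fact (Suc j) * u q (-T))) {-T..0}"
proof -
  define W where "W s = (-s) ^ Suc j / fact (Suc j) * u q s" for s :: real
  obtain C where C: "\<And>a b. a \<le> b \<Longrightarrow> b \<le> 0 \<Longrightarrow> \<bar>u q b - u q a\<bar> \<le> C * (b - a)"
    using lipschitz[OF q] by blast
  define g where "g s = (-s) ^ Suc j / fact (Suc j)" for s :: real
  have g': "(g has_real_derivative - ((-s) ^ j / fact j)) (at s within X)" for s X
  proof -
    have "((\<lambda>s. (-s) ^ Suc j) has_real_derivative - (real (Suc j) * (-s) ^ j)) (at s within X)"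
      by (rule derivative_eq_intros refl | simp)+
    from DERIV_cdivide[OF this, of "fact (Suc j)"] show ?thesis
      unfolding g_def by (simp add: fact_Suc del: of_nat_Suc power_Suc)
  qed
  have gT: "\<bar>g s\<bar> \<le> T ^ Suc j / fact (Suc j)" "\<bar>(-s) ^ j / fact j\<bar> \<le> T ^ j / fact j"
    if "s \<in> {-T..0}" for s
    using that unfolding g_def abs_divide power_abs
    by (auto intro!: divide_right_mono power_mono simp del: power_Suc)
  have glip: "\<bar>g b - g a\<bar> \<le> T ^ j / fact j * (b - a)" if ab: "-T \<le> a" "a \<le> b" "b \<le> 0" for a b
  proof -
    have "((\<lambda>s. - ((-s) ^ j / fact j)) has_integral g b - g a) (cbox a b)"
      unfolding interval_cbox[symmetric] using ab g'
      by (intro fundamental_theorem_of_calculus) (auto simp: has_real_derivative_iff_has_vector_derivative[symmetric])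
    from has_integral_bound[OF _ this, of "T ^ j / fact j"]
    have "norm (g b - g a) \<le> T ^ j / fact j * measure lborel (cbox a b)"
      using gT(2) ab T by auto
    then show ?thesis using ab by simp
  qed
  have uT: "\<bar>u q s\<bar> \<le> u q 0" if "s \<in> {-T..0}" for s using nonneg[OF q] mono[OF q] that by auto
  have W: "W = (\<lambda>s. g s * u q s)" by (simp add: W_def g_def fun_eq_iff)
  have "abs_cont_on (-T) 0 W"
  proof (rule abs_cont_on_if_lipschitz)
    fix a b assume ab: "-T \<le> a" "a \<le> b" "b \<le> 0"
    have "W b - W a = g b * (u q b - u q a) + (g b - g a) * u q a" by (simp add: W algebra_simps)
    also have "\<bar>\<dots>\<bar> \<le> \<bar>g b\<bar> * \<bar>u q b - u q a\<bar> + \<bar>g b - g a\<bar> * \<bar>u q a\<bar>"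
      by (rule order_trans[OF abs_triangle_ineq]) (simp add: abs_mult)
    also have "\<dots> \<le> T ^ Suc j / fact (Suc j) * (C * (b - a)) + (T ^ j / fact j * (b - a)) * u q 0"
      using ab gT(1)[of b] uT[of a] T by (intro add_mono mult_mono glip C) auto
    finally show "\<bar>W b - W a\<bar> \<le> (T ^ Suc j / fact (Suc j) * C + T ^ j / fact j * u q 0) * (b - a)"
      by (simp add: algebra_simps)
  qed
  then have "((\<lambda>s. g s * u (Suc q) s - (-s) ^ j / fact j * u q s) has_integral W 0 - W (-T)) {-T..0}"
  proof (rule ftc_abs_cont_on[OF _ _ N])
    fix t assume t: "t \<in> {-T..0} - N"
    have "(u q has_real_derivative u (Suc q) t) (at t within {-T..0})"
      unfolding has_real_derivative_iff_has_vector_derivative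
      using t q by (intro has_vector_derivative_within_subset[OF deriv_ae]) auto
    from DERIV_mult[OF g'[of t "{-T..0}"] this]
    show "(W has_vector_derivative g t * u (Suc q) t - (-t) ^ j / fact j * u q t) (at t within {-T..0})"
      unfolding has_real_derivative_iff_has_vector_derivative[symmetric] W
      by (simp add: algebra_simps)
  qed (use T in simp)
  then show ?thesis by (simp add: W_def g_def del: power_Suc fact_Suc)
qed

text \<open>Taylor's formula with integral remainder for the expansion about \<open>-T\<close>, evaluated at \<open>0\<close>.\<close>

lemma taylor:
  assumes "q + j < r" and T: "0 \<le> T"
  shows "((\<lambda>s. (-s) ^ j / fact j * u (Suc (q + j)) s) has_integral
     (u q 0 - (\<Sum>i\<le>j. T ^ i / fact i * u (q + i) (-T)))) {-T..0}"
  using assms(1)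
proof (induction j)
  case 0
  then show ?case using ftc[of q "-T" 0] T by simp
next
  case (Suc j)
  from has_integral_add[OF by_parts[of "q + Suc j" T j] Suc.IH] Suc.prems T
  show ?case by (simp add: algebra_simps del: power_Suc fact_Suc)
qed

lemma limit_at_minus_infinity:
  assumes "q < r"
  obtains c where "0 \<le> c" "((\<lambda>T. u q (-T)) \<longlongrightarrow> c) at_top"
proof -
  define c where "c = Inf ((\<lambda>T. u q (-T)) ` {0..})"
  have bdd: "bdd_below ((\<lambda>T. u q (-T)) ` {0..})" using nonneg[OF assms] by (intro bdd_belowI[of _ 0]) auto
  have "((\<lambda>T. u q (-T)) \<longlongrightarrow> c) at_top"
  proof (rule order_tendstoI)
    fix a assume "a < c"
    then have "a < u q (-T)" if "T \<ge> 0" for T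
      using cInf_lower[OF _ bdd, of "u q (-T)"] that unfolding c_def by fastforce
    then show "\<forall>\<^sub>F T in at_top. a < u q (-T)" using eventually_at_top_linorder by blast
  next
    fix a assume "c < a"
    then obtain S where S: "S \<ge> 0" "u q (-S) < a"
      unfolding c_def using cInf_less_iff[OF _ bdd, of a] by auto
    have "u q (-T) < a" if "T \<ge> S" for T using mono[OF assms, of "-T" "-S"] S that by simp
    then show "\<forall>\<^sub>F T in at_top. u q (-T) < a" using eventually_at_top_linorder by blast
  qed
  moreover have "0 \<le> c" unfolding c_def using nonneg[OF assms] by (intro cInf_greatest) auto
  ultimately show ?thesis using that by blast
qed

text \<open>The remainder \<open>J T\<close> in Taylor's formula of lower degree converges, so its increment over
  \<open>{-T..-T/2}\<close> tends to \<open>0\<close>. By monotonicity this increment is at least a constant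
  multiple of \<open>T ^ i * u (q + i) (-T)\<close>.\<close>

lemma decay: "1 \<le> i \<Longrightarrow> q + i < r \<Longrightarrow> ((\<lambda>T. T ^ i * u (q + i) (-T)) \<longlongrightarrow> 0) at_top"
proof (induction i rule: less_induct)
  case (less i)
  then obtain j where j: "i = Suc j" by (cases i) auto
  define J where "J T = u q 0 - (\<Sum>k\<le>j. T ^ k / fact k * u (q + k) (-T))" for T
  obtain c where c: "((\<lambda>T. u q (-T)) \<longlongrightarrow> c) at_top" using limit_at_minus_infinity[of q] less by auto
  have "((\<lambda>T. T ^ k / fact k * u (q + k) (-T)) \<longlongrightarrow> (if k = 0 then c else 0)) at_top" if "k \<le> j" for k
  proof (cases "k = 0")
    case False
    then have "((\<lambda>T. T ^ k * u (q + k) (-T)) \<longlongrightarrow> 0) at_top" using less that j by auto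
    from tendsto_divide[OF this tendsto_const, of "fact k"] False show ?thesis by simp
  qed (use c in simp)
  then have "(J \<longlongrightarrow> u q 0 - (\<Sum>k\<le>j. if k = 0 then c else 0)) at_top"
    unfolding J_def by (intro tendsto_intros) auto
  then obtain l where Jl: "(J \<longlongrightarrow> l) at_top" by blast
  have half: "filterlim (\<lambda>T::real. T / 2) at_top at_top"
    by (rule filterlim_tendsto_pos_mult_at_top[of "\<lambda>_. 1/2" "1/2", simplified, OF filterlim_ident])
  have JJ: "((\<lambda>T. 2 ^ i * fact j * (J T - J (T / 2))) \<longlongrightarrow> 2 ^ i * fact j * (l - l)) at_top"
    by (intro tendsto_intros Jl filterlim_compose[OF Jl half])
  have le: "T ^ i * u (q + i) (-T) \<le> 2 ^ i * fact j * (J T - J (T / 2))" if T: "0 \<le> T" for T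
  proof -
    define S where "S = T / 2"
    have S: "0 \<le> S" "S \<le> T" "T = 2 * S" using T by (auto simp: S_def)
    let ?h = "\<lambda>s. (-s) ^ j / fact j * u (Suc (q + j)) s"
    have qj: "q + j < r" using less.prems j by simp
    have JT: "(?h has_integral J T) {-T..0}" "(?h has_integral J S) {-S..0}"
      unfolding J_def by (rule taylor[OF qj T], rule taylor[OF qj S(1)])
    have "integral {-T..-S} ?h + integral {-S..0} ?h = integral {-T..0} ?h"
      using JT(1) S by (intro Henstock_Kurzweil_Integration.integral_combine) auto
    then have I: "integral {-T..-S} ?h = J T - J S" 
      using integral_unique[OF JT(1)] integral_unique[OF JT(2)] by linarith
    have hint: "?h integrable_on {-T..-S}"
      by (rule integrable_on_subinterval[OF has_integral_integrable[OF JT(1)]]) (use S in auto)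
    have qi: "q + i < r" "Suc (q + j) = q + i" using less.prems j by auto
    have "((\<lambda>_. S ^ j / fact j * u (q + i) (-T)) has_integral (S ^ j / fact j * u (q + i) (-T)) * S) {-T..-S}"
      using has_integral_const_real[of "S ^ j / fact j * u (q + i) (-T)" "-T" "-S"] S by (simp add: mult.commute)
    then have "S ^ j / fact j * u (q + i) (-T) * S \<le> J T - J S"
      unfolding I[symmetric]
    proof (rule has_integral_le[OF _ integrable_integral[OF hint]])
      fix s assume s: "s \<in> {-T..-S}"
      have "u (q + i) (-T) \<le> u (q + i) s" using s S by (intro mono qi) auto
      moreover have "S ^ j \<le> (-s) ^ j" using s S by (intro power_mono) auto
      ultimately show "S ^ j / fact j * u (q + i) (-T) \<le> ?h s"
        using S s nonneg[OF qi(1), of "-T"] unfolding qi(2)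
        by (intro mult_mono divide_right_mono) auto
    qed
    then have "2 ^ i * fact j * (S ^ j / fact j * u (q + i) (-T) * S) \<le> 2 ^ i * fact j * (J T - J S)"
      by (intro mult_left_mono) auto
    moreover have "2 ^ i * fact j * (S ^ j / fact j * u (q + i) (-T) * S) = T ^ i * u (q + i) (-T)"
      unfolding S(3) j by (simp add: power_mult_distrib)
    ultimately have "T ^ i * u (q + i) (-T) \<le> 2 ^ i * fact j * (J T - J S)" by linarith
    then show ?thesis unfolding S_def .
  qed
  show ?case
  proof (rule tendsto_sandwich[OF _ _ tendsto_const])
    show "\<forall>\<^sub>F T in at_top. T ^ i * u (q + i) (-T) \<le> 2 ^ i * fact j * (J T - J (T / 2))"
      using eventually_ge_at_top[of 0] by eventually_elim (rule le)
    show "\<forall>\<^sub>F T in at_top. 0 \<le> T ^ i * u (q + i) (-T)"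
      using eventually_ge_at_top[of 0] by eventually_elim (use nonneg less.prems in auto)
    show "((\<lambda>T. 2 ^ i * fact j * (J T - J (T / 2))) \<longlongrightarrow> 0) at_top" using JJ by simp
  qed
qed

text \<open>All boundary terms at \<open>-T\<close> in Taylor's formula vanish in the limit, except for the limit of
  \<open>u 0\<close> itself. So the values at \<open>0\<close> of the derivatives are moments of the top derivative;
  only the function itself may carry an additive constant.\<close>

lemma moments:
  assumes c: "((\<lambda>T. u 0 (-T)) \<longlongrightarrow> c) at_top" and e: "1 \<le> e" "e \<le> r"
  shows "has_moment (\<lambda>t. u r (-t) / L) e (fact e / L * (u (r - e) 0 - (if e = r then c else 0)))"
proof -
  define q where "q = r - e"
  define j where "j = e - 1"
  have qj: "q + j < r" "Suc (q + j) = r" "e = Suc j" using e by (auto simp: q_def j_def)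
  define J where "J T = u q 0 - (\<Sum>k\<le>j. T ^ k / fact k * u (q + k) (-T))" for T
  define c' where "c' = (if e = r then c else 0)"
  have c0: "((\<lambda>T. u q (-T)) \<longlongrightarrow> c') at_top"
  proof (cases "e = r")
    case True
    then show ?thesis using c by (simp add: q_def c'_def)
  next
    case False
    then obtain p where p: "q = Suc p" using e by (cases q) (auto simp: q_def)
    \<comment> \<open>A derivative of positive order tends to \<open>0\<close>, even after multiplication by \<open>T\<close>.\<close>
    have "((\<lambda>T. T ^ 1 * u (p + 1) (-T)) \<longlongrightarrow> 0) at_top"
      by (rule decay) (use p qj in auto)
    then have d: "((\<lambda>T. T * u q (-T)) \<longlongrightarrow> 0) at_top" using p by simp
    have "((\<lambda>T. u q (-T)) \<longlongrightarrow> 0) at_top"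
    proof (rule tendsto_sandwich[OF _ _ tendsto_const d])
      show "\<forall>\<^sub>F T in at_top. 0 \<le> u q (-T)"
        using eventually_ge_at_top[of 0] by eventually_elim (use nonneg[of q] qj in auto)
      show "\<forall>\<^sub>F T in at_top. u q (-T) \<le> T * u q (-T)"
        using eventually_ge_at_top[of 1]
      proof eventually_elim
        case (elim T)
        then show ?case using mult_right_mono[of 1 T "u q (-T)"] nonneg[of q "-T"] qj by simp
      qed
    qed
    then show ?thesis using False by (simp add: c'_def)
  qed
  have "((\<lambda>T. T ^ k / fact k * u (q + k) (-T)) \<longlongrightarrow> (if k = 0 then c' else 0)) at_top" if "k \<le> j" for k
  proof (cases "k = 0")
    case False
    then have "((\<lambda>T. T ^ k * u (q + k) (-T)) \<longlongrightarrow> 0) at_top" using that qj by (intro decay) auto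
    from tendsto_divide[OF this tendsto_const, of "fact k"] False show ?thesis by simp
  qed (use c0 in simp)
  then have "(J \<longlongrightarrow> u q 0 - (\<Sum>k\<le>j. if k = 0 then c' else 0)) at_top"
    unfolding J_def by (intro tendsto_intros) auto
  then have Jl: "(J \<longlongrightarrow> u q 0 - c') at_top" by simp
  have hi: "((\<lambda>t. real e * t ^ (e - 1) * (u r (-t) / L)) has_integral fact e / L * J T) {0..T}" if "0 \<le> T" for T
  proof -
    have "((\<lambda>s. (-s) ^ j / fact j * u r s) has_integral J T) {-T..0}"
      using taylor[OF qj(1) that] unfolding qj(2) J_def .
    then have "((\<lambda>t. t ^ j / fact j * u r (-t)) has_integral J T) {0..T}"
      using has_integral_reflect_real[of "\<lambda>s. (-s) ^ j / fact j * u r s" "J T" 0 "-T"] by simp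
    from has_integral_mult_right[OF this, of "fact e / L"]
    show ?thesis by (simp add: qj(3) mult_ac)
  qed
  have "((\<lambda>T. fact e / L * J T) \<longlongrightarrow> fact e / L * (u q 0 - c')) at_top"
    by (intro tendsto_intros Jl)
  then have "((\<lambda>T. integral {0..T} (\<lambda>t. real e * t ^ (e - 1) * (u r (-t) / L))) \<longlongrightarrow> fact e / L * (u q 0 - c')) at_top"
  proof (rule Lim_transform_eventually)
    show "\<forall>\<^sub>F T in at_top. fact e / L * J T = integral {0..T} (\<lambda>t. real e * t ^ (e - 1) * (u r (-t) / L))"
      using eventually_ge_at_top[of 0] by eventually_elim (rule integral_unique[OF hi, symmetric])
  qed
  then show ?thesis using hi unfolding has_moment_def q_def c'_def by blast
qed

lemma density_ae_unit: "negligible {t. 0 < t \<and> \<not> (0 \<le> u r (-t) / L \<and> u r (-t) / L \<le> 1)}"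
proof (rule negligible_subset)
  show "negligible (uminus ` N)" 
    by (intro negligible_differentiable_image_negligible N) (auto intro!: derivative_intros)
  show "{t. 0 < t \<and> \<not> (0 \<le> u r (-t) / L \<and> u r (-t) / L \<le> 1)} \<subseteq> uminus ` N"
  proof
    fix t assume t: "t \<in> {t. 0 < t \<and> \<not> (0 \<le> u r (-t) / L \<and> u r (-t) / L \<le> 1)}"
    have "-t \<in> N"
    proof (rule ccontr)
      assume "-t \<notin> N"
      then have "0 \<le> u r (-t)" "u r (-t) \<le> L" using top_bounds[of "-t"] t by auto
      then show False using t L by simp
    qed
    then show "t \<in> uminus ` N" by force
  qed
qed

end

section \<open>Norms and derivatives of splines\<close>

lemma AE_half_line_iff: "(AE t in lebesgue_on {..0}. P t) \<longleftrightarrow> negligible {t::real. t \<le> 0 \<and> \<not> P t}"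
proof -
  have "(AE t in lebesgue_on {..0}. P t) \<longleftrightarrow> (AE t::real in lebesgue. t \<in> {..0} \<longrightarrow> P t)"
    by (rule AE_restrict_space_iff) simp
  also have "\<dots> \<longleftrightarrow> negligible {t. t \<le> 0 \<and> \<not> P t}"
  proof
    assume "AE t in lebesgue. t \<in> {..0} \<longrightarrow> P t"
    then obtain Z where "Z \<in> null_sets lebesgue" "{t. t \<le> 0 \<and> \<not> P t} \<subseteq> Z"
      by (auto simp: eventually_ae_filter)
    then show "negligible {t. t \<le> 0 \<and> \<not> P t}"
      using negligible_iff_null_sets negligible_subset by blast
  next
    assume "negligible {t. t \<le> 0 \<and> \<not> P t}"
    then have Z: "{t. t \<le> 0 \<and> \<not> P t} \<in> null_sets lebesgue" by (simp add: negligible_iff_null_sets)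
    show "AE t in lebesgue. t \<in> {..0} \<longrightarrow> P t" by (rule AE_I'[OF Z]) auto
  qed
  finally show ?thesis .
qed

text \<open>The norm is an essential supremum, so the value \<open>c\<close> has to be approached on sets of positive
  measure; intervals are enough here.\<close>

lemma linf_norm_eqI:
  assumes meas: "f \<in> borel_measurable (lebesgue_on {..0})"
    and N: "negligible N" and le: "\<And>t. t \<le> 0 \<Longrightarrow> t \<notin> N \<Longrightarrow> \<bar>f t\<bar> \<le> c"
    and ge: "\<And>z. z < c \<Longrightarrow> \<exists>a b. a < b \<and> b \<le> 0 \<and> (\<forall>t\<in>{a<..<b}. z \<le> \<bar>f t\<bar>)"
  shows "linf_norm f = ereal c"
proof (rule antisym)
  have m: "(\<lambda>t. ereal \<bar>f t\<bar>) \<in> borel_measurable (lebesgue_on {..0})" using meas by measurable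
  have "negligible {t. t \<le> 0 \<and> \<not> ereal \<bar>f t\<bar> \<le> ereal c}"
    by (rule negligible_subset[OF N]) (use le in auto)
  then show "linf_norm f \<le> ereal c"
    unfolding linf_norm_def by (intro esssup_I m) (simp add: AE_half_line_iff)
  show "ereal c \<le> linf_norm f"
  proof (rule dense_le)
    fix x assume x: "x < ereal c"
    show "x \<le> linf_norm f"
    proof (cases x)
      case (real z)
      then obtain a b where ab: "a < b" "b \<le> 0" "\<forall>t\<in>{a<..<b}. z \<le> \<bar>f t\<bar>" using ge[of z] x by auto
      have "AE t in lebesgue_on {..0}. ereal \<bar>f t\<bar> \<le> linf_norm f"
        unfolding linf_norm_def by (rule esssup_AE)
      then have "negligible {t. t \<le> 0 \<and> \<not> ereal \<bar>f t\<bar> \<le> linf_norm f}" by (simp add: AE_half_line_iff)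
      moreover have "\<not> negligible {a<..<b}" using negligible_interval(2)[of a b] ab(1) by simp
      ultimately have "\<not> {a<..<b} \<subseteq> {t. t \<le> 0 \<and> \<not> ereal \<bar>f t\<bar> \<le> linf_norm f}"
        using negligible_subset by blast
      then obtain t where t: "t \<in> {a<..<b}" "\<not> (t \<le> 0 \<and> \<not> ereal \<bar>f t\<bar> \<le> linf_norm f)" by blast
      then have "ereal \<bar>f t\<bar> \<le> linf_norm f" using ab(2) by simp
      with t(1) show ?thesis using ab(3) real by (metis ereal_less_eq(3) order_trans)
    qed (use x in auto)
  qed
qed

lemma at_within_half_line_neq_bot: "t \<le> 0 \<Longrightarrow> at (t::real) within {..0} \<noteq> bot"
proof
  assume "t \<le> 0" "at t within {..0} = bot"
  moreover have "at_left t \<le> at t within {..0}" using \<open>t \<le> 0\<close> by (intro at_le) auto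
  ultimately have "at_left t = bot" by (simp add: bot_unique)
  then show False using trivial_limit_at_left_real[of t] by (simp add: trivial_limit_def)
qed

lemma nth_deriv_0 [simp]: "nth_deriv 0 x = x"
  by (simp add: nth_deriv_def)

lemma nth_deriv_Suc: "nth_deriv (Suc n) x t = vector_derivative (nth_deriv n x) (at t within {..0})"
  by (simp add: nth_deriv_def)

context derivative_chain
begin

lemma measurable_lower:
  assumes "q < r"
  shows "u q \<in> borel_measurable (lebesgue_on {..0})"
proof -
  obtain C where C: "\<And>a b. a \<le> b \<Longrightarrow> b \<le> 0 \<Longrightarrow> \<bar>u q b - u q a\<bar> \<le> C * (b - a)"
    using lipschitz[OF assms] by blast
  have "(\<bar>C\<bar>)-lipschitz_on {..0} (u q)"
  proof (rule lipschitz_onI)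
    fix s t :: real assume st: "s \<in> {..0}" "t \<in> {..0}"
    have le: "C * z \<le> \<bar>C\<bar> * z" if "0 \<le> z" for z using that by (intro mult_right_mono) auto
    show "dist (u q s) (u q t) \<le> \<bar>C\<bar> * dist s t"
    proof (cases "s \<le> t")
      case True
      then have "\<bar>u q t - u q s\<bar> \<le> \<bar>C\<bar> * (t - s)" using order_trans[OF C le, of s t] st by simp
      then show ?thesis using True by (simp add: dist_real_def abs_minus_commute)
    next
      case False
      then have "\<bar>u q s - u q t\<bar> \<le> \<bar>C\<bar> * (s - t)" using order_trans[OF C le, of t s] st by simp
      then show ?thesis using False by (simp add: dist_real_def)
    qed
  qed simp
  then show ?thesis
    by (intro continuous_imp_measurable_on_sets_lebesgue lipschitz_on_continuous_on) auto
qed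

text \<open>The function \<open>u q\<close> is nonnegative and increasing, hence its norm is its value at the right end.\<close>

lemma linf_norm_lower:
  assumes q: "q < r"
  shows "linf_norm (u q) = ereal (u q 0)"
proof (rule linf_norm_eqI[OF measurable_lower[OF q] negligible_empty])
  show "\<bar>u q t\<bar> \<le> u q 0" if "t \<le> 0" for t using nonneg[OF q that] mono[OF q that] by simp
  fix z assume z: "z < u q 0"
  obtain C where C: "\<And>a b. a \<le> b \<Longrightarrow> b \<le> 0 \<Longrightarrow> \<bar>u q b - u q a\<bar> \<le> C * (b - a)"
    using lipschitz[OF q] by blast
  define a where "a = - ((u q 0 - z) / (\<bar>C\<bar> + 1))"
  have a: "a < 0" using z by (simp add: a_def)
  have "z \<le> \<bar>u q t\<bar>" if "t \<in> {a<..<0}" for t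
  proof -
    have "u q 0 - u q t \<le> C * (0 - t)" using C[of t 0] that by simp
    also have "\<dots> \<le> (\<bar>C\<bar> + 1) * (0 - a)" using that by (intro mult_mono) auto
    also have "\<dots> = u q 0 - z" by (simp add: a_def)
    finally show ?thesis by simp
  qed
  then show "\<exists>a b. a < b \<and> b \<le> 0 \<and> (\<forall>t\<in>{a<..<b}. z \<le> \<bar>u q t\<bar>)" using a by blast
qed

end

lemma Lrr_class_chain:
  assumes x: "x \<in> Lrr_class r" and r: "1 \<le> r" and L: "0 < L"
    and norm: "linf_norm (nth_deriv r x) = ereal L"
  obtains N where "derivative_chain r L (\<lambda>q. nth_deriv q x) N"
proof -
  let ?P = "\<lambda>t. nth_deriv (r - 1) x differentiable (at t within {..0})"
  let ?Q = "\<lambda>t. ereal \<bar>nth_deriv r x t\<bar> \<le> ereal L"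
  let ?R = "\<lambda>t. nth_deriv r x t \<ge> 0"
  define N where "N = {t. t \<le> 0 \<and> \<not> ?P t} \<union> {t. t \<le> 0 \<and> \<not> ?Q t} \<union> {t. t \<le> 0 \<and> \<not> ?R t}"
  have lr: "x \<in> Lr_space r" using x by (simp add: Lrr_class_def)
  have "AE t in lebesgue_on {..0}. ?P t" using lr by (simp add: Lr_space_def)
  moreover have "AE t in lebesgue_on {..0}. ?Q t"
    unfolding norm[symmetric] linf_norm_def by (rule esssup_AE)
  moreover have "AE t in lebesgue_on {..0}. ?R t" using x by (simp add: Lrr_class_def)
  ultimately have N: "negligible N" unfolding AE_half_line_iff N_def by (intro negligible_Un)
  have "derivative_chain r L (\<lambda>q. nth_deriv q x) N"
  proof
    show "1 \<le> r" "0 < L" "negligible N" by fact+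
    show "locally_abs_cont (nth_deriv (r - 1) x)" using lr by (simp add: Lr_space_def)
    show "0 \<le> nth_deriv q x t" if "q < r" "t \<le> 0" for q t using x that by (simp add: Lrr_class_def)
    show "(nth_deriv q x has_vector_derivative nth_deriv (Suc q) x t) (at t within {..0})"
      if "Suc q < r" "t \<le> 0" for q t
    proof -
      have "nth_deriv q x differentiable (at t within {..0})"
        using lr that by (simp add: Lr_space_def less_diff_conv)
      then show ?thesis unfolding nth_deriv_Suc vector_derivative_works .
    qed
    fix t assume t: "t \<le> (0::real)" "t \<notin> N"
    then have "?P t" "?Q t" "?R t" by (auto simp: N_def)
    then show "0 \<le> nth_deriv r x t \<and> nth_deriv r x t \<le> L" by simp
    have "nth_deriv r x t = vector_derivative (nth_deriv (r - 1) x) (at t within {..0})"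
      using nth_deriv_Suc[of "r - 1" x t] r by simp
    then show "(nth_deriv (r - 1) x has_vector_derivative nth_deriv r x t) (at t within {..0})"
      using \<open>?P t\<close> by (simp add: vector_derivative_works)
  qed
  then show ?thesis by (rule that)
qed

text \<open>The spline \<open>\<phi>\<close> of the statement, with knots given as a list and an additive constant \<open>C\<close>
  for the systems of Type 3.\<close>

definition knot_spline :: "nat \<Rightarrow> real \<Rightarrow> real list \<Rightarrow> real \<Rightarrow> real \<Rightarrow> real" where
  "knot_spline r l xs C t = l / fact r * alt_sum (\<lambda>x. max 0 (t + x) ^ r) xs + C"

text \<open>The classical formula for the derivative of order \<open>q\<close>. For \<open>q = r\<close> it holds away from the
  knots only.\<close>

definition spline_deriv :: "nat \<Rightarrow> real \<Rightarrow> real list \<Rightarrow> real \<Rightarrow> nat \<Rightarrow> real \<Rightarrow> real" where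
  "spline_deriv r l xs C q t =
     (if q < r then l / fact (r - q) * alt_sum (\<lambda>x. max 0 (t + x) ^ (r - q)) xs + (if q = 0 then C else 0)
      else l * step xs (-t))"

lemma has_real_derivative_alt_sum:
  assumes "\<And>x. x \<in> set xs \<Longrightarrow> (f x has_real_derivative f' x) F"
  shows "((\<lambda>t. alt_sum (\<lambda>x. f x t) xs) has_real_derivative alt_sum f' xs) F"
  using assms by (induction xs) (auto intro!: derivative_eq_intros)

text \<open>At the knot itself the difference quotient is \<open>max 0 (z + x) ^ m\<close>, which is continuous and vanishes
  there.\<close>

lemma truncated_power_deriv:
  assumes "1 \<le> m"
  shows "((\<lambda>t::real. max 0 (t + x) ^ Suc m) has_real_derivative real (Suc m) * max 0 (t + x) ^ m) (at t)"
proof -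
  consider "t + x > 0" | "t + x < 0" | "t + x = 0" by linarith
  then show ?thesis
  proof cases
    case 1
    have "((\<lambda>t. (t + x) ^ Suc m) has_real_derivative real (Suc m) * (t + x) ^ m) (at t)"
      by (rule derivative_eq_intros refl | simp)+
    then have "((\<lambda>t. max 0 (t + x) ^ Suc m) has_real_derivative real (Suc m) * (t + x) ^ m) (at t)"
      by (rule has_field_derivative_transform_within_open[of _ _ _ "{-x<..}"]) (use 1 in auto)
    then show ?thesis using 1 by simp
  next
    case 2
    have "((\<lambda>t. 0) has_real_derivative 0) (at t)" by simp
    then have "((\<lambda>t. max 0 (t + x) ^ Suc m) has_real_derivative 0) (at t)"
      by (rule has_field_derivative_transform_within_open[of _ _ _ "{..<-x}"]) (use 2 in auto)
    moreover have "real (Suc m) * max 0 (t + x) ^ m = 0" using 2 assms by (simp add: max_def)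
    ultimately show ?thesis by (simp only:)
  next
    case 3
    have "max 0 (z + x) ^ Suc m - max 0 (t + x) ^ Suc m = max 0 (z + x) ^ m * (z - t)" for z
      using 3 assms by (cases "z + x \<ge> 0") auto
    moreover have "isCont (\<lambda>z. max 0 (z + x) ^ m) t" by (intro continuous_intros)
    ultimately show ?thesis using 3 assms unfolding CARAT_DERIV by (intro exI[of _ "\<lambda>z. max 0 (z + x) ^ m"]) auto
  qed
qed

lemma truncated_linear_deriv:
  assumes "t \<noteq> -x"
  shows "((\<lambda>t::real. max 0 (t + x)) has_real_derivative of_bool (-t < x)) (at t)"
proof (cases "-t < x")
  case True
  have "((\<lambda>t. t + x) has_real_derivative 1) (at t)" by (auto intro!: derivative_eq_intros)
  then have "((\<lambda>t. max 0 (t + x)) has_real_derivative 1) (at t)"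
    by (rule has_field_derivative_transform_within_open[of _ _ _ "{-x<..}"]) (use True in auto)
  then show ?thesis using True by simp
next
  case False
  have "((\<lambda>t. 0) has_real_derivative 0) (at t)" by simp
  then have "((\<lambda>t. max 0 (t + x)) has_real_derivative 0) (at t)"
    by (rule has_field_derivative_transform_within_open[of _ _ _ "{..<-x}"]) (use False assms in auto)
  then show ?thesis using False by simp
qed

lemma spline_deriv_derivative:
  assumes "Suc q < r"
  shows "(spline_deriv r l xs C q has_real_derivative spline_deriv r l xs C (Suc q) t) (at t)"
proof -
  define m where "m = r - Suc q"
  have m: "1 \<le> m" "r - q = Suc m" using assms by (auto simp: m_def)
  have "((\<lambda>t. alt_sum (\<lambda>x. max 0 (t + x) ^ Suc m) xs) has_real_derivative
      alt_sum (\<lambda>x. real (Suc m) * max 0 (t + x) ^ m) xs) (at t)"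
    by (rule has_real_derivative_alt_sum) (rule truncated_power_deriv[OF m(1)])
  moreover have "alt_sum (\<lambda>x. real (Suc m) * max 0 (t + x) ^ m) xs
      = real (Suc m) * alt_sum (\<lambda>x. max 0 (t + x) ^ m) xs"
    by (induction xs) (simp_all add: right_diff_distrib)
  ultimately have d: "((\<lambda>t. alt_sum (\<lambda>x. max 0 (t + x) ^ Suc m) xs) has_real_derivative
      real (Suc m) * alt_sum (\<lambda>x. max 0 (t + x) ^ m) xs) (at t)" by simp
  have "((\<lambda>t. l / fact (Suc m) * alt_sum (\<lambda>x. max 0 (t + x) ^ Suc m) xs + (if q = 0 then C else 0))
      has_real_derivative l / fact (Suc m) * (real (Suc m) * alt_sum (\<lambda>x. max 0 (t + x) ^ m) xs) + 0) (at t)"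
    by (intro DERIV_add DERIV_cmult d DERIV_const)
  moreover have "l / fact (Suc m) * (real (Suc m) * A) + 0 = l / fact m * A" for A
    by (simp add: fact_Suc del: of_nat_Suc)
  ultimately show ?thesis
    using assms unfolding spline_deriv_def m(2) by (simp add: m_def[symmetric] del: power_Suc fact_Suc of_nat_Suc)
qed

lemma spline_deriv_top_derivative:
  assumes "1 \<le> r" "t \<notin> uminus ` set xs"
  shows "(spline_deriv r l xs C (r - 1) has_real_derivative spline_deriv r l xs C r t) (at t)"
proof -
  have rr: "r - 1 < r" "r - (r - 1) = 1" using assms by auto
  have "((\<lambda>t. alt_sum (\<lambda>x. max 0 (t + x)) xs) has_real_derivative alt_sum (\<lambda>x. of_bool (-t < x)) xs) (at t)"
    by (rule has_real_derivative_alt_sum, rule truncated_linear_deriv) (use assms in force)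
  then have "((\<lambda>t. l * alt_sum (\<lambda>x. max 0 (t + x)) xs + (if r - 1 = 0 then C else 0)) has_real_derivative
      l * alt_sum (\<lambda>x. of_bool (-t < x)) xs + 0) (at t)"
    by (intro DERIV_add DERIV_cmult DERIV_const)
  then show ?thesis using rr unfolding spline_deriv_def step_def rr(2) by simp
qed

lemma nth_deriv_knot_spline:
  assumes "q < r" "t \<le> 0"
  shows "nth_deriv q (knot_spline r l xs C) t = spline_deriv r l xs C q t"
  using assms
proof (induction q arbitrary: t)
  case 0
  then show ?case by (simp add: knot_spline_def spline_deriv_def)
next
  case (Suc q)
  have "(spline_deriv r l xs C q has_vector_derivative spline_deriv r l xs C (Suc q) t) (at t within {..0})"
    unfolding has_real_derivative_iff_has_vector_derivative[symmetric]
    by (rule has_field_derivative_at_within, rule spline_deriv_derivative) (use Suc.prems in simp)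
  then have "(nth_deriv q (knot_spline r l xs C) has_vector_derivative spline_deriv r l xs C (Suc q) t) (at t within {..0})"
  proof (rule has_vector_derivative_transform[rotated 2])
    show "t \<in> {..0}" using Suc.prems by simp
    fix s assume "s \<in> {..(0::real)}"
    then show "nth_deriv q (knot_spline r l xs C) s = spline_deriv r l xs C q s"
      using Suc.prems by (intro Suc.IH) auto
  qed
  then show ?case
    unfolding nth_deriv_Suc by (rule vector_derivative_within[OF at_within_half_line_neq_bot[OF Suc.prems(2)]])
qed

lemma top_deriv_knot_spline:
  assumes "1 \<le> r" "t \<le> 0" "t \<notin> uminus ` set xs"
  shows "(nth_deriv (r - 1) (knot_spline r l xs C) has_vector_derivative spline_deriv r l xs C r t) (at t within {..0})"
    and "nth_deriv r (knot_spline r l xs C) t = l * step xs (-t)"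
proof -
  have "(spline_deriv r l xs C (r - 1) has_vector_derivative spline_deriv r l xs C r t) (at t within {..0})"
    unfolding has_real_derivative_iff_has_vector_derivative[symmetric]
    by (rule has_field_derivative_at_within[OF spline_deriv_top_derivative[OF assms(1,3)]])
  then show d: "(nth_deriv (r - 1) (knot_spline r l xs C) has_vector_derivative spline_deriv r l xs C r t) (at t within {..0})"
  proof (rule has_vector_derivative_transform[rotated 2])
    fix s assume "s \<in> {..(0::real)}"
    then show "nth_deriv (r - 1) (knot_spline r l xs C) s = spline_deriv r l xs C (r - 1) s"
      using assms(1) by (intro nth_deriv_knot_spline) auto
  qed (use assms in simp)
  have "nth_deriv (Suc (r - 1)) (knot_spline r l xs C) t = spline_deriv r l xs C r t"
    unfolding nth_deriv_Suc by (rule vector_derivative_within[OF at_within_half_line_neq_bot[OF assms(2)] d])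
  then show "nth_deriv r (knot_spline r l xs C) t = l * step xs (-t)"
    using assms(1) by (simp add: spline_deriv_def)
qed

lemma spline_deriv_nonneg:
  assumes "knots xs" "0 \<le> l" "0 \<le> C"
  shows "0 \<le> spline_deriv r l xs C q t"
proof (cases "q < r")
  case True
  have "0 \<le> alt_sum (\<lambda>x. max 0 (t + x) ^ (r - q)) xs"
    by (rule alt_sum_bounds(1)[OF knots_sorted[OF assms(1)]]) (auto intro!: power_mono)
  then show ?thesis using True assms by (simp add: spline_deriv_def)
next
  case False
  then show ?thesis using assms step_unit_interval[OF knots_sorted[OF assms(1)], of "-t"]
    by (simp add: spline_deriv_def)
qed

lemma knot_spline_chain:
  assumes xs: "knots xs" and r: "1 \<le> r" and l: "0 < l" and C: "0 \<le> C"
  shows "derivative_chain r l (\<lambda>q. nth_deriv q (knot_spline r l xs C)) (uminus ` set xs)"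
proof
  let ?\<phi> = "knot_spline r l xs C"
  show "1 \<le> r" "0 < l" by fact+
  show "negligible (uminus ` set xs)" by (simp add: negligible_finite)
  show "0 \<le> nth_deriv q ?\<phi> t" if "q < r" "t \<le> 0" for q t
    unfolding nth_deriv_knot_spline[OF that] using xs l C by (intro spline_deriv_nonneg) auto
  show "(nth_deriv q ?\<phi> has_vector_derivative nth_deriv (Suc q) ?\<phi> t) (at t within {..0})"
    if "Suc q < r" "t \<le> 0" for q t
  proof -
    have "(spline_deriv r l xs C q has_vector_derivative spline_deriv r l xs C (Suc q) t) (at t within {..0})"
      unfolding has_real_derivative_iff_has_vector_derivative[symmetric]
      by (rule has_field_derivative_at_within[OF spline_deriv_derivative[OF that(1)]])
    then show ?thesis unfolding nth_deriv_knot_spline[OF that]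
    proof (rule has_vector_derivative_transform[rotated 2])
      fix s assume "s \<in> {..(0::real)}"
      then show "nth_deriv q ?\<phi> s = spline_deriv r l xs C q s"
        using that by (intro nth_deriv_knot_spline) auto
    qed (use that in simp)
  qed
  fix t assume t: "t \<le> (0::real)" "t \<notin> uminus ` set xs"
  have "spline_deriv r l xs C r t = l * step xs (-t)" by (simp add: spline_deriv_def)
  then show "(nth_deriv (r - 1) ?\<phi> has_vector_derivative nth_deriv r ?\<phi> t) (at t within {..0})"
    using top_deriv_knot_spline[OF r t, of l C] by simp
  show "0 \<le> nth_deriv r ?\<phi> t \<and> nth_deriv r ?\<phi> t \<le> l"
    unfolding top_deriv_knot_spline(2)[OF r t]
    using step_unit_interval[OF knots_sorted[OF xs], of "-t"] l by (simp add: mult_left_le)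
next
  show "locally_abs_cont (nth_deriv (r - 1) (knot_spline r l xs C))"
    unfolding locally_abs_cont_def
  proof (intro allI impI)
    fix a b :: real assume ab: "a \<le> b \<and> b \<le> 0"
    have lip: "\<bar>alt_sum (\<lambda>x. max 0 (v + x)) ys - alt_sum (\<lambda>x. max 0 (w + x)) ys\<bar> \<le> real (length ys) * (v - w)"
      if "w \<le> v" for v w :: real and ys
    proof (induction ys)
      case (Cons y ys)
      have "\<bar>max 0 (v + y) - max 0 (w + y)\<bar> \<le> v - w" using that by (simp add: max_def)
      with Cons show ?case by (simp add: algebra_simps)
    qed simp
    have rr: "r - 1 < r" "r - (r - 1) = 1" using r by auto
    show "abs_cont_on a b (nth_deriv (r - 1) (knot_spline r l xs C))"
    proof (rule abs_cont_on_if_lipschitz)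
      fix u v assume uv: "a \<le> u" "u \<le> v" "v \<le> b"
      then have "u \<le> 0" "v \<le> 0" using ab by auto
      then have "nth_deriv (r - 1) (knot_spline r l xs C) v - nth_deriv (r - 1) (knot_spline r l xs C) u
         = l * (alt_sum (\<lambda>x. max 0 (v + x)) xs - alt_sum (\<lambda>x. max 0 (u + x)) xs)"
        using rr by (simp add: nth_deriv_knot_spline spline_deriv_def right_diff_distrib)
      also have "\<bar>\<dots>\<bar> \<le> l * (real (length xs) * (v - u))"
        using lip[OF uv(2), of xs] l by (simp add: abs_mult)
      finally show "\<bar>nth_deriv (r - 1) (knot_spline r l xs C) v - nth_deriv (r - 1) (knot_spline r l xs C) u\<bar>
        \<le> (l * real (length xs)) * (v - u)" by (simp add: mult.assoc)
    qed
  qed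
qed

lemma linf_norm_top_knot_spline:
  assumes xs: "knots xs" "xs \<noteq> []" and r: "1 \<le> r" and l: "0 < l"
  shows "nth_deriv r (knot_spline r l xs C) \<in> borel_measurable (lebesgue_on {..0})"
    and "linf_norm (nth_deriv r (knot_spline r l xs C)) = ereal l"
proof -
  let ?f = "nth_deriv r (knot_spline r l xs C)"
  have "(\<lambda>t. step ys (-t)) \<in> borel_measurable lebesgue" for ys
  proof (induction ys)
    case (Cons y ys)
    have "(\<lambda>t. of_bool (-t < y)) = indicat_real {-y<..}" by (auto simp: fun_eq_iff indicator_def)
    moreover have "indicat_real {-y<..} \<in> borel_measurable lebesgue"
      by (rule borel_measurable_indicator) simp
    ultimately have "(\<lambda>t. of_bool (-t < y) :: real) \<in> borel_measurable lebesgue" by simp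
    then show ?case using Cons.IH by (simp add: borel_measurable_diff)
  qed simp
  then have m: "(\<lambda>t. l * step xs (-t)) \<in> borel_measurable (lebesgue_on {..0})"
    by (intro measurable_restrict_space1 borel_measurable_times borel_measurable_const)
  have top: "?f t = l * step xs (-t)" if "t \<le> 0" "t \<notin> uminus ` set xs" for t
    by (rule top_deriv_knot_spline(2)[OF r that])
  show meas: "?f \<in> borel_measurable (lebesgue_on {..0})"
  proof (rule measurable_discrete_difference[OF m, of "uminus ` set xs"])
    fix x assume "x \<in> uminus ` set xs"
    then have "x \<le> 0" using knots_pos[OF xs(1)] by force
    then show "{x} \<in> sets (lebesgue_on {..0})" by (simp add: sets_restrict_space_iff)
  qed (use top in \<open>auto simp: countable_finite\<close>)
  show "linf_norm ?f = ereal l"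
  proof (rule linf_norm_eqI[OF meas, of "uminus ` set xs"])
    show "negligible (uminus ` set xs)" by (simp add: negligible_finite)
    show "\<bar>?f t\<bar> \<le> l" if "t \<le> 0" "t \<notin> uminus ` set xs" for t
      unfolding top[OF that] using step_unit_interval[OF knots_sorted[OF xs(1)], of "-t"] l
      by (simp add: abs_mult mult_left_le)
    fix z assume z: "z < l"
    obtain x ys where xys: "xs = x # ys" using xs(2) by (cases xs) auto
    define m where "m = Max (insert 0 (set ys))"
    have m: "0 \<le> m" "\<And>y. y \<in> set ys \<Longrightarrow> y \<le> m" unfolding m_def by auto
    have "m \<in> insert 0 (set ys)" unfolding m_def by (rule Max_in) auto
    then have "m < x" using xs(1) xys by auto
    \<comment> \<open>Between the two largest knots the top derivative equals \<open>l\<close>.\<close>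
    have "z \<le> \<bar>?f t\<bar>" if t: "t \<in> {-x<..<-m}" for t
    proof -
      have "step ys (-t) = 0" using t m(2) by (intro step_eq_0) force
      then have st: "step xs (-t) = 1" using t xys by auto
      have "t \<notin> uminus ` set xs" using t m(2) xys by force
      then have "?f t = l * step xs (-t)" using top t m(1) by auto
      then show ?thesis using st z l by simp
    qed
    then show "\<exists>a b. a < b \<and> b \<le> 0 \<and> (\<forall>t\<in>{a<..<b}. z \<le> \<bar>?f t\<bar>)"
      using \<open>m < x\<close> m(1) by (intro exI[of _ "-x"] exI[of _ "-m"]) auto
  qed
qed

lemma linf_norm_knot_spline:
  assumes xs: "knots xs" and r: "1 \<le> r" and l: "0 < l" and C: "0 \<le> C" and q: "q < r"
  shows "linf_norm (nth_deriv q (knot_spline r l xs C)) =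
     ereal (l / fact (r - q) * power_sum (r - q) xs + (if q = 0 then C else 0))"
proof -
  interpret derivative_chain r l "\<lambda>q. nth_deriv q (knot_spline r l xs C)" "uminus ` set xs"
    by (rule knot_spline_chain[OF xs r l C])
  have "alt_sum (\<lambda>x. max 0 (0 + x) ^ (r - q)) xs = power_sum (r - q) xs"
    using knots_pos[OF xs] unfolding power_sum_def by (induction xs) auto
  then show ?thesis
    unfolding linf_norm_lower[OF q] using nth_deriv_knot_spline[OF q, of 0 l xs C] q
    by (simp add: spline_deriv_def)
qed

lemma knot_spline_in_Lrr_class:
  assumes xs: "knots xs" "xs \<noteq> []" and r: "1 \<le> r" and l: "0 < l" and C: "0 \<le> C"
  shows "knot_spline r l xs C \<in> Lrr_class r"
proof -
  let ?\<phi> = "knot_spline r l xs C"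
  interpret derivative_chain r l "\<lambda>q. nth_deriv q ?\<phi>" "uminus ` set xs"
    by (rule knot_spline_chain[OF xs(1) r l C])
  have "?\<phi> \<in> Linf"
    unfolding Linf_def using measurable_lower[of 0] linf_norm_lower[of 0] r by simp
  moreover have "nth_deriv r ?\<phi> \<in> Linf"
    unfolding Linf_def using linf_norm_top_knot_spline[OF xs r l] by simp
  moreover have "\<forall>i<r - 1. \<forall>t\<le>0. nth_deriv i ?\<phi> differentiable (at t within {..0})"
    by (intro allI impI differentiableI_vector[OF deriv_lower]) auto
  moreover have "AE t in lebesgue_on {..0}. nth_deriv (r - 1) ?\<phi> differentiable (at t within {..0})"
    unfolding AE_half_line_iff
    by (rule negligible_subset[OF N]) (use deriv_top differentiableI_vector in blast)
  moreover have "AE t in lebesgue_on {..0}. nth_deriv r ?\<phi> t \<ge> 0"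
    unfolding AE_half_line_iff by (rule negligible_subset[OF N]) (use top_bounds in blast)
  ultimately show ?thesis
    unfolding Lrr_class_def Lr_space_def using abs_cont nonneg by auto
qed

text \<open>The link between the function class and the moment problem: \<open>f\<close> is the time-reversed normalised
  top derivative and \<open>c\<close> the limit of \<open>x\<close> at \<open>-\<infinity>\<close>.\<close>

lemma Lrr_class_moments:
  assumes x: "x \<in> Lrr_class r" and r: "1 \<le> r" and L: "0 < L"
    and norm: "linf_norm (nth_deriv r x) = ereal L"
  obtains f c where "0 \<le> c" "negligible {t. 0 < t \<and> \<not> (0 \<le> f t \<and> f t \<le> 1)}"
    "\<And>q. q < r \<Longrightarrow> linf_norm (nth_deriv q x) = ereal (nth_deriv q x 0)"
    "\<And>e. 1 \<le> e \<Longrightarrow> e \<le> r \<Longrightarrow>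
       has_moment f e (fact e / L * (nth_deriv (r - e) x 0 - (if e = r then c else 0)))"
proof -
  obtain N where "derivative_chain r L (\<lambda>q. nth_deriv q x) N" using Lrr_class_chain[OF assms] .
  then interpret derivative_chain r L "\<lambda>q. nth_deriv q x" N .
  obtain c where c: "0 \<le> c" "((\<lambda>T. nth_deriv 0 x (-T)) \<longlongrightarrow> c) at_top"
    using limit_at_minus_infinity[of 0] r by auto
  show ?thesis
    by (rule that[OF c(1) density_ae_unit linf_norm_lower moments[OF c(2)]])
qed

section \<open>Admissible systems of norms\<close>

lemma spline_eq_knot_spline: "spline r s a l = knot_spline r l (map a [1..<Suc s]) 0"
proof
  fix t
  have "alt_sum f (map a [1..<Suc s]) = (\<Sum>j=1..s. (-1) ^ (j + 1) * f (a j))" for f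
  proof (induction s)
    case (Suc s)
    have "[1..<Suc (Suc s)] = [1..<Suc s] @ [Suc s]" by simp
    then show ?case using Suc by (simp add: alt_sum_append del: upt_Suc)
  qed simp
  then show "spline r s a l t = knot_spline r l (map a [1..<Suc s]) 0 t"
    by (simp add: spline_def knot_spline_def)
qed

lemma Phi_iff:
  "\<phi> \<in> Phi r n \<longleftrightarrow>
     (\<exists>xs l. knots xs \<and> xs \<noteq> [] \<and> length xs \<le> n \<and> 0 < l \<and> \<phi> = knot_spline r l xs 0)"
proof
  assume "\<phi> \<in> Phi r n"
  then obtain s a l where a: "\<phi> = spline r s a l" "1 \<le> s" "s \<le> n" "strict_antimono_on {1..s} a"
    "\<forall>j\<in>{1..s}. a j > 0" "l > 0" unfolding Phi_def by blast
  have "a j < a i" if "i \<in> {1..s}" "j \<in> {1..s}" "i < j" for i j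
    using a(4) that by (auto simp: monotone_on_def)
  then have "sorted_wrt (>) (map a [1..<Suc s])"
    by (simp add: sorted_wrt_iff_nth_less del: upt_Suc)
  then have "knots (map a [1..<Suc s])" using a(5) unfolding knots_def by auto
  then show "\<exists>xs l. knots xs \<and> xs \<noteq> [] \<and> length xs \<le> n \<and> 0 < l \<and> \<phi> = knot_spline r l xs 0"
    using a by (intro exI[of _ "map a [1..<Suc s]"] exI[of _ l]) (auto simp: spline_eq_knot_spline)
next
  assume "\<exists>xs l. knots xs \<and> xs \<noteq> [] \<and> length xs \<le> n \<and> 0 < l \<and> \<phi> = knot_spline r l xs 0"
  then obtain xs l where xs: "knots xs" "xs \<noteq> []" "length xs \<le> n" "0 < l" "\<phi> = knot_spline r l xs 0"
    by blast
  define a where "a j = xs ! (j - 1)" for j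
  have "map a [1..<Suc (length xs)] = map (\<lambda>i. xs ! i) [0..<length xs]"
    by (rule nth_equalityI) (auto simp: a_def simp del: upt_Suc)
  also have "\<dots> = xs" by (rule map_nth)
  finally have sp: "\<phi> = spline r (length xs) a l" using xs(5) by (simp only: spline_eq_knot_spline)
  have "a j < a i" if "i \<in> {1..length xs}" "j \<in> {1..length xs}" "i < j" for i j
    using xs(1) that unfolding a_def knots_def sorted_wrt_iff_nth_less by auto
  then have "strict_antimono_on {1..length xs} a" by (auto simp: monotone_on_def)
  moreover have "\<forall>j\<in>{1..length xs}. a j > 0" using knots_pos[OF xs(1)] by (auto simp: a_def)
  moreover have "1 \<le> length xs" using xs(2) by (simp add: Suc_le_eq)
  ultimately show "\<phi> \<in> Phi r n"
    unfolding Phi_def using xs(3,4) sp by blast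
qed

lemma has_norms_knot_spline_iff:
  assumes xs: "knots xs" "xs \<noteq> []" and l: "0 < l" and C: "0 \<le> C"
    and q: "r \<in> set q" "\<forall>i\<in>set q. i \<le> r" and r: "1 \<le> r"
  shows "has_norms q M (knot_spline r l xs C) \<longleftrightarrow> l = M r \<and>
    (\<forall>i\<in>set q - {r}. M r / fact (r - i) * power_sum (r - i) xs + (if i = 0 then C else 0) = M i)"
proof -
  have top: "linf_norm (nth_deriv r (knot_spline r l xs C)) = ereal l"
    by (rule linf_norm_top_knot_spline(2)[OF xs r l])
  have low: "linf_norm (nth_deriv i (knot_spline r l xs C)) =
       ereal (l / fact (r - i) * power_sum (r - i) xs + (if i = 0 then C else 0))"
    if "i \<in> set q - {r}" for i
  proof (rule linf_norm_knot_spline[OF xs(1) r l C])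
    show "i < r" using q(2) that by force
  qed
  have "set q = insert r (set q - {r})" using q by auto
  then have "has_norms q M (knot_spline r l xs C) \<longleftrightarrow>
    linf_norm (nth_deriv r (knot_spline r l xs C)) = ereal (M r) \<and>
    (\<forall>i\<in>set q - {r}. linf_norm (nth_deriv i (knot_spline r l xs C)) = ereal (M i))"
    unfolding has_norms_def by blast
  also have "\<dots> \<longleftrightarrow> l = M r \<and>
    (\<forall>i\<in>set q - {r}. M r / fact (r - i) * power_sum (r - i) xs + (if i = 0 then C else 0) = M i)"
    using top low by (auto simp del: plus_ereal.simps)
  finally show ?thesis .
qed

text \<open>The data of the theorem, with \<open>n = d - 2\<close>: the orders in \<open>k2\<close> other than \<open>r\<close> prescribe
  \<open>n\<close> moments, and the order \<open>k1\<close> prescribes one more, of the largest exponent \<open>e1\<close>.\<close>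

locale prescribed_norms =
  fixes r k1 n :: nat and k2 :: "nat list" and M :: "nat \<Rightarrow> real"
  assumes n: "1 \<le> n" and len: "length k2 = Suc n"
    and sorted: "sorted_wrt (<) (k1 # k2)" and last: "last k2 = r"
    and M_pos: "\<forall>i\<in>set (k1 # k2). M i > 0"
begin

definition E :: "nat set" where "E = (\<lambda>i. r - i) ` (set k2 - {r})"

definition e1 :: nat where "e1 = r - k1"

text \<open>A spline with top norm \<open>M r\<close> has \<open>M (r - e)\<close> as norm of its derivative of order \<open>r - e\<close> if
  and only if its power sum of exponent \<open>e\<close> is this number.\<close>

definition target :: "nat \<Rightarrow> real" where "target e = fact e / M r * M (r - e)"

lemma r_mem: "r \<in> set k2"
proof -
  have "k2 \<noteq> []" using len by auto
  then show ?thesis using last last_in_set[of k2] by simp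
qed

lemma orders: "i \<in> set k2 \<Longrightarrow> i \<le> r" "i \<in> set k2 \<Longrightarrow> k1 < i"
proof -
  assume i: "i \<in> set k2"
  then show "k1 < i" using sorted by auto
  have "k2 \<noteq> []" using len by auto
  then have "k2 = butlast k2 @ [r]" using last append_butlast_last_id[of k2] by simp
  moreover have "sorted_wrt (<) k2" using sorted by simp
  ultimately have "\<forall>j\<in>set (butlast k2). j < r" by (metis sorted_wrt_append list.set_intros(1))
  then show "i \<le> r" using i \<open>k2 = butlast k2 @ [r]\<close>
    by (metis Un_iff empty_iff empty_set insert_iff less_imp_le list.simps(15) order.refl set_append)
qed

lemma k1_less: "k1 < r"
  using orders(2)[OF r_mem] .

lemma r1: "1 \<le> r"
  using k1_less by simp

lemma Mr_pos: "0 < M r" and Mk1_pos: "0 < M k1"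
  using M_pos r_mem by auto

lemma E_bounds: "finite E" "\<forall>e\<in>E. 1 \<le> e \<and> e < e1" "\<forall>e\<in>E. e < r" "1 \<le> e1" "e1 \<le> r"
  using orders k1_less by (force simp: E_def e1_def)+

lemma e1_notin: "e1 \<notin> E"
  using E_bounds by auto

lemma card_E: "card E = n"
proof -
  have "inj_on (\<lambda>i. r - i) (set k2 - {r})" using orders(1) by (fastforce simp: inj_on_def)
  then have "card E = card (set k2 - {r})" unfolding E_def by (rule card_image)
  moreover have "distinct k2" using sorted by (simp add: strict_sorted_iff)
  then have "card (set k2) = Suc n" using len by (simp add: distinct_card)
  ultimately show ?thesis using r_mem by simp
qed

lemma target_pos: "e \<in> insert e1 E \<Longrightarrow> 0 < target e"
  using Mr_pos M_pos orders(1) k1_less by (auto simp: target_def E_def e1_def)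

lemma norm_eq_iff: "M r / fact e * p = M (r - e) \<longleftrightarrow> p = target e"
  using Mr_pos by (auto simp: target_def field_simps)

lemma norms_k2_iff:
  assumes "knots xs" "xs \<noteq> []" "0 < l"
  shows "has_norms k2 M (knot_spline r l xs 0) \<longleftrightarrow> l = M r \<and> (\<forall>e\<in>E. power_sum e xs = target e)"
proof -
  have "(\<forall>i\<in>set k2 - {r}. M r / fact (r - i) * power_sum (r - i) xs = M i) \<longleftrightarrow>
      (\<forall>i\<in>set k2 - {r}. power_sum (r - i) xs = target (r - i))"
    by (rule ball_cong[OF refl]) (use norm_eq_iff orders(1) in force)
  then show ?thesis
    using has_norms_knot_spline_iff[OF assms, of 0 r k2 M] r_mem orders(1) r1 by (simp add: E_def)
qed

lemma norms_k_iff: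
  assumes "knots xs" "xs \<noteq> []" "0 < l"
  shows "has_norms (k1 # k2) M (knot_spline r l xs 0) \<longleftrightarrow>
     l = M r \<and> (\<forall>e\<in>insert e1 E. power_sum e xs = target e)"
proof -
  have "linf_norm (nth_deriv k1 (knot_spline r l xs 0)) = ereal (l / fact e1 * power_sum e1 xs)"
    using linf_norm_knot_spline[OF assms(1) r1 assms(3), of 0 k1] k1_less by (simp add: e1_def)
  moreover have "M r / fact e1 * power_sum e1 xs = M k1 \<longleftrightarrow> power_sum e1 xs = target e1"
    using norm_eq_iff[of e1] k1_less by (simp add: e1_def)
  ultimately show ?thesis
    using norms_k2_iff[OF assms] by (auto simp: has_norms_def)
qed

lemma k1_norm:
  assumes "knots xs"
  shows "linf_norm (nth_deriv k1 (knot_spline r (M r) xs 0)) = ereal (M r / fact e1 * power_sum e1 xs)"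
  using linf_norm_knot_spline[OF assms r1 Mr_pos, of 0 k1] k1_less by (simp add: e1_def)

lemma k1_norm_iff:
  "M r / fact e1 * p = M k1 \<longleftrightarrow> p = target e1"
  "M r / fact e1 * p \<le> M k1 \<longleftrightarrow> p \<le> target e1"
  "M r / fact e1 * p < M k1 \<longleftrightarrow> p < target e1"
  using Mr_pos k1_less by (auto simp: target_def e1_def field_simps)

lemma knots_nonempty:
  assumes "\<forall>e\<in>E. power_sum e xs = target e"
  shows "xs \<noteq> []"
proof
  assume "xs = []"
  obtain e where "e \<in> E" using card_E n by fastforce
  then show False using assms target_pos[of e] \<open>xs = []\<close> by auto
qed

lemma knots_determined:
  assumes "knots xs" "knots ys" "length xs \<le> n" "length ys \<le> n"
    "\<forall>e\<in>E. power_sum e xs = target e" "\<forall>e\<in>E. power_sum e ys = target e"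
  shows "ys = xs"
  using assms E_bounds card_E by (intro knots_unique[of xs ys E]) auto

lemma extremal_spline_eq:
  assumes xs: "knots xs" "length xs \<le> n" "\<forall>e\<in>E. power_sum e xs = target e"
  shows "extremal_spline r k2 M = knot_spline r (M r) xs 0"
  unfolding extremal_spline_def
proof (rule the_equality)
  have ne: "xs \<noteq> []" by (rule knots_nonempty[OF xs(3)])
  have norms: "has_norms k2 M (knot_spline r (M r) xs 0)"
    using norms_k2_iff[OF xs(1) ne Mr_pos] xs(3) by simp
  have "nth_deriv i (knot_spline r (M r) xs 0) 0 = M i" if i: "i \<in> set k2" "i < r" for i
  proof -
    interpret derivative_chain r "M r" "\<lambda>q. nth_deriv q (knot_spline r (M r) xs 0)" "uminus ` set xs"
      by (rule knot_spline_chain[OF xs(1) r1 Mr_pos order_refl])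
    show ?thesis using linf_norm_lower[OF i(2)] norms i(1) by (simp add: has_norms_def)
  qed
  moreover have "knot_spline r (M r) xs 0 \<in> Phi r (length k2 - 1)"
    unfolding Phi_iff using xs ne Mr_pos len by auto
  ultimately show "knot_spline r (M r) xs 0 \<in> Phi r (length k2 - 1) \<and>
    has_norms k2 M (knot_spline r (M r) xs 0) \<and>
    (\<forall>i\<in>set k2. i < r \<longrightarrow> nth_deriv i (knot_spline r (M r) xs 0) 0 = M i)" using norms by blast
next
  fix \<phi> assume "\<phi> \<in> Phi r (length k2 - 1) \<and> has_norms k2 M \<phi> \<and>
    (\<forall>i\<in>set k2. i < r \<longrightarrow> nth_deriv i \<phi> 0 = M i)"
  then obtain ys l where ys: "knots ys" "ys \<noteq> []" "length ys \<le> n" "0 < l" "\<phi> = knot_spline r l ys 0"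
    "has_norms k2 M (knot_spline r l ys 0)" unfolding Phi_iff len by auto
  then have "l = M r" "\<forall>e\<in>E. power_sum e ys = target e" using norms_k2_iff by auto
  then show "\<phi> = knot_spline r (M r) xs 0" using knots_determined[OF xs(1) ys(1) xs(2) ys(3) xs(3)] ys(5) by simp
qed

lemma admissible_by_spline:
  assumes "knots xs" "xs \<noteq> []" "0 \<le> C" "has_norms q M (knot_spline r (M r) xs C)" "set q \<subseteq> set (k1 # k2)"
  shows "admissible r q M"
  unfolding admissible_def
  using knot_spline_in_Lrr_class[OF assms(1,2) r1 Mr_pos assms(3)] assms(4,5) M_pos by blast

text \<open>By uniqueness of the knots, a spline with exactly \<open>n\<close> knots and the prescribed norms does not also
  arise from fewer knots; so Type 1 just counts knots.\<close>

lemma type1_k2_iff: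
  "admissible1 r k2 M \<longleftrightarrow> (\<exists>xs. knots xs \<and> length xs = n \<and> (\<forall>e\<in>E. power_sum e xs = target e))"
proof
  assume "admissible1 r k2 M"
  then obtain \<phi> where \<phi>: "\<phi> \<in> Phi r n" "\<phi> \<notin> Phi r (n - 1)" "has_norms k2 M \<phi>"
    unfolding admissible1_def len by auto
  then obtain xs l where xs: "knots xs" "xs \<noteq> []" "length xs \<le> n" "0 < l" "\<phi> = knot_spline r l xs 0"
    unfolding Phi_iff by blast
  have "length xs = n"
    using \<phi>(2) xs unfolding Phi_iff by (metis One_nat_def Suc_pred le_neq_implies_less less_Suc_eq_le n neq0_conv not_one_le_zero)
  then show "\<exists>xs. knots xs \<and> length xs = n \<and> (\<forall>e\<in>E. power_sum e xs = target e)"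
    using xs \<phi>(3) norms_k2_iff[OF xs(1,2,4)] by auto
next
  assume "\<exists>xs. knots xs \<and> length xs = n \<and> (\<forall>e\<in>E. power_sum e xs = target e)"
  then obtain xs where xs: "knots xs" "length xs = n" "\<forall>e\<in>E. power_sum e xs = target e" by blast
  have ne: "xs \<noteq> []" by (rule knots_nonempty[OF xs(3)])
  have norms: "has_norms k2 M (knot_spline r (M r) xs 0)"
    using norms_k2_iff[OF xs(1) ne Mr_pos] xs(3) by simp
  have "knot_spline r (M r) xs 0 \<notin> Phi r (n - 1)"
  proof
    assume "knot_spline r (M r) xs 0 \<in> Phi r (n - 1)"
    then obtain ys l where ys: "knots ys" "ys \<noteq> []" "length ys \<le> n - 1" "0 < l"
      "knot_spline r (M r) xs 0 = knot_spline r l ys 0" unfolding Phi_iff by blast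
    then have "\<forall>e\<in>E. power_sum e ys = target e" using norms norms_k2_iff[OF ys(1,2,4)] by simp
    then have "ys = xs" using xs ys(1,3) by (intro knots_determined) auto
    then show False using ys(3) xs(2) n by simp
  qed
  moreover have "knot_spline r (M r) xs 0 \<in> Phi r n" unfolding Phi_iff using xs ne Mr_pos by auto
  moreover have "admissible r k2 M"
    by (rule admissible_by_spline[OF xs(1) ne order_refl norms]) auto
  ultimately show "admissible1 r k2 M" unfolding admissible1_def len using norms by auto
qed

lemma type2_k2_iff:
  "admissible2 r k2 M \<longleftrightarrow> (\<exists>xs. knots xs \<and> length xs < n \<and> (\<forall>e\<in>E. power_sum e xs = target e))"
proof
  assume "admissible2 r k2 M"
  then obtain \<phi> where "\<phi> \<in> Phi r (n - 1)" "has_norms k2 M \<phi>"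
    unfolding admissible2_def len by auto
  then obtain xs l where xs: "knots xs" "xs \<noteq> []" "length xs \<le> n - 1" "0 < l"
    "has_norms k2 M (knot_spline r l xs 0)" unfolding Phi_iff by blast
  then show "\<exists>xs. knots xs \<and> length xs < n \<and> (\<forall>e\<in>E. power_sum e xs = target e)"
    using norms_k2_iff[OF xs(1,2,4)] n by (intro exI[of _ xs]) auto
next
  assume "\<exists>xs. knots xs \<and> length xs < n \<and> (\<forall>e\<in>E. power_sum e xs = target e)"
  then obtain xs where xs: "knots xs" "length xs < n" "\<forall>e\<in>E. power_sum e xs = target e" by blast
  have ne: "xs \<noteq> []" by (rule knots_nonempty[OF xs(3)])
  have norms: "has_norms k2 M (knot_spline r (M r) xs 0)"
    using norms_k2_iff[OF xs(1) ne Mr_pos] xs(3) by simp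
  have "knot_spline r (M r) xs 0 \<in> Phi r (n - 1)" unfolding Phi_iff using xs ne Mr_pos by auto
  moreover have "admissible r k2 M"
    by (rule admissible_by_spline[OF xs(1) ne order_refl norms]) auto
  ultimately show "admissible2 r k2 M" unfolding admissible2_def len using norms by auto
qed

lemma type1_kI:
  assumes xs: "knots xs" "length xs = Suc n" "\<forall>e\<in>insert e1 E. power_sum e xs = target e"
  shows "admissible1 r (k1 # k2) M"
proof -
  have ne: "xs \<noteq> []" using xs(2) by auto
  have norms: "has_norms (k1 # k2) M (knot_spline r (M r) xs 0)"
    using norms_k_iff[OF xs(1) ne Mr_pos] xs(3) by simp
  have "knot_spline r (M r) xs 0 \<notin> Phi r n"
  proof
    assume "knot_spline r (M r) xs 0 \<in> Phi r n"
    then obtain ys l where ys: "knots ys" "ys \<noteq> []" "length ys \<le> n" "0 < l"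
      "knot_spline r (M r) xs 0 = knot_spline r l ys 0" unfolding Phi_iff by blast
    then have "\<forall>e\<in>insert e1 E. power_sum e ys = target e" using norms norms_k_iff[OF ys(1,2,4)] by simp
    then have "ys = xs"
      using xs ys(1,3) E_bounds card_E e1_notin by (intro knots_unique[of xs ys "insert e1 E"]) auto
    then show False using ys(3) xs(2) by simp
  qed
  moreover have "knot_spline r (M r) xs 0 \<in> Phi r (Suc n)" unfolding Phi_iff using xs ne Mr_pos by auto
  moreover have "admissible r (k1 # k2) M"
    by (rule admissible_by_spline[OF xs(1) ne order_refl norms]) auto
  ultimately show ?thesis unfolding admissible1_def using norms len by auto
qed

lemma type2_kI:
  assumes xs: "knots xs" "length xs \<le> n" "\<forall>e\<in>insert e1 E. power_sum e xs = target e"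
  shows "admissible2 r (k1 # k2) M"
proof -
  have ne: "xs \<noteq> []" using xs(3) by (intro knots_nonempty) auto
  have norms: "has_norms (k1 # k2) M (knot_spline r (M r) xs 0)"
    using norms_k_iff[OF xs(1) ne Mr_pos] xs(3) by simp
  have "knot_spline r (M r) xs 0 \<in> Phi r n" unfolding Phi_iff using xs ne Mr_pos by auto
  moreover have "admissible r (k1 # k2) M"
    by (rule admissible_by_spline[OF xs(1) ne order_refl norms]) auto
  ultimately show ?thesis unfolding admissible2_def using norms len by auto
qed

text \<open>With fewer than \<open>n\<close> knots the first \<open>n\<close> moments leave no freedom for the last one. This
  separates Type 2 from Type 1.\<close>

lemma few_knots_rigid:
  assumes xs: "knots xs" "length xs < n" "\<forall>e\<in>E. power_sum e xs = target e"
    and f: "negligible {t. 0 < t \<and> \<not> (0 \<le> f t \<and> f t \<le> 1)}" "\<forall>e\<in>E. has_moment f e (target e)"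
    and m: "has_moment f e1 \<mu>"
  shows "\<mu> = power_sum e1 xs"
proof -
  have "negligible {t. 0 < t \<and> f t \<noteq> step xs t}"
    using xs f E_bounds card_E by (intro step_determined_by_moments[OF xs(1) f(1), of E]) auto
  then have "has_moment (step xs) e1 \<mu>" by (rule has_moment_cong_ae[OF m])
  moreover have "has_moment (step xs) e1 (power_sum e1 xs)"
    using knots_pos[OF xs(1)] E_bounds(4) by (intro has_moment_step) auto
  ultimately show ?thesis by (rule has_moment_unique)
qed

text \<open>An additive constant raises the norm of the function alone, and no spline without a constant can do
  the same because of the rigidity.\<close>

lemma type3_kI:
  assumes xs: "knots xs" "length xs < n" "\<forall>e\<in>E. power_sum e xs = target e"
    and k1: "k1 = 0" and less: "power_sum e1 xs < target e1"
  shows "admissible3 r (k1 # k2) M"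
proof -
  have ne: "xs \<noteq> []" by (rule knots_nonempty[OF xs(3)])
  define C where "C = M 0 - M r / fact e1 * power_sum e1 xs"
  have C: "0 < C" using k1_norm_iff(3)[of "power_sum e1 xs"] less k1 by (simp add: C_def)
  have "has_norms (k1 # k2) M (knot_spline r (M r) xs C)"
  proof -
    have "M r / fact (r - i) * power_sum (r - i) xs + (if i = 0 then C else 0) = M i"
      if i: "i \<in> set (k1 # k2) - {r}" for i
    proof (cases "i = k1")
      case True
      then show ?thesis using k1 unfolding C_def e1_def by simp
    next
      case False
      then have i: "i \<in> set k2 - {r}" using i by auto
      then have "i \<noteq> 0" "i \<le> r" "r - i \<in> E" using orders[of i] k1 by (auto simp: E_def)
      then show ?thesis using xs(3) norm_eq_iff[of "r - i" "power_sum (r - i) xs"] by simp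
    qed
    then show ?thesis
      using has_norms_knot_spline_iff[OF xs(1) ne Mr_pos less_imp_le[OF C], of r "k1 # k2" M]
        r_mem orders(1) r1 k1_less by simp
  qed
  moreover have "knot_spline r (M r) xs C = (\<lambda>t. knot_spline r (M r) xs 0 t + C)"
    by (simp add: knot_spline_def fun_eq_iff)
  moreover have "knot_spline r (M r) xs 0 \<in> Phi r (Suc n)" unfolding Phi_iff using xs ne Mr_pos by auto
  moreover have "admissible r (k1 # k2) M"
    by (rule admissible_by_spline[OF xs(1) ne less_imp_le[OF C] calculation(1)]) auto
  moreover have "\<not> admissible1 r (k1 # k2) M"
  proof
    assume "admissible1 r (k1 # k2) M"
    then obtain \<psi> n' where "\<psi> \<in> Phi r n'" "has_norms (k1 # k2) M \<psi>" unfolding admissible1_def by blast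
    then obtain ys l where ys: "knots ys" "ys \<noteq> []" "0 < l" "has_norms (k1 # k2) M (knot_spline r l ys 0)"
      unfolding Phi_iff by blast
    then have ps: "\<forall>e\<in>insert e1 E. power_sum e ys = target e" using norms_k_iff[OF ys(1-3)] by simp
    have mom: "has_moment (step ys) e (power_sum e ys)" if "1 \<le> e" for e
      using knots_pos[OF ys(1)] that by (intro has_moment_step) auto
    have "power_sum e1 ys = power_sum e1 xs"
    proof (rule few_knots_rigid[OF xs step_ae_unit_interval[OF knots_sorted[OF ys(1)]]])
      show "\<forall>e\<in>E. has_moment (step ys) e (target e)" using mom ps E_bounds(2) by (metis insertI2)
      show "has_moment (step ys) e1 (power_sum e1 ys)" by (rule mom[OF E_bounds(4)])
    qed
    then show False using ps less by simp
  qed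
  ultimately show ?thesis unfolding admissible3_def using C k1 len by auto
qed

text \<open>The norm of order \<open>k1\<close> exceeds the moment of the top derivative at most by the limit at
  \<open>-\<infinity>\<close>, and by nothing at all if \<open>k1 > 0\<close>. Hence the minimality of splines bounds it from
  below, and rigidity gives equality if there are fewer than \<open>n\<close> knots.\<close>

lemma admissible_kD:
  assumes "admissible r (k1 # k2) M"
  obtains xs where "knots xs" "length xs \<le> n" "\<forall>e\<in>E. power_sum e xs = target e"
    "power_sum e1 xs \<le> target e1" "length xs < n \<Longrightarrow> 0 < k1 \<Longrightarrow> power_sum e1 xs = target e1"
proof -
  obtain x where x: "x \<in> Lrr_class r" "has_norms (k1 # k2) M x" using assms unfolding admissible_def by blast
  have top: "linf_norm (nth_deriv r x) = ereal (M r)" using x(2) r_mem by (simp add: has_norms_def)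
  obtain c f where f: "0 \<le> c" "negligible {t. 0 < t \<and> \<not> (0 \<le> f t \<and> f t \<le> 1)}"
    "\<And>q. q < r \<Longrightarrow> linf_norm (nth_deriv q x) = ereal (nth_deriv q x 0)"
    "\<And>e. 1 \<le> e \<Longrightarrow> e \<le> r \<Longrightarrow>
       has_moment f e (fact e / M r * (nth_deriv (r - e) x 0 - (if e = r then c else 0)))"
    by (rule Lrr_class_moments[OF x(1) r1 Mr_pos top]) (rule that)
  have val: "nth_deriv i x 0 = M i" if "i \<in> set (k1 # k2)" "i < r" for i
  proof -
    have "linf_norm (nth_deriv i x) = ereal (M i)" using x(2) that(1) unfolding has_norms_def by blast
    then show ?thesis using f(3)[OF that(2)] by simp
  qed
  have mE: "has_moment f e (target e)" if e: "e \<in> E" for e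
  proof -
    obtain i where i: "i \<in> set k2" "i \<noteq> r" "e = r - i" using e by (auto simp: E_def)
    then have "i < r" "r - e = i" using orders(1)[of i] by auto
    then show ?thesis using f(4)[of e] e E_bounds(2,3) val[of i] i by (auto simp: target_def)
  qed
  define \<mu> where "\<mu> = fact e1 / M r * (M k1 - (if k1 = 0 then c else 0))"
  have "r - e1 = k1" "e1 = r \<longleftrightarrow> k1 = 0" using k1_less by (auto simp: e1_def)
  then have m1: "has_moment f e1 \<mu>" and \<mu>: "\<mu> \<le> target e1" "0 < k1 \<Longrightarrow> \<mu> = target e1"
    using f(4)[OF E_bounds(4,5)] val[of k1] k1_less Mr_pos f(1)
    by (auto simp: \<mu>_def target_def intro!: divide_right_mono mult_left_mono)
  obtain xs where xs: "knots xs" "length xs \<le> n" "\<forall>e\<in>E. power_sum e xs = target e"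
    using exists_knots_with_moments[OF f(2) E_bounds(1), of target] mE E_bounds(2) card_E by auto
  have "power_sum e1 xs \<le> \<mu>"
    by (rule step_minimizes_next_moment(1)[OF xs(1) f(2) E_bounds(1) _ E_bounds(2,4) _ m1])
       (use xs mE card_E in auto)
  moreover have "power_sum e1 xs = target e1" if "length xs < n" "0 < k1"
    using few_knots_rigid[OF xs(1) that(1) xs(3) f(2) _ m1] mE \<mu>(2)[OF that(2)] by auto
  ultimately show ?thesis using that[OF xs] \<mu>(1) by fastforce
qed

lemma raise_k1_norm:
  assumes xs: "knots xs" "length xs = n" "\<forall>e\<in>E. power_sum e xs = target e"
    and less: "power_sum e1 xs < target e1"
  shows "admissible1 r (k1 # k2) M"
proof -
  obtain ys where "knots ys" "length ys = Suc n" "\<forall>e\<in>E. power_sum e ys = target e" "power_sum e1 ys = target e1"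
    using extra_knot_with_prescribed_moment[OF xs(1) E_bounds(1,2,4) _ less] xs card_E by auto
  then show ?thesis by (intro type1_kI[of ys]) auto
qed

end

theorem theorem3:
  fixes r d k1 :: nat and k k2 :: "nat list" and M :: "nat \<Rightarrow> real"
  assumes "d \<ge> 3"
    and "length k = d" and "sorted_wrt (<) k" and "last k = r"
    and "k = k1 # k2"
    and "\<forall>i\<in>set k. M i > 0"
  shows "let N = linf_norm (nth_deriv k1 (extremal_spline r k2 M));
             cond_i = (admissible1 r k2 M \<and> ereal (M k1) \<ge> N);
             cond_ii = (admissible2 r k2 M \<and> k1 > 0 \<and> ereal (M k1) = N);
             cond_iii = (admissible2 r k2 M \<and> k1 = 0 \<and> ereal (M k1) \<ge> N)
         in (admissible r k M \<longleftrightarrow> cond_i \<or> cond_ii \<or> cond_iii) \<and>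
            (cond_i \<longrightarrow> (ereal (M k1) > N \<longrightarrow> admissible1 r k M) \<and>
                        (ereal (M k1) = N \<longrightarrow> admissible2 r k M)) \<and>
            (cond_ii \<longrightarrow> admissible2 r k M) \<and>
            (cond_iii \<longrightarrow> (ereal (M k1) = N \<longrightarrow> admissible2 r k M) \<and>
                          (ereal (M k1) > N \<longrightarrow> admissible3 r k M))"
proof -
  define N where "N = linf_norm (nth_deriv k1 (extremal_spline r k2 M))"
  interpret prescribed_norms r k1 "d - 2" k2 M
  proof
    show "1 \<le> d - 2" "length k2 = Suc (d - 2)" using assms(1,2,5) by auto
    show "sorted_wrt (<) (k1 # k2)" "\<forall>i\<in>set (k1 # k2). M i > 0" using assms by auto
    show "last k2 = r" using assms(1,2,4,5) by (cases k2) auto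
  qed
  have N: "N = ereal (M r / fact e1 * power_sum e1 xs)"
    if "knots xs" "length xs \<le> d - 2" "\<forall>e\<in>E. power_sum e xs = target e" for xs
    unfolding N_def extremal_spline_eq[OF that] by (rule k1_norm[OF that(1)])
  have N_iff: "N \<le> ereal (M k1) \<longleftrightarrow> power_sum e1 xs \<le> target e1"
      "N = ereal (M k1) \<longleftrightarrow> power_sum e1 xs = target e1" "N < ereal (M k1) \<longleftrightarrow> power_sum e1 xs < target e1"
    if "knots xs" "length xs \<le> d - 2" "\<forall>e\<in>E. power_sum e xs = target e" for xs
    unfolding N[OF that] using k1_norm_iff by simp_all
  have one: "N < ereal (M k1) \<Longrightarrow> admissible1 r k M" "ereal (M k1) = N \<Longrightarrow> admissible2 r k M"
    if "admissible1 r k2 M"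
  proof -
    obtain xs where xs: "knots xs" "length xs = d - 2" "\<forall>e\<in>E. power_sum e xs = target e"
      using \<open>admissible1 r k2 M\<close> unfolding type1_k2_iff by blast
    note iff = N_iff[OF xs(1) eq_refl[OF xs(2)] xs(3)]
    show "admissible1 r k M" if "N < ereal (M k1)"
      unfolding assms(5) using raise_k1_norm[OF xs] iff(3) that by simp
    show "admissible2 r k M" if "ereal (M k1) = N"
      unfolding assms(5) using type2_kI[OF xs(1) eq_refl[OF xs(2)]] xs(3) iff(2) that by auto
  qed
  have two: "ereal (M k1) = N \<Longrightarrow> admissible2 r k M" "k1 = 0 \<Longrightarrow> N < ereal (M k1) \<Longrightarrow> admissible3 r k M"
    if "admissible2 r k2 M"
  proof -
    obtain xs where xs: "knots xs" "length xs < d - 2" "\<forall>e\<in>E. power_sum e xs = target e"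
      using \<open>admissible2 r k2 M\<close> unfolding type2_k2_iff by blast
    note iff = N_iff[OF xs(1) less_imp_le[OF xs(2)] xs(3)]
    show "admissible2 r k M" if "ereal (M k1) = N"
      unfolding assms(5) using type2_kI[OF xs(1) less_imp_le[OF xs(2)]] xs(3) iff(2) that by auto
    show "admissible3 r k M" if "k1 = 0" "N < ereal (M k1)"
      unfolding assms(5) using type3_kI[OF xs that(1)] iff(3) that(2) by simp
  qed
  have three: "(admissible1 r k2 M \<and> N \<le> ereal (M k1)) \<or>
      (admissible2 r k2 M \<and> k1 > 0 \<and> ereal (M k1) = N) \<or>
      (admissible2 r k2 M \<and> k1 = 0 \<and> N \<le> ereal (M k1))" if "admissible r k M"
  proof -
    obtain xs where xs: "knots xs" "length xs \<le> d - 2" "\<forall>e\<in>E. power_sum e xs = target e"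
      "power_sum e1 xs \<le> target e1" "length xs < d - 2 \<Longrightarrow> 0 < k1 \<Longrightarrow> power_sum e1 xs = target e1"
      using admissible_kD \<open>admissible r k M\<close> unfolding assms(5) by blast
    note iff = N_iff[OF xs(1-3)]
    show ?thesis
    proof (cases "length xs = d - 2")
      case True
      then show ?thesis using xs iff(1) unfolding type1_k2_iff by blast
    next
      case False
      then have lt: "length xs < d - 2" using xs(2) by simp
      then have "admissible2 r k2 M" using xs(1,3) unfolding type2_k2_iff by blast
      then show ?thesis using iff xs(4,5) lt by (cases "k1 = 0") auto
    qed
  qed
  have adm: "admissible1 r k M \<Longrightarrow> admissible r k M" "admissible2 r k M \<Longrightarrow> admissible r k M"
    "admissible3 r k M \<Longrightarrow> admissible r k M"
    by (simp_all add: admissible1_def admissible2_def admissible3_def)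
  show ?thesis
    unfolding Let_def N_def[symmetric]
    using one two three adm by (metis order_le_less)
qed

end
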